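(* Let $w,B_L,B_R>0$ be fixed. (i) There exists exactly one traveling wave shape for the finite frame $[-B_L,B_R]$ and speed $w$, i.e. exactly one distribution $\gamma$ concentrated on $[-B_L,B_R]$ with $\gamma=A^{(w;B_L,B_R)}\gamma$. It is denoted $\mathcal T(w;B_L,B_R)$. (ii) A distribution function $\gamma$ equals $\mathcal T(w;B_L,B_R)$ if and only if it satisfies all of the following conditions, where $$\zeta(x):=\int_{[-B_L,x]}\bar\eta(y,\gamma)\,\bar J(x-y)\,d\gamma(y)$$ (the integral includes a possible atom of $\gamma$ at $-B_L$): (1) $\gamma$ is $1/w$-Lipschitz on $[-B_L,B_R]$; (2) $\gamma(-B_L-)=0<\gamma(-B_L)$ and $\gamma(B_R)=1$; (3) Lebesgue-almost every $x\in(-B_L,B_R)$ is regular, meaning that the derivative $\gamma'(x)$ exists, and at each regular point $w\,\gamma'(x)=\zeta(x)$; (4) $\zeta$ is RCLL on $[-B_L,B_R]$, and $\zeta(x-)\ge\zeta(x)$ for $x\in(-B_L,B_R]$; (5) $w\frac{d^+}{dx}\gamma(x)=\zeta(x)$ for all $x\in[-B_L,B_R)$, and $w\frac{d^-}{dx}\gamma(x)=\zeta(x-)$ for all $x\in(-B_L,B_R]$; (6) $\inf_{x\in[-B_L,B_R]}\zeta(x)>0$.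
   Context: RCLL means right-continuous with left limits; $\frac{d^+}{dx}$, $\frac{d^-}{dx}$ are right and left derivatives. A distribution function is a non-decreasing RCLL function on $\mathbb{R}$ with limits $0$ and $1$ at $-\infty$ and $+\infty$. Standing assumptions: $\eta:[0,1]\to[0,1]$ is continuous and strictly decreasing with $\eta(0)=1$, $\eta(1)=0$; $J$ is the CDF of a probability distribution on $[0,\infty)$ with $\int_0^\infty y^\ell\,dJ(y)<\infty$ for some integer $\ell\ge2$ and normalized mean $\int_0^\infty y\,dJ(y)=1$; $\bar J=1-J$. For a distribution function $\gamma$ and $y\in\mathbb{R}$, $\bar\eta(y,\gamma)=\eta(\gamma(y))$ if $\gamma$ is continuous at $y$, and otherwise $\bar\eta(y,\gamma)=(\nu_2-\nu_1)^{-1}\int_{\nu_1}^{\nu_2}\eta(\nu)\,d\nu$ with $\nu_1=\gamma(y-)$, $\nu_2=\gamma(y)$. Operator $A^{(w;B_L,B_R)}$: let $\gamma$ be a distribution concentrated on $[-B_L,B_R]$ (i.e. $\gamma(-B_L-)=0$, $\gamma(B_R)=1$). Consider the Markov process $X(\cdot)$ on $[-B_L,B_R]$ (location of a single particle): between jumps it moves left at constant speed $w$ until it reaches $-B_L$, where it stays until its next jump; it gets urges to jump at the points of a rate $1$ Poisson process; at an urge at time $t$ it actually jumps with probability $\bar\eta(X(t),\gamma)$; a jump displaces it to the right by an amount drawn from $J$ (jump sizes i.i.d.), except that if this would take it to the right of $B_R$ it lands at $B_R$. This process is positive Harris recurrent and $A^{(w;B_L,B_R)}\gamma$ is its unique stationary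 distribution (also concentrated on $[-B_L,B_R]$). A traveling wave shape for the finite frame $[-B_L,B_R]$ and speed $w$ is a distribution $\gamma$ concentrated on $[-B_L,B_R]$ with $\gamma=A^{(w;B_L,B_R)}\gamma$. *)

theory Defs
  imports "HOL-Probability.Probability"
begin

text \<open>The one-sided filters are restricted to \<open>S\<close>, so both conditions are vacuous at a point of
  \<open>S\<close> which cannot be approached from the corresponding side within \<open>S\<close>.\<close>

definition rcll_on :: "real set \<Rightarrow> (real \<Rightarrow> real) \<Rightarrow> bool" where
  "rcll_on S f \<longleftrightarrow> (\<forall>x\<in>S. (f \<longlongrightarrow> f x) (at x within S \<inter> {x<..})
                          \<and> (\<exists>l. (f \<longlongrightarrow> l) (at x within S \<inter> {..<x})))"

definition left_lim :: "(real \<Rightarrow> real) \<Rightarrow> real \<Rightarrow> real" where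
  "left_lim f x = Lim (at_left x) f"

definition dist_fun :: "(real \<Rightarrow> real) \<Rightarrow> bool" where
  "dist_fun F \<longleftrightarrow> mono F \<and> rcll_on UNIV F \<and> (F \<longlongrightarrow> 0) at_bot \<and> (F \<longlongrightarrow> 1) at_top"

definition dist_fun_on_frame :: "real \<Rightarrow> real \<Rightarrow> (real \<Rightarrow> real) \<Rightarrow> bool" where
  "dist_fun_on_frame BL BR F \<longleftrightarrow> dist_fun F \<and> left_lim F (- BL) = 0 \<and> F BR = 1"

definition etabar :: "(real \<Rightarrow> real) \<Rightarrow> real \<Rightarrow> (real \<Rightarrow> real) \<Rightarrow> real" where
  "etabar \<eta> y \<gamma> =
     (if isCont \<gamma> y then \<eta> (\<gamma> y)
      else inverse (\<gamma> y - left_lim \<gamma> y) * integral {left_lim \<gamma> y..\<gamma> y} \<eta>)"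

text \<open>The process is driven by an i.i.d. sequence of triples: the rate 1 exponential time
  between two consecutive urges, a uniform variable on \<open>[0,1]\<close> deciding whether the urge leads to a
  jump, and the size of the jump, distributed according to \<open>J\<close>.\<close>

definition driving :: "(real \<Rightarrow> real) \<Rightarrow> (nat \<Rightarrow> real \<times> real \<times> real) measure" where
  "driving J = Pi\<^sub>M UNIV (\<lambda>_. density lborel (\<lambda>s. ennreal (exponential_density 1 s))
      \<Otimes>\<^sub>M (uniform_measure lborel {0..1} \<Otimes>\<^sub>M interval_measure J))"

definition drift :: "real \<Rightarrow> real \<Rightarrow> real \<Rightarrow> real \<Rightarrow> real" where
  "drift w BL s x = max (- BL) (x - w * s)"

text \<open>Location right after the \<open>n\<close>-th urge (initial location for \<open>n = 0\<close>); the location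
  just before the urge determines the jump probability.\<close>

primrec after_urge :: "(real \<Rightarrow> real) \<Rightarrow> real \<Rightarrow> real \<Rightarrow> real \<Rightarrow> (real \<Rightarrow> real)
    \<Rightarrow> real \<Rightarrow> (nat \<Rightarrow> real \<times> real \<times> real) \<Rightarrow> nat \<Rightarrow> real" where
  "after_urge \<eta> w BL BR \<gamma> x \<omega> 0 = x"
| "after_urge \<eta> w BL BR \<gamma> x \<omega> (Suc n) =
     (case \<omega> n of (s, u, y) \<Rightarrow>
        (let z = drift w BL s (after_urge \<eta> w BL BR \<gamma> x \<omega> n)
         in if u < etabar \<eta> z \<gamma> then min (z + y) BR else z))"

definition urge_time :: "(nat \<Rightarrow> real \<times> real \<times> real) \<Rightarrow> nat \<Rightarrow> real" where
  "urge_time \<omega> n = (\<Sum>k<n. fst (\<omega> k))"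

definition urge_count :: "(nat \<Rightarrow> real \<times> real \<times> real) \<Rightarrow> real \<Rightarrow> nat" where
  "urge_count \<omega> t = card {n. n \<ge> 1 \<and> urge_time \<omega> n \<le> t}"

definition location :: "(real \<Rightarrow> real) \<Rightarrow> real \<Rightarrow> real \<Rightarrow> real \<Rightarrow> (real \<Rightarrow> real)
    \<Rightarrow> real \<Rightarrow> (nat \<Rightarrow> real \<times> real \<times> real) \<Rightarrow> real \<Rightarrow> real" where
  "location \<eta> w BL BR \<gamma> x \<omega> t =
     (let n = urge_count \<omega> t
      in drift w BL (t - urge_time \<omega> n) (after_urge \<eta> w BL BR \<gamma> x \<omega> n))"

text \<open>\<open>\<pi>\<close> is stationary: started from an initial location with distribution \<open>\<pi>\<close>, independent of the
  driving sequence, the process has distribution \<open>\<pi>\<close> at all times.\<close>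

definition stationary :: "(real \<Rightarrow> real) \<Rightarrow> (real \<Rightarrow> real) \<Rightarrow> real \<Rightarrow> real \<Rightarrow> real
    \<Rightarrow> (real \<Rightarrow> real) \<Rightarrow> (real \<Rightarrow> real) \<Rightarrow> bool" where
  "stationary \<eta> J w BL BR \<gamma> \<pi> \<longleftrightarrow>
     (\<forall>t\<ge>0. distr (interval_measure \<pi> \<Otimes>\<^sub>M driving J) borel
               (\<lambda>(x, \<omega>). location \<eta> w BL BR \<gamma> x \<omega> t) = interval_measure \<pi>)"

definition opA :: "(real \<Rightarrow> real) \<Rightarrow> (real \<Rightarrow> real) \<Rightarrow> real \<Rightarrow> real \<Rightarrow> real
    \<Rightarrow> (real \<Rightarrow> real) \<Rightarrow> (real \<Rightarrow> real)" where
  "opA \<eta> J w BL BR \<gamma> = (THE \<pi>. dist_fun_on_frame BL BR \<pi> \<and> stationary \<eta> J w BL BR \<gamma> \<pi>)"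

definition travelling_wave_shape :: "(real \<Rightarrow> real) \<Rightarrow> (real \<Rightarrow> real) \<Rightarrow> real \<Rightarrow> real \<Rightarrow> real
    \<Rightarrow> (real \<Rightarrow> real) \<Rightarrow> bool" where
  "travelling_wave_shape \<eta> J w BL BR \<gamma> \<longleftrightarrow>
     dist_fun_on_frame BL BR \<gamma> \<and> \<gamma> = opA \<eta> J w BL BR \<gamma>"

definition TW :: "(real \<Rightarrow> real) \<Rightarrow> (real \<Rightarrow> real) \<Rightarrow> real \<Rightarrow> real \<Rightarrow> real \<Rightarrow> (real \<Rightarrow> real)" where
  "TW \<eta> J w BL BR = (THE \<gamma>. travelling_wave_shape \<eta> J w BL BR \<gamma>)"

definition zeta :: "(real \<Rightarrow> real) \<Rightarrow> (real \<Rightarrow> real) \<Rightarrow> real \<Rightarrow> (real \<Rightarrow> real) \<Rightarrow> real \<Rightarrow> real" where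
  "zeta \<eta> J BL \<gamma> x =
     (LINT y:{- BL..x}|interval_measure \<gamma>. etabar \<eta> y \<gamma> * (1 - J (x - y)))"

end

theory Submission
  imports Defs
begin

text \<open>
  A law \<open>\<mu>\<close> on the frame is stationary for the particle moving in a given environment \<open>\<gamma>\<close> exactly when mass
  crosses every point \<open>x\<close> leftwards (by drift, at rate \<open>w \<mu>'(x)\<close>) as fast as it crosses \<open>x\<close> rightwards
  (by jumps, at rate \<open>\<integral> p(y) (1 - J(x - y)) d\<mu>(y)\<close> over \<open>y \<le> x\<close>, with \<open>p(y)\<close> the jump probability at \<open>y\<close>).
  Integrated in \<open>x\<close>, this is the predicate \<open>flux_balanced\<close>, which is linear in \<open>\<mu>\<close>.

  Flux balance implies stationarity without semigroup theory. By comparing distribution functions one finds that a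
  flux-balanced \<open>\<mu>\<close> is reproduced by looking back from time \<open>t\<close> to the last urge (\<open>lookback_law\<close>): wait an
  exponential time \<open>s\<close>; if \<open>s \<le> t\<close>, let the particle decide about a jump and then drift for a time \<open>s\<close>, else only let
  it drift for a time \<open>t\<close>. The law of the location at time \<open>t\<close>, split by the number of urges, satisfies a
  recursion of the same form (\<open>urge_part_Suc\<close>), so all its partial sums are dominated by \<open>\<mu>\<close>; two probability
  measures one of which dominates the other coincide. Stationary laws are unique (\<open>stationary_unique\<close>),
  since during a long time without urges every starting point is driven into \<open>- BL\<close>. A flux-balanced law
  exists for every environment, by solving a linear Volterra equation. Hence \<open>opA\<close> maps \<open>\<gamma>\<close> to its unique
  flux-balanced law, and travelling waves are the \<open>\<gamma>\<close> that are flux balanced with respect to themselves.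

  For such \<open>\<gamma>\<close> the problem closes: \<open>\<gamma>\<close> is Lipschitz on the frame, thus \<open>p(y) d\<gamma>(y)\<close> has the distribution function
  \<open>H \<circ> \<gamma>\<close> with \<open>H\<close> the primitive of \<open>\<eta>\<close> -- the averaging in \<open>etabar\<close> makes this true at the atom in \<open>- BL\<close> as
  well -- and flux balance becomes the scalar Volterra equation
  \<open>w \<gamma>(x) = w \<gamma>(- BL) + \<integral> (1 - J(x - u)) H(\<gamma>(u)) du\<close> over \<open>- BL \<le> u \<le> x\<close> (\<open>balanced_iff_volterra\<close>). Its right-hand side is
  monotone and Lipschitz in \<open>\<gamma>\<close>, so for each size \<open>a\<close> of the atom there is one solution, which depends continuously
  on \<open>a\<close> and increases strictly with it. Exactly one \<open>a\<close> yields \<open>\<gamma>(BR) = 1\<close>.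

  The one-sided derivatives in the characterisation follow from the fundamental theorem of calculus, as \<open>\<zeta>\<close>
  is the difference of the continuous function \<open>H \<circ> \<gamma>\<close> and a right-continuous monotone one. Conversely,
  the right derivatives determine \<open>\<gamma>\<close> up to its atom and so give flux balance back.
\<close>

section \<open>Distribution functions and mean jump probabilities\<close>

lemma dist_fun_mono: "dist_fun F \<Longrightarrow> x \<le> y \<Longrightarrow> F x \<le> F y"
  by (auto simp: dist_fun_def mono_def)

lemma dist_fun_right_cont: "dist_fun F \<Longrightarrow> continuous (at_right x) F"
  by (auto simp: dist_fun_def rcll_on_def continuous_within)

lemma left_lim_eqI: "(f \<longlongrightarrow> k) (at_left (x::real)) \<Longrightarrow> left_lim f x = k"
  unfolding left_lim_def by (rule tendsto_Lim) auto

lemma real_distribution_of_dist_fun: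
  assumes "dist_fun F"
  shows "real_distribution (interval_measure F)"
  using assms dist_fun_mono[OF assms] dist_fun_right_cont[OF assms]
  by (intro real_distribution_interval_measure) (auto simp: dist_fun_def)

lemma cdf_of_dist_fun:
  assumes "dist_fun F"
  shows "cdf (interval_measure F) = F"
  using assms dist_fun_mono[OF assms] dist_fun_right_cont[OF assms]
  by (intro cdf_interval_measure) (auto simp: dist_fun_def)

lemma measure_of_dist_fun: "dist_fun F \<Longrightarrow> measure (interval_measure F) {..x} = F x"
  using cdf_of_dist_fun[of F] by (metis cdf_def)

lemma emeasure_of_dist_fun:
  assumes "dist_fun F"
  shows "emeasure (interval_measure F) {..x} = ennreal (F x)"
proof -
  interpret real_distribution "interval_measure F" by (rule real_distribution_of_dist_fun[OF assms])
  show ?thesis using measure_of_dist_fun[OF assms, of x] by (simp add: emeasure_eq_measure)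
qed

lemma dist_fun_bounds: assumes "dist_fun F" shows "0 \<le> F x" "F x \<le> 1"
proof -
  interpret real_distribution "interval_measure F" by (rule real_distribution_of_dist_fun[OF assms])
  show "0 \<le> F x" "F x \<le> 1" by (metis assms measure_of_dist_fun measure_nonneg, metis assms measure_of_dist_fun prob_le_1)
qed

lemma left_lim_eq_measure:
  assumes "dist_fun F"
  shows "left_lim F x = measure (interval_measure F) {..<x}"
proof -
  interpret real_distribution "interval_measure F" by (rule real_distribution_of_dist_fun[OF assms])
  show ?thesis using cdf_at_left[of x] cdf_of_dist_fun[OF assms] by (auto intro: left_lim_eqI)
qed

lemma dist_fun_cdf:
  assumes "real_distribution M"
  shows "dist_fun (cdf M)"
proof -
  interpret real_distribution M by fact
  show ?thesis
    unfolding dist_fun_def rcll_on_def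
    using cdf_nondecreasing cdf_is_right_cont cdf_lim_at_bot cdf_lim_at_top_prob cdf_at_left
    by (auto simp: mono_def continuous_within intro!: exI)
qed

lemma interval_measure_of_cdf:
  assumes "real_distribution M"
  shows "interval_measure (cdf M) = M"
  by (intro cdf_unique real_distribution_of_dist_fun dist_fun_cdf assms cdf_of_dist_fun)

lemma borel_measurable_dist_fun[measurable_dest]: "dist_fun F \<Longrightarrow> F \<in> borel_measurable borel"
  by (auto simp: dist_fun_def intro: borel_measurable_mono)

lemma frame_AE:
  assumes "dist_fun_on_frame BL BR F"
  shows "AE x in interval_measure F. - BL \<le> x \<and> x \<le> BR"
proof -
  have F: "dist_fun F" using assms by (auto simp: dist_fun_on_frame_def)
  interpret real_distribution "interval_measure F" by (rule real_distribution_of_dist_fun[OF F])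
  have "measure (interval_measure F) {..<- BL} = 0"
    using left_lim_eq_measure[OF F] assms by (auto simp: dist_fun_on_frame_def)
  then have "AE x in interval_measure F. x \<notin> {..<- BL}"
    by (intro AE_not_in) (auto simp: null_sets_def emeasure_eq_measure)
  moreover have "AE x in interval_measure F. x \<in> {..BR}"
    using measure_of_dist_fun[OF F, of BR] assms
    by (intro AE_prob_1) (auto simp: dist_fun_on_frame_def)
  ultimately show ?thesis by eventually_elim auto
qed

lemma frame_AE_iff:
  assumes "real_distribution M"
  shows "dist_fun_on_frame BL BR (cdf M) \<longleftrightarrow> (AE x in M. - BL \<le> x \<and> x \<le> BR)"
proof
  assume "dist_fun_on_frame BL BR (cdf M)"
  from frame_AE[OF this] show "AE x in M. - BL \<le> x \<and> x \<le> BR"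
    unfolding interval_measure_of_cdf[OF assms] .
next
  interpret real_distribution M by fact
  assume *: "AE x in M. - BL \<le> x \<and> x \<le> BR"
  have "measure M {..<-BL} = 0"
    using * by (subst measure_eq_0_null_sets) (auto intro!: AE_iff_null_sets[THEN iffD2] elim!: eventually_mono)
  moreover have "measure M {..BR} = 1"
    using * by (intro prob_eq_1[THEN iffD2]) (auto elim!: eventually_mono)
  ultimately show "dist_fun_on_frame BL BR (cdf M)"
    using left_lim_eq_measure[OF dist_fun_cdf[OF assms], of "-BL"] interval_measure_of_cdf[OF assms]
      dist_fun_cdf[OF assms]
    by (auto simp: dist_fun_on_frame_def cdf_def)
qed

locale decreasing_response =
  fixes \<eta> :: "real \<Rightarrow> real"
  assumes eta_range: "\<eta> ` {0..1} \<subseteq> {0..1}"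
    and eta_cont: "continuous_on {0..1} \<eta>"
    and eta_decr: "strict_antimono_on {0..1} \<eta>"
    and eta_ends: "\<eta> 0 = 1" "\<eta> 1 = 0"
begin

lemma eta_bounds: "0 \<le> v \<Longrightarrow> v \<le> 1 \<Longrightarrow> 0 \<le> \<eta> v \<and> \<eta> v \<le> 1"
  using eta_range by (auto simp: image_subset_iff)

lemma eta_less: "0 \<le> u \<Longrightarrow> u < v \<Longrightarrow> v \<le> 1 \<Longrightarrow> \<eta> v < \<eta> u"
  using eta_decr by (auto simp: monotone_on_def)

lemma eta_le: "0 \<le> u \<Longrightarrow> u \<le> v \<Longrightarrow> v \<le> 1 \<Longrightarrow> \<eta> v \<le> \<eta> u"
  using eta_less[of u v] by (cases "u = v") auto

lemma eta_integrable: "0 \<le> a \<Longrightarrow> b \<le> 1 \<Longrightarrow> \<eta> integrable_on {a..b}"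
  by (intro integrable_continuous_interval continuous_on_subset[OF eta_cont]) auto

lemma left_lim_bounds:
  assumes "dist_fun \<gamma>"
  shows "0 \<le> left_lim \<gamma> y" "left_lim \<gamma> y \<le> \<gamma> y"
proof -
  interpret real_distribution "interval_measure \<gamma>" by (rule real_distribution_of_dist_fun[OF assms])
  show "0 \<le> left_lim \<gamma> y" "left_lim \<gamma> y \<le> \<gamma> y"
    using left_lim_eq_measure[OF assms, of y] measure_of_dist_fun[OF assms, of y]
    by (auto simp flip: measure_of_dist_fun[OF assms] intro!: finite_measure_mono)
qed

lemma etabar_bounds:
  assumes "dist_fun \<gamma>"
  shows "0 \<le> etabar \<eta> y \<gamma>" "etabar \<eta> y \<gamma> \<le> 1"
proof -
  define a b where "a = left_lim \<gamma> y" and "b = \<gamma> y"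
  have ab: "0 \<le> a" "a \<le> b" "b \<le> 1"
    using left_lim_bounds[OF assms] dist_fun_bounds[OF assms] by (auto simp: a_def b_def)
  have "0 \<le> integral {a..b} \<eta>" using ab eta_bounds by (intro integral_nonneg eta_integrable) auto
  moreover have "integral {a..b} \<eta> \<le> integral {a..b} (\<lambda>_. 1)"
    using ab eta_bounds by (intro integral_le eta_integrable) auto
  ultimately have "0 \<le> inverse (b - a) * integral {a..b} \<eta>" "inverse (b - a) * integral {a..b} \<eta> \<le> 1"
    using ab by (auto intro!: divide_le_eq_1[THEN iffD2] simp: inverse_eq_divide)
  then show "0 \<le> etabar \<eta> y \<gamma>" "etabar \<eta> y \<gamma> \<le> 1"
    using eta_bounds[of "\<gamma> y"] dist_fun_bounds[OF assms, of y] by (auto simp: etabar_def a_def b_def)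
qed

text \<open>Away from the countably many atoms of \<open>\<gamma>\<close> the jump probability is the monotone function
  \<open>\<eta> \<circ> \<gamma>\<close>; countably many values do not affect measurability.\<close>

lemma etabar_measurable:
  assumes "dist_fun \<gamma>"
  shows "(\<lambda>y. etabar \<eta> y \<gamma>) \<in> borel_measurable borel"
proof (rule measurable_discrete_difference)
  have "mono (\<lambda>y. - \<eta> (\<gamma> y))"
    using eta_le dist_fun_bounds[OF assms] dist_fun_mono[OF assms] by (auto simp: mono_def)
  then have "(\<lambda>y. - (- \<eta> (\<gamma> y))) \<in> borel_measurable borel"
    by (intro borel_measurable_uminus borel_measurable_mono)
  then show "(\<lambda>y. \<eta> (\<gamma> y)) \<in> borel_measurable borel" by simp
  show "countable {y. \<not> isCont \<gamma> y}"
    using assms by (intro mono_ctble_discont) (auto simp: dist_fun_def)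
qed (auto simp: etabar_def)

end

section \<open>Flux balance and the look-back identity\<close>

text \<open>The rate at which mass distributed by \<open>M\<close> is thrown across \<open>c\<close> from the left, when a particle in \<open>y\<close>
  jumps at rate \<open>p y\<close>. It takes values in \<open>ennreal\<close>, so that Tonelli applies without integrability conditions.\<close>

definition flux :: "(real \<Rightarrow> real) \<Rightarrow> (real \<Rightarrow> real) \<Rightarrow> real measure \<Rightarrow> real \<Rightarrow> ennreal" where
  "flux p J M c = (\<integral>\<^sup>+y. ennreal (p y * (1 - J (c - y))) * indicator {..c} y \<partial>M)"

text \<open>The differential equation \<open>w M' = flux\<close> in integrated form, which presupposes neither a density nor
  continuity of \<open>M\<close>; the atom in \<open>- BL\<close> is left free.\<close>

definition flux_balanced :: "real \<Rightarrow> real \<Rightarrow> real \<Rightarrow> (real \<Rightarrow> real) \<Rightarrow> (real \<Rightarrow> real) \<Rightarrow> real measure \<Rightarrow> bool" where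
  "flux_balanced w BL BR p J M \<longleftrightarrow>
     (\<forall>x\<in>{- BL..BR}. ennreal w * emeasure M {..x} =
        ennreal w * emeasure M {..- BL} + (\<integral>\<^sup>+u. flux p J M u * indicator {- BL..x} u \<partial>lborel))"

abbreviation waiting_time :: "real measure" where
  "waiting_time \<equiv> density lborel (\<lambda>s. ennreal (exponential_density 1 s))"

abbreviation decision :: "(real \<Rightarrow> real) \<Rightarrow> (real \<times> real) measure" where
  "decision J \<equiv> uniform_measure lborel {0..1} \<Otimes>\<^sub>M interval_measure J"

lemma prob_space_waiting_time: "prob_space waiting_time"
  by (rule prob_space_exponential_density) simp

lemma AE_waiting_time: "AE s in waiting_time. 0 < s"
proof -
  have "AE s in lborel. s \<noteq> (0::real)" by (rule AE_lborel_singleton)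
  then show ?thesis
    by (subst AE_density) (auto simp: exponential_density_def elim!: eventually_mono)
qed

lemma waiting_time_tail:
  assumes "0 \<le> r"
  shows "emeasure waiting_time {r<..} = ennreal (exp (- r))"
proof -
  interpret prob_space waiting_time by (rule prob_space_waiting_time)
  have "distributed waiting_time lborel (\<lambda>x. x) (exponential_density 1)"
    by (auto simp: distributed_def distr_id2)
  from exponential_distributedD_gt[OF this assms] show ?thesis
    by (simp add: emeasure_eq_measure greaterThan_def)
qed

lemma nn_integral_pair:
  assumes "prob_space N" "f \<in> borel_measurable (M \<Otimes>\<^sub>M N)"
  shows "(\<integral>\<^sup>+z. f z \<partial>(M \<Otimes>\<^sub>M N)) = (\<integral>\<^sup>+x. (\<integral>\<^sup>+y. f (x, y) \<partial>N) \<partial>M)"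
  using sigma_finite_measure.nn_integral_fst[OF prob_space_imp_sigma_finite[OF assms(1)] assms(2)] by simp

locale jump_frame = decreasing_response +
  fixes J :: "real \<Rightarrow> real" and w BL BR :: real
  assumes J_dist: "dist_fun J"
    and J_nonneg: "\<And>y. y < 0 \<Longrightarrow> J y = 0"
    and pos: "w > 0" "BL > 0" "BR > 0"
begin

lemma J_measurable[measurable]: "J \<in> borel_measurable borel"
  by (rule borel_measurable_dist_fun[OF J_dist])

lemma J_bounds[simp]: "0 \<le> J y" "J y \<le> 1"
  using dist_fun_bounds[OF J_dist] by auto

end

locale particle = jump_frame +
  fixes \<gamma> :: "real \<Rightarrow> real"
  assumes \<gamma>_dist: "dist_fun \<gamma>"
begin

abbreviation p :: "real \<Rightarrow> real" where "p y \<equiv> etabar \<eta> y \<gamma>"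

lemma p_bounds[simp]: "0 \<le> p y" "p y \<le> 1"
  using etabar_bounds[OF \<gamma>_dist] by auto

lemma p_measurable[measurable]: "p \<in> borel_measurable borel"
  by (rule etabar_measurable[OF \<gamma>_dist])

sublocale J: real_distribution "interval_measure J"
  by (rule real_distribution_of_dist_fun[OF J_dist])

sublocale U: prob_space "uniform_measure lborel {0..1::real}"
  by (rule prob_space_uniform_measure) auto

sublocale UJ: pair_prob_space "uniform_measure lborel {0..1::real}" "interval_measure J" ..

sublocale Exp: prob_space waiting_time by (rule prob_space_waiting_time)

lemma J_AE: "AE y in interval_measure J. 0 \<le> y"
proof -
  have "(J \<longlongrightarrow> 0) (at_left 0)"
    by (rule tendsto_eventually) (auto simp: eventually_at_filter J_nonneg)
  then have "left_lim J 0 = 0" by (rule left_lim_eqI)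
  then have "emeasure (interval_measure J) {..<0} = 0"
    using left_lim_eq_measure[OF J_dist, of 0] by (simp add: J.emeasure_eq_measure)
  then have "AE y in interval_measure J. y \<notin> {..<0}"
    by (intro AE_not_in) (auto simp: null_sets_def)
  then show ?thesis by eventually_elim auto
qed

lemma emeasure_J_gt: "emeasure (interval_measure J) {c<..} = ennreal (1 - J c)"
proof -
  have "{c<..} = space (interval_measure J) - {..c}" by auto
  then have "measure (interval_measure J) {c<..} = 1 - J c"
    using J.prob_compl[of "{..c}"] measure_of_dist_fun[OF J_dist] by auto
  then show ?thesis by (simp add: J.emeasure_eq_measure)
qed

lemma emeasure_U_less:
  assumes "0 \<le> a" "a \<le> (1::real)"
  shows "emeasure (uniform_measure lborel {0..1}) {..<a} = ennreal a"
proof -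
  have "{0..1} \<inter> {..<a} = {0..<a}" using assms by auto
  then have "emeasure lborel ({0..1} \<inter> {..<a}) = ennreal a" using assms(1) by simp
  then show ?thesis using assms(1) divide_ennreal[of a 1]
    by (subst emeasure_uniform_measure) simp_all
qed

text \<open>\<open>v\<close> consists of the uniform variable that decides about the jump and of the jump size.\<close>

definition landing :: "real \<Rightarrow> real \<times> real \<Rightarrow> real" where
  "landing z v = (if fst v < p z then min (z + snd v) BR else z)"

lemma landing_measurable[measurable]:
  assumes [measurable]: "f \<in> borel_measurable N" "g \<in> measurable N (decision J)"
  shows "(\<lambda>x. landing (f x) (g x)) \<in> borel_measurable N"
proof -
  have [measurable]: "(\<lambda>x. fst (g x)) \<in> borel_measurable N" "(\<lambda>x. snd (g x)) \<in> borel_measurable N"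
    using measurable_compose[OF assms(2) measurable_fst] measurable_compose[OF assms(2) measurable_snd]
    by (auto simp: measurable_def)
  show ?thesis unfolding landing_def by measurable
qed

lemma drift_measurable[measurable]:
  assumes [measurable]: "f \<in> borel_measurable N" "g \<in> borel_measurable N"
  shows "(\<lambda>x. drift w BL (f x) (g x)) \<in> borel_measurable N"
  unfolding drift_def by measurable

lemma drift_le_iff: "- BL \<le> b \<Longrightarrow> drift w BL s x \<le> b \<longleftrightarrow> x \<le> b + w * s"
  by (auto simp: drift_def)

lemma drift_ge: "- BL \<le> drift w BL s x"
  by (auto simp: drift_def)

lemma decision_jump_over:
  "emeasure (decision J) {v. fst v < p z \<and> c < snd v} = ennreal (p z * (1 - J c))"
proof -
  have "{v. fst v < p z \<and> c < snd v} = {..<p z} \<times> {c<..}" by auto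
  then have "emeasure (decision J) {v. fst v < p z \<and> c < snd v} =
      emeasure (uniform_measure lborel {0..1}) {..<p z} * emeasure (interval_measure J) {c<..}"
    by (simp add: J.emeasure_pair_measure_Times)
  also have "\<dots> = ennreal (p z * (1 - J c))"
    using emeasure_U_less[of "p z"] by (simp add: emeasure_J_gt ennreal_mult del: emeasure_uniform_measure)
  finally show ?thesis .
qed

text \<open>An urge moves mass only to the right, so the probability with which a particle in \<open>z \<le> c\<close> leaves
  \<open>{..c}\<close> is its contribution to the flux. If \<open>c \<ge> BR\<close>, it could not leave, as jumps are stopped in \<open>BR\<close>.\<close>

lemma landing_below:
  assumes "c < BR"
  shows "(\<integral>\<^sup>+v. indicator {..c} (landing z v) \<partial>decision J) + ennreal (p z * (1 - J (c - z))) * indicator {..c} z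
    = indicator {..c} z"
proof (cases "z \<le> c")
  case True
  define E where "E = {v. fst v < p z \<and> c - z < snd v}"
  have E: "E = {..<p z} \<times> {c - z<..}" by (auto simp: E_def)
  have Em[measurable]: "E \<in> sets (decision J)" unfolding E by simp
  have "(\<integral>\<^sup>+v. indicator {..c} (landing z v) \<partial>decision J) + emeasure (decision J) E
     = (\<integral>\<^sup>+v. indicator {..c} (landing z v) \<partial>decision J) + (\<integral>\<^sup>+v. indicator E v \<partial>decision J)"
    by (simp only: nn_integral_indicator[OF Em])
  also have "\<dots> = (\<integral>\<^sup>+v. indicator {..c} (landing z v) + indicator E v \<partial>decision J)"
    by (rule nn_integral_add[symmetric]) measurable
  also have "\<dots> = (\<integral>\<^sup>+v. 1 \<partial>decision J)"
    using True assms
    by (intro nn_integral_cong) (simp add: landing_def indicator_def E_def min_def not_less not_le)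
  also have "\<dots> = 1" using UJ.emeasure_space_1 by (simp only: nn_integral_const mult_1)
  finally show ?thesis using True decision_jump_over[of z "c - z"] by (simp add: E_def)
next
  case False
  have "AE v in decision J. landing z v > c"
  proof -
    have "AE v in decision J. 0 \<le> snd v"
    proof (rule UJ.AE_pair_measure)
      have "{x \<in> space (decision J). 0 \<le> snd x} = UNIV \<times> {0..}" by (auto simp: space_pair_measure)
      then show "{x \<in> space (decision J). 0 \<le> snd x} \<in> sets (decision J)" by simp
    qed (use J_AE in simp)
    then show ?thesis
      by (rule AE_mp) (use False assms in \<open>auto simp: landing_def intro!: AE_I2\<close>)
  qed
  then have "(\<integral>\<^sup>+v. indicator {..c} (landing z v) \<partial>decision J) = (\<integral>\<^sup>+v. 0 \<partial>decision J)"
    by (intro nn_integral_cong_AE) (auto elim!: eventually_mono simp: indicator_def)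
  then show ?thesis using False by simp
qed


lemma flux_measurable:
  assumes "real_distribution M"
  shows "flux p J M \<in> borel_measurable borel"
proof -
  interpret real_distribution M by (rule assms)
  have "flux p J M = (\<lambda>c. \<integral>\<^sup>+y. (if y \<le> c then ennreal (p y * (1 - J (c - y))) else 0) \<partial>M)"
    by (auto simp: flux_def indicator_def fun_eq_iff intro!: nn_integral_cong)
  then show ?thesis by simp
qed

lemma flux_le_1:
  assumes "real_distribution M"
  shows "flux p J M c \<le> 1"
proof -
  interpret real_distribution M by (rule assms)
  have "flux p J M c \<le> (\<integral>\<^sup>+y. 1 \<partial>M)"
    unfolding flux_def
    by (intro nn_integral_mono) (auto simp: indicator_def intro!: mult_le_one)
  then show ?thesis using emeasure_space_1 by simp
qed

end

locale balanced_law = particle +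
  fixes M :: "real measure"
  assumes M: "real_distribution M"
    and M_frame: "AE x in M. - BL \<le> x \<and> x \<le> BR"
    and M_balanced: "flux_balanced w BL BR p J M"
begin

sublocale M: real_distribution M by (rule M)

lemmas flux_M_measurable[measurable] = flux_measurable[OF M]

text \<open>Beyond \<open>BR\<close> nothing is thrown, as all jumps are stopped in \<open>BR\<close>. With this convention the
  balance equations hold on all of \<open>[- BL, \<infinity>)\<close>, beyond \<open>BR\<close> for the trivial reason that no mass is left.\<close>

definition cut_flux :: "real \<Rightarrow> ennreal" where "cut_flux c = (if c < BR then flux p J M c else 0)"

lemma cut_flux_measurable[measurable]: "cut_flux \<in> borel_measurable borel"
  unfolding cut_flux_def by measurable

lemma cut_flux_le_1: "cut_flux c \<le> 1"
  using flux_le_1[OF M] by (simp add: cut_flux_def)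

lemma emeasure_above:
  assumes "BR \<le> c"
  shows "emeasure M {..c} = 1"
proof (rule M.emeasure_eq_1_AE)
  show "AE x in M. x \<in> {..c}"
    using M_frame by eventually_elim (use assms in auto)
qed simp

lemma landing_flux:
  "(\<integral>\<^sup>+x. (\<integral>\<^sup>+v. indicator {..c} (landing x v) \<partial>decision J) \<partial>M) + cut_flux c = emeasure M {..c}"
proof (cases "c < BR")
  case True
  have "(\<integral>\<^sup>+x. (\<integral>\<^sup>+v. indicator {..c} (landing x v) \<partial>decision J) \<partial>M) + cut_flux c
    = (\<integral>\<^sup>+x. (\<integral>\<^sup>+v. indicator {..c} (landing x v) \<partial>decision J)
         + ennreal (p x * (1 - J (c - x))) * indicator {..c} x \<partial>M)"
    unfolding cut_flux_def flux_def using True by (subst nn_integral_add) auto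
  also have "\<dots> = (\<integral>\<^sup>+x. indicator {..c} x \<partial>M)"
    by (simp only: landing_below[OF True])
  finally show ?thesis by simp
next
  case False
  have "(\<integral>\<^sup>+x. (\<integral>\<^sup>+v. indicator {..c} (landing x v) \<partial>decision J) \<partial>M) = (\<integral>\<^sup>+x. (\<integral>\<^sup>+v. 1 \<partial>decision J) \<partial>M)"
  proof (rule nn_integral_cong_AE, use M_frame in eventually_elim)
    fix x assume "- BL \<le> x \<and> x \<le> BR"
    with False show "(\<integral>\<^sup>+v. indicator {..c} (landing x v) \<partial>decision J) = (\<integral>\<^sup>+v. 1 \<partial>decision J)"
      by (intro nn_integral_cong) (auto simp: landing_def indicator_def)
  qed
  also have "\<dots> = 1"
    using UJ.emeasure_space_1 M.emeasure_space_1 by (simp only: nn_integral_const mult_1)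
  finally show ?thesis using False emeasure_above by (simp add: cut_flux_def)
qed

lemma balance_from_bottom:
  assumes "- BL \<le> x"
  shows "ennreal w * emeasure M {..x} =
    ennreal w * emeasure M {..- BL} + (\<integral>\<^sup>+u. cut_flux u * indicator {- BL<..<x} u \<partial>lborel)"
proof -
  have *: "ennreal w * emeasure M {..x} =
    ennreal w * emeasure M {..- BL} + (\<integral>\<^sup>+u. cut_flux u * indicator {- BL<..<x} u \<partial>lborel)"
    if "- BL \<le> x" "x \<le> BR" for x
  proof -
    have "(\<integral>\<^sup>+u. flux p J M u * indicator {- BL..x} u \<partial>lborel) = (\<integral>\<^sup>+u. cut_flux u * indicator {- BL<..<x} u \<partial>lborel)"
      using AE_lborel_singleton[of "- BL"] AE_lborel_singleton[of x]
      by (intro nn_integral_cong_AE, eventually_elim) (use that in \<open>auto simp: cut_flux_def indicator_def\<close>)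
    moreover have "x \<in> {- BL..BR}" using that by simp
    ultimately show ?thesis using bspec[OF M_balanced[unfolded flux_balanced_def], of x] by (simp only:)
  qed
  show ?thesis
  proof (cases "x \<le> BR")
    case True
    then show ?thesis using *[of x] assms by simp
  next
    case False
    have "(\<integral>\<^sup>+u. cut_flux u * indicator {- BL<..<x} u \<partial>lborel) = (\<integral>\<^sup>+u. cut_flux u * indicator {- BL<..<BR} u \<partial>lborel)"
      using False by (intro nn_integral_cong) (auto simp: cut_flux_def indicator_def)
    moreover have "emeasure M {..x} = emeasure M {..BR}"
      using False emeasure_above[of BR] emeasure_above[of x] by simp
    ultimately show ?thesis using *[of BR] pos by (simp only:)
  qed
qed

text \<open>The particles found at most at \<open>b\<close> after drifting for a time \<open>r\<close> are those that start at most at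
  \<open>b + w * r\<close>; the point \<open>b + w * s\<close> is passed at time \<open>s\<close>, which turns the flux integral into one over time.\<close>

lemma balance_increment:
  assumes "- BL \<le> b" "0 \<le> r"
  shows "emeasure M {..b + w * r} =
    emeasure M {..b} + (\<integral>\<^sup>+s. cut_flux (b + w * s) * indicator {0<..<r} s \<partial>lborel)"
proof -
  have "ennreal w * emeasure M {..b + w * r} =
    ennreal w * emeasure M {..- BL} + (\<integral>\<^sup>+u. cut_flux u * indicator {- BL<..<b + w * r} u \<partial>lborel)"
    using assms pos by (intro balance_from_bottom) (auto intro: add_increasing2)
  also have "(\<integral>\<^sup>+u. cut_flux u * indicator {- BL<..<b + w * r} u \<partial>lborel) =
      (\<integral>\<^sup>+u. cut_flux u * indicator {- BL<..<b} u + cut_flux u * indicator {b<..<b + w * r} u \<partial>lborel)"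
    using AE_lborel_singleton[of b]
  proof (intro nn_integral_cong_AE, eventually_elim)
    fix u assume "u \<noteq> b"
    moreover have "b \<le> b + w * r" using assms pos by simp
    ultimately show "cut_flux u * indicator {- BL<..<b + w * r} u =
        cut_flux u * indicator {- BL<..<b} u + cut_flux u * indicator {b<..<b + w * r} u"
      using assms(1) by (auto simp: indicator_def)
  qed
  also have "\<dots> = (\<integral>\<^sup>+u. cut_flux u * indicator {- BL<..<b} u \<partial>lborel) +
      (\<integral>\<^sup>+u. cut_flux u * indicator {b<..<b + w * r} u \<partial>lborel)"
    by (intro nn_integral_add) auto
  also have "(\<integral>\<^sup>+u. cut_flux u * indicator {b<..<b + w * r} u \<partial>lborel) =
      ennreal w * (\<integral>\<^sup>+s. cut_flux (b + w * s) * indicator {b<..<b + w * r} (b + w * s) \<partial>lborel)"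
    using pos nn_integral_real_affine[of "\<lambda>u. cut_flux u * indicator {b<..<b + w * r} u" w b] by simp
  also have "(\<integral>\<^sup>+s. cut_flux (b + w * s) * indicator {b<..<b + w * r} (b + w * s) \<partial>lborel) =
      (\<integral>\<^sup>+s. cut_flux (b + w * s) * indicator {0<..<r} s \<partial>lborel)"
    using pos by (intro nn_integral_cong) (simp add: indicator_def zero_less_mult_iff)
  also have "ennreal w * emeasure M {..- BL} + ((\<integral>\<^sup>+u. cut_flux u * indicator {- BL<..<b} u \<partial>lborel) +
      ennreal w * (\<integral>\<^sup>+s. cut_flux (b + w * s) * indicator {0<..<r} s \<partial>lborel)) =
      ennreal w * (emeasure M {..b} + (\<integral>\<^sup>+s. cut_flux (b + w * s) * indicator {0<..<r} s \<partial>lborel))"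
    unfolding distrib_left balance_from_bottom[OF assms(1)] by (simp only: add.assoc)
  finally show ?thesis
    using pos by (simp add: ennreal_mult_cancel_left)
qed

text \<open>The location at time \<open>t\<close>, reconstructed from the age \<open>s\<close> of the last urge and the location \<open>x\<close> before it; if
  \<open>s > t\<close>, there has been no urge and \<open>x\<close> is the initial location.\<close>

definition lookback :: "real \<Rightarrow> real \<times> real \<times> real \<times> real \<Rightarrow> real" where
  "lookback t = (\<lambda>(s, x, v). if s \<le> t then drift w BL s (landing x v) else drift w BL t x)"

lemma lookback_measurable[measurable]:
  "lookback t \<in> borel_measurable (waiting_time \<Otimes>\<^sub>M (M \<Otimes>\<^sub>M decision J))"
  unfolding lookback_def by measurable

sublocale L: pair_prob_space M "decision J" ..
sublocale LL: pair_prob_space waiting_time "M \<Otimes>\<^sub>M decision J" ..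

lemma nn_integral_lookback:
  assumes [measurable]: "f \<in> borel_measurable borel"
  shows "(\<integral>\<^sup>+x. f x \<partial>distr (waiting_time \<Otimes>\<^sub>M (M \<Otimes>\<^sub>M decision J)) borel (lookback t)) =
    (\<integral>\<^sup>+s. (\<integral>\<^sup>+x. (\<integral>\<^sup>+v. f (lookback t (s, x, v)) \<partial>decision J) \<partial>M) \<partial>waiting_time)"
proof -
  have "(\<integral>\<^sup>+x. f x \<partial>distr (waiting_time \<Otimes>\<^sub>M (M \<Otimes>\<^sub>M decision J)) borel (lookback t)) =
    (\<integral>\<^sup>+z. f (lookback t z) \<partial>(waiting_time \<Otimes>\<^sub>M (M \<Otimes>\<^sub>M decision J)))"
    by (intro nn_integral_distr) auto
  also have "\<dots> = (\<integral>\<^sup>+s. (\<integral>\<^sup>+z. f (lookback t (s, z)) \<partial>(M \<Otimes>\<^sub>M decision J)) \<partial>waiting_time)"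
    by (rule nn_integral_pair[OF L.prob_space_axioms]) measurable
  also have "\<dots> = (\<integral>\<^sup>+s. (\<integral>\<^sup>+x. (\<integral>\<^sup>+v. f (lookback t (s, x, v)) \<partial>decision J) \<partial>M) \<partial>waiting_time)"
    by (intro nn_integral_cong nn_integral_pair[OF UJ.prob_space_axioms]) measurable
  finally show ?thesis .
qed

text \<open>In both cases the sublevel \<open>{..b}\<close> is traced back to \<open>{..b + w * min s t}\<close>; only in the case \<open>s \<le> t\<close> an urge
  throws mass out of it.\<close>

lemma lookback_below:
  assumes "- BL \<le> b" "0 \<le> s" "0 \<le> t"
  shows "(\<integral>\<^sup>+x. (\<integral>\<^sup>+v. indicator {..b} (lookback t (s, x, v)) \<partial>decision J) \<partial>M)
      + cut_flux (b + w * s) * indicator {..t} s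
    = emeasure M {..b} + (\<integral>\<^sup>+r. cut_flux (b + w * r) * indicator {0<..<min s t} r \<partial>lborel)"
proof (cases "s \<le> t")
  case True
  have "(\<integral>\<^sup>+x. (\<integral>\<^sup>+v. indicator {..b} (lookback t (s, x, v)) \<partial>decision J) \<partial>M) =
    (\<integral>\<^sup>+x. (\<integral>\<^sup>+v. indicator {..b + w * s} (landing x v) \<partial>decision J) \<partial>M)"
    using True assms by (intro nn_integral_cong) (simp add: lookback_def indicator_def drift_le_iff)
  then show ?thesis
    using landing_flux[of "b + w * s"] balance_increment[OF assms(1,2)] True by (simp add: min_def)
next
  case False
  have "(\<integral>\<^sup>+x. (\<integral>\<^sup>+v. indicator {..b} (lookback t (s, x, v)) \<partial>decision J) \<partial>M) =
    (\<integral>\<^sup>+x. (\<integral>\<^sup>+v. indicator {..b + w * t} x \<partial>decision J) \<partial>M)"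
    using False assms by (intro nn_integral_cong) (simp add: lookback_def indicator_def drift_le_iff)
  also have "\<dots> = (\<integral>\<^sup>+x. indicator {..b + w * t} x \<partial>M)"
    using UJ.emeasure_space_1 by (intro nn_integral_cong) (simp only: nn_integral_const mult_1_right)
  finally show ?thesis
    using balance_increment[OF assms(1,3)] False by (simp add: min_def)
qed

text \<open>Integrate the previous identity over the waiting time \<open>s\<close>: since \<open>r\<close> lies below
  \<open>min s t\<close> with probability \<open>exp (- r)\<close> for \<open>0 < r < t\<close>, the two flux terms agree and cancel.\<close>

lemma lookback_law:
  assumes "0 \<le> t"
  shows "distr (waiting_time \<Otimes>\<^sub>M (M \<Otimes>\<^sub>M decision J)) borel (lookback t) = M" (is "?R = M")
proof (rule cdf_unique)
  interpret R: prob_space ?R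
    by (rule LL.P.prob_space_distr) measurable
  show R: "real_distribution ?R" by standard auto
  show "real_distribution M" by (rule M)
  have "emeasure ?R {..b} = emeasure M {..b}" for b
  proof (cases "- BL \<le> b")
    \<comment> \<open>Neither law charges points below \<open>- BL\<close>.\<close>
    case False
    have "emeasure M {..b} = (\<integral>\<^sup>+x. indicator {..b} x \<partial>M)" by simp
    also have "\<dots> = (\<integral>\<^sup>+x. 0 \<partial>M)"
    proof (rule nn_integral_cong_AE, use M_frame in eventually_elim)
      fix x assume "- BL \<le> x \<and> x \<le> BR"
      then show "indicator {..b} x = (0::ennreal)" using False by (simp add: indicator_def)
    qed
    finally have *: "emeasure M {..b} = 0" by simp
    have "emeasure ?R {..b} = (\<integral>\<^sup>+x. indicator {..b} x \<partial>?R)" by simp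
    also have "\<dots> = (\<integral>\<^sup>+s. (\<integral>\<^sup>+x. (\<integral>\<^sup>+v. indicator {..b} (lookback t (s, x, v)) \<partial>decision J) \<partial>M) \<partial>waiting_time)"
      by (rule nn_integral_lookback) simp
    also have "\<dots> = (\<integral>\<^sup>+s. (\<integral>\<^sup>+x. (\<integral>\<^sup>+v. 0 \<partial>decision J) \<partial>M) \<partial>waiting_time)"
    proof (intro nn_integral_cong)
      fix s x v
      have "b < lookback t (s, x, v)"
        unfolding lookback_def using False drift_ge[of s "landing x v"] drift_ge[of t x] by auto
      then show "indicator {..b} (lookback t (s, x, v)) = (0::ennreal)" by simp
    qed
    finally show ?thesis using * by simp
  next
    case True
    \<comment> \<open>The flux term common to both sides, to be cancelled in the end.\<close>
    define K where "K = (\<integral>\<^sup>+s. cut_flux (b + w * s) * indicator {..t} s \<partial>waiting_time)"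
    have "emeasure ?R {..b} + K = (\<integral>\<^sup>+x. indicator {..b} x \<partial>?R) + K" by simp
    also have "(\<integral>\<^sup>+x. indicator {..b} x \<partial>?R) =
        (\<integral>\<^sup>+s. (\<integral>\<^sup>+x. (\<integral>\<^sup>+v. indicator {..b} (lookback t (s, x, v)) \<partial>decision J) \<partial>M) \<partial>waiting_time)"
      by (rule nn_integral_lookback) simp
    also have "\<dots> + K = (\<integral>\<^sup>+s. (\<integral>\<^sup>+x. (\<integral>\<^sup>+v. indicator {..b} (lookback t (s, x, v)) \<partial>decision J) \<partial>M)
      + cut_flux (b + w * s) * indicator {..t} s \<partial>waiting_time)"
      unfolding K_def by (rule nn_integral_add[symmetric]) measurable
    also have "\<dots> = (\<integral>\<^sup>+s. emeasure M {..b} +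
        (\<integral>\<^sup>+r. cut_flux (b + w * r) * indicator {0<..<min s t} r \<partial>lborel) \<partial>waiting_time)"
    proof (rule nn_integral_cong_AE, use AE_waiting_time in eventually_elim)
      fix s :: real assume "0 < s"
      then show "(\<integral>\<^sup>+x. (\<integral>\<^sup>+v. indicator {..b} (lookback t (s, x, v)) \<partial>decision J) \<partial>M)
          + cut_flux (b + w * s) * indicator {..t} s
        = emeasure M {..b} + (\<integral>\<^sup>+r. cut_flux (b + w * r) * indicator {0<..<min s t} r \<partial>lborel)"
        using lookback_below[OF True, of s t] assms by simp
    qed
    also have "\<dots> = (\<integral>\<^sup>+s. emeasure M {..b} +
        (\<integral>\<^sup>+r. (cut_flux (b + w * r) * indicator {0<..<t} r) * indicator {r<..} s \<partial>lborel) \<partial>waiting_time)"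
      by (intro nn_integral_cong arg_cong[where f = "(+) _"]) (auto simp: indicator_def)
    also have "\<dots> = emeasure M {..b} +
        (\<integral>\<^sup>+s. (\<integral>\<^sup>+r. (cut_flux (b + w * r) * indicator {0<..<t} r) * indicator {r<..} s \<partial>lborel) \<partial>waiting_time)"
    proof -
      have [measurable]: "(\<lambda>s. \<integral>\<^sup>+r. (cut_flux (b + w * r) * indicator {0<..<t} r) * indicator {r<..} s \<partial>lborel)
          \<in> borel_measurable borel"
      proof -
        have "(\<lambda>s. \<integral>\<^sup>+r. (cut_flux (b + w * r) * indicator {0<..<t} r) * indicator {r<..} s \<partial>lborel) =
          (\<lambda>s. \<integral>\<^sup>+r. (if r < s then cut_flux (b + w * r) * indicator {0<..<t} r else 0) \<partial>lborel)"
          by (intro ext nn_integral_cong) (simp add: indicator_def)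
        then show ?thesis by simp
      qed
      show ?thesis
        using Exp.emeasure_space_1 by (subst nn_integral_add) simp_all
    qed
    also have "(\<integral>\<^sup>+s. (\<integral>\<^sup>+r. (cut_flux (b + w * r) * indicator {0<..<t} r) * indicator {r<..} s \<partial>lborel) \<partial>waiting_time) =
        (\<integral>\<^sup>+r. (\<integral>\<^sup>+s. (cut_flux (b + w * r) * indicator {0<..<t} r) * indicator {r<..} s \<partial>waiting_time) \<partial>lborel)"
    proof -
      interpret pair_sigma_finite lborel waiting_time ..
      have "(\<lambda>(r, s). (cut_flux (b + w * r) * indicator {0<..<t} r) * indicator {r<..} s) =
          (\<lambda>(r, s). if r < s then cut_flux (b + w * r) * indicator {0<..<t} r else 0)"
        by (auto simp: fun_eq_iff indicator_def)
      then have "(\<lambda>(r, s). (cut_flux (b + w * r) * indicator {0<..<t} r) * indicator {r<..} s)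
          \<in> borel_measurable (lborel \<Otimes>\<^sub>M waiting_time)" by simp
      from Fubini'[OF this] show ?thesis .
    qed
    also have "\<dots> = (\<integral>\<^sup>+r. cut_flux (b + w * r) * indicator {0<..<t} r * ennreal (exp (- r)) \<partial>lborel)"
    proof (intro nn_integral_cong)
      fix r :: real
      show "(\<integral>\<^sup>+s. (cut_flux (b + w * r) * indicator {0<..<t} r) * indicator {r<..} s \<partial>waiting_time) =
          cut_flux (b + w * r) * indicator {0<..<t} r * ennreal (exp (- r))"
        using waiting_time_tail[of r]
        by (subst nn_integral_cmult) (auto simp: indicator_def)
    qed
    also have "\<dots> = (\<integral>\<^sup>+r. ennreal (exponential_density 1 r) * (cut_flux (b + w * r) * indicator {..t} r) \<partial>lborel)"
      using AE_lborel_singleton[of 0] AE_lborel_singleton[of t]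
      by (intro nn_integral_cong_AE, eventually_elim)
         (auto simp: indicator_def exponential_density_def mult.commute)
    also have "\<dots> = K"
      unfolding K_def by (rule nn_integral_density[symmetric]) measurable
    finally have "K + emeasure ?R {..b} = K + emeasure M {..b}" by (simp only: add.commute[of K])
    moreover have "K \<le> (\<integral>\<^sup>+s. 1 \<partial>waiting_time)"
      unfolding K_def using cut_flux_le_1
      by (intro nn_integral_mono) (auto simp: indicator_def)
    then have "K \<noteq> \<top>"
      using Exp.emeasure_space_1 by (auto simp: top_unique)
    ultimately show ?thesis unfolding ennreal_add_left_cancel infinity_ennreal_def by blast
  qed
  then show "cdf ?R = cdf M"
    by (simp add: cdf_def fun_eq_iff measure_def)
qed

lemma lookback_nn_integral:
  assumes "0 \<le> t" and [measurable]: "f \<in> borel_measurable borel"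
  shows "(\<integral>\<^sup>+x. f x \<partial>M) =
    (\<integral>\<^sup>+s. (\<integral>\<^sup>+x. (\<integral>\<^sup>+v. f (lookback t (s, x, v)) \<partial>decision J) \<partial>M) \<partial>waiting_time)"
  using nn_integral_lookback[OF assms(2), of t] by (simp add: lookback_law[OF assms(1)])

end

section \<open>The particle process, decomposed at its urges\<close>

lemma indicator_atLeast_if: "indicator {a..} (b::real) = (if a \<le> b then 1 else 0::ennreal)"
  by simp

context particle
begin

abbreviation step :: "(real \<times> real \<times> real) measure" where
  "step \<equiv> waiting_time \<Otimes>\<^sub>M decision J"

abbreviation Y :: "real \<Rightarrow> (nat \<Rightarrow> real \<times> real \<times> real) \<Rightarrow> nat \<Rightarrow> real" where
  "Y \<equiv> after_urge \<eta> w BL BR \<gamma>"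

text \<open>The location at time \<open>t\<close>, provided that the \<open>n\<close>-th urge is the last one up to \<open>t\<close>.\<close>

abbreviation coast :: "nat \<Rightarrow> real \<Rightarrow> real \<Rightarrow> (nat \<Rightarrow> real \<times> real \<times> real) \<Rightarrow> real" where
  "coast n t x \<omega> \<equiv> drift w BL (t - urge_time \<omega> n) (Y x \<omega> n)"

abbreviation loc :: "real \<Rightarrow> (nat \<Rightarrow> real \<times> real \<times> real) \<Rightarrow> real \<Rightarrow> real" where
  "loc \<equiv> location \<eta> w BL BR \<gamma>"

abbreviation law_at :: "real measure \<Rightarrow> real \<Rightarrow> real measure" where
  "law_at M t \<equiv> distr (M \<Otimes>\<^sub>M driving J) borel (\<lambda>(x, \<omega>). loc x \<omega> t)"

sublocale S: pair_prob_space waiting_time "decision J" ..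

lemma driving_eq: "driving J = Pi\<^sub>M UNIV (\<lambda>_. step)"
  by (simp add: driving_def)

lemma prob_space_driving: "prob_space (driving J)"
  unfolding driving_eq by (intro prob_space_PiM S.prob_space_axioms)

lemma space_driving[simp]: "space (driving J) = UNIV"
  by (simp add: driving_eq space_PiM space_pair_measure PiE_def extensional_def)

lemma measurable_driving_component[measurable (raw)]:
  assumes "g \<in> measurable N (driving J)"
  shows "(\<lambda>x. g x n) \<in> measurable N step"
  using measurable_compose[OF assms[unfolded driving_eq] measurable_component_singleton[of n]] by simp

lemma measurable_step_parts:
  assumes "g \<in> measurable N step"
  shows "(\<lambda>x. fst (g x)) \<in> borel_measurable N" "(\<lambda>x. snd (g x)) \<in> measurable N (decision J)"
  using measurable_compose[OF assms measurable_fst] measurable_compose[OF assms measurable_snd] by simp_all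

lemma after_urge_Suc_eq:
  "Y x \<omega> (Suc n) = landing (drift w BL (fst (\<omega> n)) (Y x \<omega> n)) (snd (\<omega> n))"
  by (simp add: landing_def Let_def split: prod.split)

lemma urge_time_Suc: "urge_time \<omega> (Suc n) = urge_time \<omega> n + fst (\<omega> n)"
  by (simp add: urge_time_def)

lemma after_urge_fun_upd: "n \<le> m \<Longrightarrow> Y x (fun_upd \<omega> m e) n = Y x \<omega> n"
  by (induction n) (auto simp: after_urge_Suc_eq simp del: after_urge.simps(2))

lemma urge_time_fun_upd: "n \<le> m \<Longrightarrow> urge_time (fun_upd \<omega> m e) n = urge_time \<omega> n"
  by (auto simp: urge_time_def intro!: sum.cong)

lemma urge_time_measurable[measurable (raw)]:
  assumes [measurable]: "g \<in> measurable N (driving J)"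
  shows "(\<lambda>x. urge_time (g x) n) \<in> borel_measurable N"
  unfolding urge_time_def
  by (intro borel_measurable_sum measurable_step_parts(1) measurable_driving_component assms)

lemma after_urge_measurable[measurable (raw)]:
  assumes [measurable]: "f \<in> borel_measurable N" "g \<in> measurable N (driving J)"
  shows "(\<lambda>x. Y (f x) (g x) n) \<in> borel_measurable N"
proof (induction n)
  case (Suc n)
  note [measurable] = Suc measurable_step_parts[OF measurable_driving_component[OF assms(2), of n]]
  show ?case unfolding after_urge_Suc_eq by measurable
qed simp

text \<open>The \<open>n\<close>-th triple is independent of all others: it may be drawn afresh in a quantity that otherwise
  does not depend on it. Locations and urge times up to the \<open>n\<close>-th urge are of this kind.\<close>

lemma resample:
  assumes [measurable]: "(\<lambda>(\<omega>, e). h \<omega> e) \<in> borel_measurable (driving J \<Otimes>\<^sub>M step)"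
    and h: "\<And>\<omega> e e'. h (fun_upd \<omega> n e') e = h \<omega> e"
  shows "(\<integral>\<^sup>+\<omega>. h \<omega> (\<omega> n) \<partial>driving J) = (\<integral>\<^sup>+\<omega>. (\<integral>\<^sup>+e. h \<omega> e \<partial>step) \<partial>driving J)"
proof -
  interpret D: prob_space "driving J" by (rule prob_space_driving)
  interpret SD: pair_prob_space step "driving J" ..
  have upd: "(\<lambda>(e, \<omega>). fun_upd \<omega> n e) \<in> measurable (step \<Otimes>\<^sub>M driving J) (driving J)"
    unfolding driving_eq split_beta'
    by (rule measurable_fun_upd[where J = UNIV]) auto
  have "(\<integral>\<^sup>+\<omega>. h \<omega> (\<omega> n) \<partial>driving J) =
      (\<integral>\<^sup>+\<omega>. h \<omega> (\<omega> n) \<partial>distr (step \<Otimes>\<^sub>M driving J) (driving J) (\<lambda>(e, \<omega>). fun_upd \<omega> n e))"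
    using distr_pair_PiM_eq_PiM[of UNIV "\<lambda>_. step" n] S.prob_space_axioms by (simp add: driving_eq)
  also have "\<dots> = (\<integral>\<^sup>+z. h (snd z) (fst z) \<partial>(step \<Otimes>\<^sub>M driving J))"
    by (subst nn_integral_distr[OF upd]) (auto simp: h split_beta')
  also have "\<dots> = (\<integral>\<^sup>+e. (\<integral>\<^sup>+\<omega>. h \<omega> e \<partial>driving J) \<partial>step)"
    by (subst nn_integral_pair[OF prob_space_driving]) auto
  also have "\<dots> = (\<integral>\<^sup>+\<omega>. (\<integral>\<^sup>+e. h \<omega> e \<partial>step) \<partial>driving J)"
    by (rule SD.Fubini'[symmetric]) (use measurable_pair_swap[OF assms(1)] in \<open>simp add: split_beta'\<close>)
  finally show ?thesis .
qed

lemma AE_waiting_times_pos: "AE \<omega> in driving J. \<forall>n. 0 < fst (\<omega> n)"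
proof -
  interpret product_prob_space "\<lambda>_. step" UNIV ..
  have "AE e in step. 0 < fst e"
  proof (rule S.AE_pair_measure)
    have "{x \<in> space step. 0 < fst x} = {0<..} \<times> space (decision J)" by (auto simp: space_pair_measure)
    then show "{x \<in> space step. 0 < fst x} \<in> sets step"
      by (simp only:) (intro pair_measureI sets.top, simp)
  qed (use AE_waiting_time in simp)
  then have "AE \<omega> in driving J. 0 < fst (\<omega> n)" for n
    unfolding driving_eq by (intro AE_component) auto
  then show ?thesis by (simp add: AE_all_countable)
qed


text \<open>\<open>post_jump f r z\<close> is the expected value of \<open>f\<close> a time \<open>r\<close> after an urge at location \<open>z\<close>, when no
  other urge has occurred.\<close>

definition post_jump :: "(real \<Rightarrow> ennreal) \<Rightarrow> real \<Rightarrow> real \<Rightarrow> ennreal" where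
  "post_jump f r z = (\<integral>\<^sup>+v. f (drift w BL r (landing z v)) \<partial>decision J)"

lemma post_jump_measurable[measurable (raw)]:
  assumes [measurable]: "f \<in> borel_measurable borel" "g \<in> borel_measurable N" "h \<in> borel_measurable N"
  shows "(\<lambda>x. post_jump f (g x) (h x)) \<in> borel_measurable N"
  unfolding post_jump_def by measurable

definition start :: "real measure \<Rightarrow> (real \<times> (nat \<Rightarrow> real \<times> real \<times> real)) measure" where
  "start M = M \<Otimes>\<^sub>M driving J"

text \<open>Expectation of \<open>f\<close> at time \<open>t\<close> restricted to the event that the \<open>n\<close>-th urge is the last one up to \<open>t\<close>,
  with the next waiting time already integrated out; this accounts for the exponential factor.\<close>

definition urge_part :: "real measure \<Rightarrow> nat \<Rightarrow> real \<Rightarrow> (real \<Rightarrow> ennreal) \<Rightarrow> ennreal" where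
  "urge_part M n t f = (\<integral>\<^sup>+(x, \<omega>). ennreal (exp (- (t - urge_time \<omega> n))) * indicator {urge_time \<omega> n..} t *
     f (coast n t x \<omega>) \<partial>start M)"

text \<open>Given the first \<open>n\<close> urges, the next waiting time exceeds \<open>t - urge_time \<omega> n\<close> with exactly the
  probability that appears in \<open>urge_part\<close>.\<close>

lemma urge_part_eq:
  assumes M: "real_distribution M" and [measurable]: "f \<in> borel_measurable borel"
  shows "urge_part M n t f = (\<integral>\<^sup>+(x, \<omega>). indicator {urge_time \<omega> n..<urge_time \<omega> (Suc n)} t *
     f (coast n t x \<omega>) \<partial>start M)"
proof -
  interpret M: real_distribution M by (rule M)
  note [measurable] = measurable_step_parts
  note ind = indicator_atLeast_if
  have ind': "indicator {a..<c} (b::real) = (if a \<le> b \<and> b < c then 1 else 0::ennreal)" for a b c by auto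
  have "urge_part M n t f = (\<integral>\<^sup>+x. (\<integral>\<^sup>+\<omega>. ennreal (exp (- (t - urge_time \<omega> n))) * indicator {urge_time \<omega> n..} t *
     f (coast n t x \<omega>) \<partial>driving J) \<partial>M)"
    unfolding urge_part_def start_def ind
    by (subst nn_integral_pair[OF prob_space_driving]) (simp_all add: split_beta')
  also have "\<dots> = (\<integral>\<^sup>+x. (\<integral>\<^sup>+\<omega>. indicator {urge_time \<omega> n..<urge_time \<omega> (Suc n)} t *
     f (coast n t x \<omega>) \<partial>driving J) \<partial>M)"
  proof (rule nn_integral_cong)
    fix x
    define h where "h \<omega> e = indicator {urge_time \<omega> n..<urge_time \<omega> n + fst e} t *
        f (coast n t x \<omega>)" for \<omega> and e :: "real \<times> real \<times> real"
    have "(\<integral>\<^sup>+\<omega>. h \<omega> (\<omega> n) \<partial>driving J) = (\<integral>\<^sup>+\<omega>. (\<integral>\<^sup>+e. h \<omega> e \<partial>step) \<partial>driving J)"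
    proof (rule resample)
      show "(\<lambda>(\<omega>, e). h \<omega> e) \<in> borel_measurable (driving J \<Otimes>\<^sub>M step)"
        unfolding h_def ind' split_beta' by measurable
    qed (simp add: h_def urge_time_fun_upd after_urge_fun_upd)
    also have "\<dots> = (\<integral>\<^sup>+\<omega>. ennreal (exp (- (t - urge_time \<omega> n))) * indicator {urge_time \<omega> n..} t *
     f (coast n t x \<omega>) \<partial>driving J)"
    proof (rule nn_integral_cong)
      fix \<omega>
      define F where "F = indicator {urge_time \<omega> n..} t * f (coast n t x \<omega>)"
      have "(\<integral>\<^sup>+e. h \<omega> e \<partial>step) = (\<integral>\<^sup>+s. (\<integral>\<^sup>+v. h \<omega> (s, v) \<partial>decision J) \<partial>waiting_time)"
        unfolding h_def ind' by (rule nn_integral_pair[OF UJ.prob_space_axioms]) measurable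
      also have "\<dots> = (\<integral>\<^sup>+s. F * indicator {t - urge_time \<omega> n<..} s \<partial>waiting_time)"
      proof (rule nn_integral_cong)
        fix s
        have "(\<integral>\<^sup>+v. h \<omega> (s, v) \<partial>decision J) =
            (\<integral>\<^sup>+v. F * indicator {t - urge_time \<omega> n<..} s \<partial>decision J)"
          by (intro nn_integral_cong) (auto simp: h_def F_def indicator_def)
        then show "(\<integral>\<^sup>+v. h \<omega> (s, v) \<partial>decision J) = F * indicator {t - urge_time \<omega> n<..} s"
          using UJ.emeasure_space_1 by (simp only: nn_integral_const mult_1_right)
      qed
      also have "\<dots> = F * emeasure waiting_time {t - urge_time \<omega> n<..}"
        by (simp add: nn_integral_cmult)
      also have "\<dots> = ennreal (exp (- (t - urge_time \<omega> n))) * F"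
        using waiting_time_tail[of "t - urge_time \<omega> n"] by (auto simp: F_def indicator_def mult.commute)
      finally show "(\<integral>\<^sup>+e. h \<omega> e \<partial>step) = ennreal (exp (- (t - urge_time \<omega> n))) *
          indicator {urge_time \<omega> n..} t * f (coast n t x \<omega>)"
        by (simp add: F_def mult.assoc)
    qed
    finally show "(\<integral>\<^sup>+\<omega>. ennreal (exp (- (t - urge_time \<omega> n))) * indicator {urge_time \<omega> n..} t *
     f (coast n t x \<omega>) \<partial>driving J) =
      (\<integral>\<^sup>+\<omega>. indicator {urge_time \<omega> n..<urge_time \<omega> (Suc n)} t *
     f (coast n t x \<omega>) \<partial>driving J)"
      by (simp add: h_def urge_time_Suc)
  qed
  also have "\<dots> = (\<integral>\<^sup>+(x, \<omega>). indicator {urge_time \<omega> n..<urge_time \<omega> (Suc n)} t *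
     f (coast n t x \<omega>) \<partial>start M)"
    unfolding start_def ind'
    by (subst nn_integral_pair[OF prob_space_driving]) (simp_all add: split_beta')
  finally show ?thesis .
qed

lemma urge_part_0: 
  assumes M: "real_distribution M" and [measurable]: "f \<in> borel_measurable borel" and "0 \<le> t"
  shows "urge_part M 0 t f = ennreal (exp (- t)) * (\<integral>\<^sup>+x. f (drift w BL t x) \<partial>M)"
proof -
  interpret M: real_distribution M by (rule M)
  have "urge_part M 0 t f = (\<integral>\<^sup>+x. (\<integral>\<^sup>+\<omega>. ennreal (exp (- t)) * f (drift w BL t x) \<partial>driving J) \<partial>M)"
    unfolding urge_part_def start_def using \<open>0 \<le> t\<close>
    by (subst nn_integral_pair[OF prob_space_driving]) (simp_all add: urge_time_def split_beta')
  also have "\<dots> = (\<integral>\<^sup>+x. ennreal (exp (- t)) * f (drift w BL t x) \<partial>M)"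
    using prob_space.emeasure_space_1[OF prob_space_driving]
    by (intro nn_integral_cong) (simp only: nn_integral_const mult_1_right)
  also have "\<dots> = ennreal (exp (- t)) * (\<integral>\<^sup>+x. f (drift w BL t x) \<partial>M)"
    by (rule nn_integral_cmult) measurable
  finally show ?thesis .
qed

lemma urge_part_neg:
  assumes M: "real_distribution M" and "t < 0"
  shows "urge_part M n t f = 0"
proof -
  interpret M: real_distribution M by (rule M)
  interpret D: prob_space "driving J" by (rule prob_space_driving)
  interpret MD: pair_prob_space M "driving J" ..
  have "AE z in start M. \<forall>n. 0 < fst (snd z n)"
    unfolding start_def
  proof (rule MD.AE_pair_measure)
    note [measurable] = measurable_step_parts
    show "{x \<in> space (M \<Otimes>\<^sub>M driving J). \<forall>n. 0 < fst (snd x n)} \<in> sets (M \<Otimes>\<^sub>M driving J)" by measurable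
  qed (use AE_waiting_times_pos in simp)
  then have "urge_part M n t f = (\<integral>\<^sup>+z. 0 \<partial>start M)"
    unfolding urge_part_def
  proof (intro nn_integral_cong_AE, eventually_elim)
    fix z :: "real \<times> (nat \<Rightarrow> real \<times> real \<times> real)" assume "\<forall>n. 0 < fst (snd z n)"
    then have "0 \<le> urge_time (snd z) n" by (auto simp: urge_time_def less_imp_le intro!: sum_nonneg)
    with \<open>t < 0\<close> show "(case z of (x, \<omega>) \<Rightarrow> ennreal (exp (- (t - urge_time \<omega> n))) * indicator {urge_time \<omega> n..} t *
     f (coast n t x \<omega>)) = 0"
      by (auto simp: split_beta')
  qed
  then show ?thesis by simp
qed

text \<open>Time reversal of the stretch between the \<open>n\<close>-th urge and \<open>t\<close>: the exponential weights make the
  position of the next urge in it uniform, so it may be measured from either end.\<close>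

lemma waiting_time_reverse:
  assumes [measurable]: "G \<in> borel_measurable (borel \<Otimes>\<^sub>M borel)"
  shows "(\<integral>\<^sup>+s. ennreal (exp (- (c - s))) * indicator {..c} s * G (c - s, s) \<partial>waiting_time) =
    (\<integral>\<^sup>+s. ennreal (exp (- (c - s))) * indicator {..c} s * G (s, c - s) \<partial>waiting_time)"
proof -
  have e: "ennreal (exponential_density 1 s) * (ennreal (exp (- (c - s))) * indicator {..c} s * z) =
      ennreal (exp (- c)) * indicator {0..c} s * z" for s z
  proof -
    have "ennreal (exp (- s)) * ennreal (exp (s - c)) = ennreal (exp (- c))"
      by (simp add: ennreal_mult[symmetric] exp_add[symmetric])
    then show ?thesis
      by (auto simp: exponential_density_def indicator_def mult.assoc[symmetric])
  qed
  have d: "(\<integral>\<^sup>+s. ennreal (exp (- (c - s))) * indicator {..c} s * H s \<partial>waiting_time) =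
      (\<integral>\<^sup>+s. ennreal (exp (- c)) * indicator {0..c} s * H s \<partial>lborel)"
    if [measurable]: "H \<in> borel_measurable borel" for H
  proof -
    have "(\<integral>\<^sup>+s. ennreal (exp (- (c - s))) * indicator {..c} s * H s \<partial>waiting_time) =
      (\<integral>\<^sup>+s. ennreal (exponential_density 1 s) *
        (ennreal (exp (- (c - s))) * indicator {..c} s * H s) \<partial>lborel)"
      by (rule nn_integral_density) measurable
    then show ?thesis by (simp only: e)
  qed
  have "(\<integral>\<^sup>+s. ennreal (exp (- (c - s))) * indicator {..c} s * G (c - s, s) \<partial>waiting_time) =
      (\<integral>\<^sup>+s. ennreal (exp (- c)) * indicator {0..c} s * G (c - s, s) \<partial>lborel)"
    by (rule d) measurable
  also have "\<dots> = (\<integral>\<^sup>+s. ennreal (exp (- c)) * indicator {0..c} (c - s) * G (c - (c - s), c - s) \<partial>lborel)"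
    using nn_integral_real_affine[of "\<lambda>s. ennreal (exp (- c)) * indicator {0..c} s * G (c - s, s)" "-1" c]
    by simp
  also have "\<dots> = (\<integral>\<^sup>+s. ennreal (exp (- c)) * indicator {0..c} s * G (s, c - s) \<partial>lborel)"
    by (intro nn_integral_cong) (auto simp: indicator_def)
  also have "\<dots> = (\<integral>\<^sup>+s. ennreal (exp (- (c - s))) * indicator {..c} s * G (s, c - s) \<partial>waiting_time)"
    by (rule d[symmetric]) measurable
  finally show ?thesis .
qed

lemma urge_part_measurable:
  assumes M: "real_distribution M" and [measurable]: "f \<in> borel_measurable borel"
  shows "(\<lambda>r. urge_part M n (t - r) (post_jump f r)) \<in> borel_measurable borel"
proof -
  interpret M: real_distribution M by (rule M)
  interpret D: prob_space "driving J" by (rule prob_space_driving)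
  interpret MD: pair_prob_space M "driving J" ..
  note ind = indicator_atLeast_if
  show ?thesis unfolding urge_part_def start_def ind split_beta' by measurable
qed

text \<open>Decompose at the last urge before \<open>t\<close>, with \<open>r\<close> the time elapsed since then: up to time \<open>t - r\<close> there
  are \<open>n\<close> urges, and \<open>post_jump\<close> describes the rest. This is the recursion that the look-back
  identity mirrors.\<close>

lemma urge_part_Suc:
  assumes M: "real_distribution M" and [measurable]: "f \<in> borel_measurable borel"
  shows "urge_part M (Suc n) t f = (\<integral>\<^sup>+r. urge_part M n (t - r) (post_jump f r) \<partial>waiting_time)"
proof -
  interpret M: real_distribution M by (rule M)
  interpret D: prob_space "driving J" by (rule prob_space_driving)
  interpret MD: pair_prob_space M "driving J" ..
  note [measurable] = measurable_step_parts
  note ind = indicator_atLeast_if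
  have "urge_part M (Suc n) t f = (\<integral>\<^sup>+x. (\<integral>\<^sup>+\<omega>. ennreal (exp (- (t - urge_time \<omega> (Suc n)))) * indicator {urge_time \<omega> (Suc n)..} t *
     f (coast (Suc n) t x \<omega>) \<partial>driving J) \<partial>M)"
    unfolding urge_part_def start_def ind
    by (subst nn_integral_pair[OF prob_space_driving]) (simp_all add: split_beta' del: after_urge.simps)
  also have "\<dots> = (\<integral>\<^sup>+x. (\<integral>\<^sup>+\<omega>. (\<integral>\<^sup>+r. ennreal (exp (- (t - r - urge_time \<omega> n))) * indicator {urge_time \<omega> n..} (t - r) *
     post_jump f r (coast n (t - r) x \<omega>) \<partial>waiting_time) \<partial>driving J) \<partial>M)"
  proof (rule nn_integral_cong)
    fix x
    define h where "h \<omega> e = ennreal (exp (- (t - (urge_time \<omega> n + fst e)))) * indicator {urge_time \<omega> n + fst e..} t *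
        f (drift w BL (t - (urge_time \<omega> n + fst e)) (landing (drift w BL (fst e) (Y x \<omega> n)) (snd e)))"
      for \<omega> and e :: "real \<times> real \<times> real"
    have "(\<integral>\<^sup>+\<omega>. h \<omega> (\<omega> n) \<partial>driving J) = (\<integral>\<^sup>+\<omega>. (\<integral>\<^sup>+e. h \<omega> e \<partial>step) \<partial>driving J)"
    proof (rule resample)
      show "(\<lambda>(\<omega>, e). h \<omega> e) \<in> borel_measurable (driving J \<Otimes>\<^sub>M step)"
        unfolding h_def ind split_beta' by measurable
    qed (simp add: h_def urge_time_fun_upd after_urge_fun_upd)
    also have "\<dots> = (\<integral>\<^sup>+\<omega>. (\<integral>\<^sup>+r. ennreal (exp (- (t - r - urge_time \<omega> n))) * indicator {urge_time \<omega> n..} (t - r) *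
     post_jump f r (coast n (t - r) x \<omega>) \<partial>waiting_time) \<partial>driving J)"
    proof (rule nn_integral_cong)
      fix \<omega>
      define c where "c = t - urge_time \<omega> n"
      define G where "G = (\<lambda>(r, s). post_jump f r (drift w BL s (Y x \<omega> n)))"
      have [measurable]: "G \<in> borel_measurable (borel \<Otimes>\<^sub>M borel)"
        unfolding G_def by measurable
      have "(\<integral>\<^sup>+e. h \<omega> e \<partial>step) = (\<integral>\<^sup>+s. (\<integral>\<^sup>+v. h \<omega> (s, v) \<partial>decision J) \<partial>waiting_time)"
        unfolding h_def ind by (rule nn_integral_pair[OF UJ.prob_space_axioms]) measurable
      also have "\<dots> = (\<integral>\<^sup>+s. ennreal (exp (- (c - s))) * indicator {..c} s * G (c - s, s) \<partial>waiting_time)"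
      proof (rule nn_integral_cong)
        fix s
        have "(\<integral>\<^sup>+v. h \<omega> (s, v) \<partial>decision J) = (\<integral>\<^sup>+v. (ennreal (exp (- (c - s))) * indicator {..c} s) *
            f (drift w BL (c - s) (landing (drift w BL s (Y x \<omega> n)) v)) \<partial>decision J)"
          by (intro nn_integral_cong) (auto simp: h_def c_def indicator_def algebra_simps)
        also have "\<dots> = ennreal (exp (- (c - s))) * indicator {..c} s * G (c - s, s)"
          unfolding G_def post_jump_def by (simp add: nn_integral_cmult)
        finally show "(\<integral>\<^sup>+v. h \<omega> (s, v) \<partial>decision J) =
            ennreal (exp (- (c - s))) * indicator {..c} s * G (c - s, s)" .
      qed
      also have "\<dots> = (\<integral>\<^sup>+r. ennreal (exp (- (c - r))) * indicator {..c} r * G (r, c - r) \<partial>waiting_time)"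
        by (rule waiting_time_reverse) measurable
      also have "\<dots> = (\<integral>\<^sup>+r. ennreal (exp (- (t - r - urge_time \<omega> n))) * indicator {urge_time \<omega> n..} (t - r) *
          post_jump f r (coast n (t - r) x \<omega>) \<partial>waiting_time)"
        by (intro nn_integral_cong) (auto simp: G_def c_def indicator_def algebra_simps)
      finally show "(\<integral>\<^sup>+e. h \<omega> e \<partial>step) =
        (\<integral>\<^sup>+r. ennreal (exp (- (t - r - urge_time \<omega> n))) * indicator {urge_time \<omega> n..} (t - r) *
          post_jump f r (coast n (t - r) x \<omega>) \<partial>waiting_time)" .
    qed
    finally show "(\<integral>\<^sup>+\<omega>. ennreal (exp (- (t - urge_time \<omega> (Suc n)))) * indicator {urge_time \<omega> (Suc n)..} t *
        f (coast (Suc n) t x \<omega>) \<partial>driving J) =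
      (\<integral>\<^sup>+\<omega>. (\<integral>\<^sup>+r. ennreal (exp (- (t - r - urge_time \<omega> n))) * indicator {urge_time \<omega> n..} (t - r) *
        post_jump f r (coast n (t - r) x \<omega>) \<partial>waiting_time) \<partial>driving J)"
      by (simp add: h_def urge_time_Suc after_urge_Suc_eq del: after_urge.simps)
  qed
  also have "\<dots> = (\<integral>\<^sup>+z. (\<integral>\<^sup>+r. ennreal (exp (- (t - r - urge_time (snd z) n))) * indicator {urge_time (snd z) n..} (t - r) *
     post_jump f r (coast n (t - r) (fst z) (snd z)) \<partial>waiting_time) \<partial>start M)"
    unfolding start_def ind
    by (subst nn_integral_pair[OF prob_space_driving]) simp_all
  also have "\<dots> = (\<integral>\<^sup>+r. (\<integral>\<^sup>+z. ennreal (exp (- (t - r - urge_time (snd z) n))) * indicator {urge_time (snd z) n..} (t - r) *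
     post_jump f r (coast n (t - r) (fst z) (snd z)) \<partial>start M) \<partial>waiting_time)"
  proof -
    interpret pair_sigma_finite waiting_time "M \<Otimes>\<^sub>M driving J" ..
    show ?thesis unfolding start_def ind by (rule Fubini') measurable
  qed
  also have "\<dots> = (\<integral>\<^sup>+r. urge_part M n (t - r) (post_jump f r) \<partial>waiting_time)"
    unfolding urge_part_def by (simp add: split_beta')
  finally show ?thesis .
qed

end

context balanced_law
begin

text \<open>By induction, applying the bound at time \<open>t - r\<close> to \<open>post_jump f r\<close>; what results is the right-hand side of the
  look-back identity, hence the expectation of \<open>f\<close> itself.\<close>

lemma sum_urge_part_le:
  assumes "0 \<le> t" and f[measurable]: "f \<in> borel_measurable borel"
  shows "(\<Sum>n<N. urge_part M n t f) \<le> (\<integral>\<^sup>+x. f x \<partial>M)"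
  using assms
proof (induction N arbitrary: t f)
  case (Suc N)
  note [measurable] = Suc.prems(2)
  have m: "(\<lambda>r. urge_part M n (t - r) (post_jump f r)) \<in> borel_measurable borel" for n
    by (rule urge_part_measurable[OF M]) measurable
  have "(\<lambda>(r, x). post_jump f r x) \<in> borel_measurable (borel \<Otimes>\<^sub>M M)"
    unfolding split_beta' by (intro post_jump_measurable) measurable
  from M.borel_measurable_nn_integral[OF this]
  have m': "(\<lambda>r. (\<integral>\<^sup>+x. post_jump f r x \<partial>M) * indicator {..t} r) \<in> borel_measurable waiting_time"
    by (intro borel_measurable_times_ennreal borel_measurable_indicator) simp_all
  define C where "C = (\<integral>\<^sup>+x. f (drift w BL t x) \<partial>M)"
  have 1: "(\<Sum>n<Suc N. urge_part M n t f) = urge_part M 0 t f + (\<Sum>n<N. urge_part M (Suc n) t f)"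
    by (rule sum.lessThan_Suc_shift)
  have 2: "urge_part M 0 t f = (\<integral>\<^sup>+r. C * indicator {t<..} r \<partial>waiting_time)"
    using Suc.prems waiting_time_tail[of t] by (subst nn_integral_cmult_indicator) (simp_all add: urge_part_0[OF M] C_def mult.commute)
  have 3: "(\<Sum>n<N. urge_part M (Suc n) t f) \<le> (\<integral>\<^sup>+r. (\<integral>\<^sup>+x. post_jump f r x \<partial>M) * indicator {..t} r \<partial>waiting_time)"
  proof -
  have "(\<Sum>n<N. urge_part M (Suc n) t f) = (\<integral>\<^sup>+r. (\<Sum>n<N. urge_part M n (t - r) (post_jump f r)) \<partial>waiting_time)"
    using Suc.prems by (subst nn_integral_sum) (simp_all add: urge_part_Suc[OF M] m)
  also have "\<dots> \<le> (\<integral>\<^sup>+r. (\<integral>\<^sup>+x. post_jump f r x \<partial>M) * indicator {..t} r \<partial>waiting_time)"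
  proof (rule nn_integral_mono)
    fix r
    have "post_jump f r \<in> borel_measurable borel" by measurable
    then show "(\<Sum>n<N. urge_part M n (t - r) (post_jump f r)) \<le> (\<integral>\<^sup>+x. post_jump f r x \<partial>M) * indicator {..t} r"
      using Suc.IH[of "t - r" "post_jump f r"] urge_part_neg[OF M, of "t - r"] by (cases "r \<le> t") auto
  qed
  finally show ?thesis .
  qed
  have 4: "(\<integral>\<^sup>+r. C * indicator {t<..} r \<partial>waiting_time) +
      (\<integral>\<^sup>+r. (\<integral>\<^sup>+x. post_jump f r x \<partial>M) * indicator {..t} r \<partial>waiting_time) =
      (\<integral>\<^sup>+r. C * indicator {t<..} r + (\<integral>\<^sup>+x. post_jump f r x \<partial>M) * indicator {..t} r \<partial>waiting_time)"
    by (rule nn_integral_add[symmetric, OF _ m']) simp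
  have 5: "(\<integral>\<^sup>+r. C * indicator {t<..} r + (\<integral>\<^sup>+x. post_jump f r x \<partial>M) * indicator {..t} r \<partial>waiting_time) =
      (\<integral>\<^sup>+x. f x \<partial>M)"
    unfolding lookback_nn_integral[OF Suc.prems]
  proof (rule nn_integral_cong)
    fix r
    have "(\<integral>\<^sup>+x. (\<integral>\<^sup>+v. f (drift w BL t x) \<partial>decision J) \<partial>M) = C"
      unfolding C_def using UJ.emeasure_space_1
      by (intro nn_integral_cong) (simp only: nn_integral_const mult_1_right)
    then show "C * indicator {t<..} r + (\<integral>\<^sup>+x. post_jump f r x \<partial>M) * indicator {..t} r =
        (\<integral>\<^sup>+x. (\<integral>\<^sup>+v. f (lookback t (r, x, v)) \<partial>decision J) \<partial>M)"
      by (cases "r \<le> t") (simp_all add: lookback_def post_jump_def)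
  qed
  show ?case unfolding 1 2 5[symmetric] 4[symmetric] by (rule add_left_mono[OF 3])
qed simp

end

subsection \<open>Only finitely many urges occur in finite time\<close>

context particle
begin

text \<open>The waiting times are independent and \<open>exp (- s)\<close> has mean \<open>1 / 2\<close> for each of them.\<close>

lemma exp_urge_time:
  "(\<integral>\<^sup>+\<omega>. ennreal (exp (- urge_time \<omega> n)) \<partial>driving J) = ennreal ((1 / 2) ^ n)"
proof (induction n)
  case 0
  show ?case using prob_space.emeasure_space_1[OF prob_space_driving] by (simp add: urge_time_def)
next
  case (Suc n)
  note [measurable] = measurable_step_parts
  define h where "h \<omega> e = ennreal (exp (- urge_time \<omega> n)) * ennreal (exp (- fst e))"
    for \<omega> and e :: "real \<times> real \<times> real"
  have e: "(\<integral>\<^sup>+e. ennreal (exp (- fst e)) \<partial>step) = ennreal (1 / 2)"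
  proof -
    have "(\<integral>\<^sup>+e. ennreal (exp (- fst e)) \<partial>step) =
        (\<integral>\<^sup>+s. (\<integral>\<^sup>+v. ennreal (exp (- s)) \<partial>decision J) \<partial>waiting_time)"
      by (subst nn_integral_pair[OF UJ.prob_space_axioms]) simp_all
    also have "\<dots> = (\<integral>\<^sup>+s. ennreal (exp (- s)) \<partial>waiting_time)"
      using UJ.emeasure_space_1 by (intro nn_integral_cong) (simp only: nn_integral_const mult_1_right)
    also have "\<dots> = (\<integral>\<^sup>+s. ennreal (exponential_density 1 s) * ennreal (exp (- s)) \<partial>lborel)"
      by (rule nn_integral_density) measurable
    also have "\<dots> = (\<integral>\<^sup>+s. ennreal (1 / 2) * ennreal (exponential_density 2 s) \<partial>lborel)"
      proof (rule nn_integral_cong)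
      fix s :: real
      have "exponential_density 1 s * exp (- s) = 1 / 2 * exponential_density 2 s"
        by (simp add: exponential_density_def exp_add[symmetric] mult.commute)
      then show "ennreal (exponential_density 1 s) * ennreal (exp (- s)) =
          ennreal (1 / 2) * ennreal (exponential_density 2 s)"
        using exponential_density_nonneg[of 1 s]
        by (subst (1 2) ennreal_mult'[symmetric]) (simp_all only: zero_le_divide_1_iff zero_le_numeral zero_less_one)
    qed
    also have "\<dots> = ennreal (1 / 2) * (\<integral>\<^sup>+s. 1 \<partial>density lborel (\<lambda>s. ennreal (exponential_density 2 s)))"
    proof -
      have "(\<integral>\<^sup>+s. 1 \<partial>density lborel (\<lambda>s. ennreal (exponential_density 2 s))) =
          (\<integral>\<^sup>+s. ennreal (exponential_density 2 s) * 1 \<partial>lborel)"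
        by (rule nn_integral_density) measurable
      then show ?thesis by (subst nn_integral_cmult) (simp_all only: mult_1_right, measurable)
    qed
    also have "\<dots> = ennreal (1 / 2)"
      using prob_space.emeasure_space_1[OF prob_space_exponential_density[of 2]] by simp
    finally show ?thesis .
  qed
  have "(\<integral>\<^sup>+\<omega>. ennreal (exp (- urge_time \<omega> (Suc n))) \<partial>driving J) = (\<integral>\<^sup>+\<omega>. h \<omega> (\<omega> n) \<partial>driving J)"
    by (intro nn_integral_cong) (simp add: h_def urge_time_Suc ennreal_mult[symmetric] exp_add[symmetric])
  also have "\<dots> = (\<integral>\<^sup>+\<omega>. (\<integral>\<^sup>+e. h \<omega> e \<partial>step) \<partial>driving J)"
  proof (rule resample)
    show "(\<lambda>(\<omega>, e). h \<omega> e) \<in> borel_measurable (driving J \<Otimes>\<^sub>M step)"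
      unfolding h_def split_beta' by measurable
  qed (simp add: h_def urge_time_fun_upd)
  also have "\<dots> = (\<integral>\<^sup>+\<omega>. ennreal (exp (- urge_time \<omega> n)) * ennreal (1 / 2) \<partial>driving J)"
    unfolding h_def e[symmetric] by (intro nn_integral_cong nn_integral_cmult) measurable
  also have "\<dots> = ennreal ((1 / 2) ^ n) * ennreal (1 / 2)"
    unfolding Suc.IH[symmetric] by (rule nn_integral_multc) measurable
  also have "\<dots> = ennreal ((1 / 2) ^ Suc n)" by (subst ennreal_mult[symmetric]) simp_all
  finally show ?case .
qed

text \<open>A Chernoff bound: \<open>P (urge_time \<omega> n \<le> t) \<le> exp t * 2 ^ (- n)\<close>.\<close>

lemma AE_urge_time_unbounded: "AE \<omega> in driving J. \<exists>n. t < urge_time \<omega> n"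
proof -
  interpret D: prob_space "driving J" by (rule prob_space_driving)
  define A where "A = {\<omega> \<in> space (driving J). \<forall>n. urge_time \<omega> n \<le> t}"
  have A[measurable]: "A \<in> sets (driving J)" unfolding A_def by measurable
  have le: "D.prob A \<le> exp t * (1 / 2) ^ n" for n
  proof -
    have "emeasure (driving J) A = (\<integral>\<^sup>+\<omega>. indicator A \<omega> \<partial>driving J)" by simp
    also have "\<dots> \<le> (\<integral>\<^sup>+\<omega>. ennreal (exp t) * ennreal (exp (- urge_time \<omega> n)) \<partial>driving J)"
      by (intro nn_integral_mono)
         (auto simp: A_def indicator_def ennreal_mult[symmetric] exp_add[symmetric])
    also have "\<dots> = ennreal (exp t) * (\<integral>\<^sup>+\<omega>. ennreal (exp (- urge_time \<omega> n)) \<partial>driving J)"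
      by (rule nn_integral_cmult) measurable
    also have "\<dots> = ennreal (exp t * (1 / 2) ^ n)"
      unfolding exp_urge_time by (subst ennreal_mult) simp_all
    finally show ?thesis by (simp add: D.emeasure_eq_measure)
  qed
  have "(\<lambda>n. exp t * (1 / 2) ^ n) \<longlonglongrightarrow> exp t * 0"
    by (intro tendsto_intros) auto
  then have "D.prob A \<le> exp t * 0"
    by (rule LIMSEQ_le_const) (use le in auto)
  then have "AE \<omega> in driving J. \<omega> \<notin> A"
    by (intro AE_not_in) (auto simp: null_sets_def D.emeasure_eq_measure measure_le_0_iff)
  then show ?thesis by eventually_elim (auto simp: A_def not_le)
qed

lemma urge_count_eq:
  assumes pos: "\<forall>n. 0 < fst (\<omega> n)" and n: "urge_time \<omega> n \<le> t" "t < urge_time \<omega> (Suc n)"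
  shows "urge_count \<omega> t = n"
proof -
  have mono: "strict_mono (urge_time \<omega>)"
    using pos by (intro strict_mono_Suc_iff[THEN iffD2]) (simp add: urge_time_Suc)
  have "{k. k \<ge> 1 \<and> urge_time \<omega> k \<le> t} = {1..n}"
  proof safe
    fix k assume "1 \<le> k" "urge_time \<omega> k \<le> t"
    then have "urge_time \<omega> k < urge_time \<omega> (Suc n)" using n by simp
    then show "k \<in> {1..n}" using \<open>1 \<le> k\<close> strict_mono_less[OF mono] by simp
  next
    fix k assume "k \<in> {1..n}"
    then have "urge_time \<omega> k \<le> urge_time \<omega> n" using strict_mono_less_eq[OF mono] by simp
    then show "urge_time \<omega> k \<le> t" using n by simp
  qed simp
  then show ?thesis by (simp add: urge_count_def)
qed

lemma ex_last_urge:
  assumes "0 \<le> t" "t < urge_time \<omega> k"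
  obtains n where "urge_time \<omega> n \<le> t" "t < urge_time \<omega> (Suc n)"
proof -
  define m where "m = (LEAST m. t < urge_time \<omega> m)"
  have m: "t < urge_time \<omega> m" unfolding m_def by (rule LeastI) (rule assms)
  then have "m \<noteq> 0" using assms(1) by (auto simp: urge_time_def intro: gr0I)
  then obtain n where "m = Suc n" by (cases m) auto
  moreover have "\<not> t < urge_time \<omega> n"
    using not_less_Least[of n "\<lambda>m. t < urge_time \<omega> m"] \<open>m = Suc n\<close> by (simp add: m_def)
  ultimately show ?thesis using that[of n] m by simp
qed

lemma location_measurable:
  "(\<lambda>(x, \<omega>). loc x \<omega> t) \<in> borel_measurable (borel \<Otimes>\<^sub>M driving J)"
proof -
  have [measurable]: "(\<lambda>z::real \<times> _. urge_count (snd z) t) \<in> measurable (borel \<Otimes>\<^sub>M driving J) (count_space UNIV)"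
    unfolding urge_count_def by measurable
  have "(\<lambda>z. drift w BL (t - urge_time (snd z) (urge_count (snd z) t)) (Y (fst z) (snd z) (urge_count (snd z) t)))
    \<in> borel_measurable (borel \<Otimes>\<^sub>M driving J)"
    by (rule measurable_compose_countable[where f = "\<lambda>n z. coast n t (fst z) (snd z)"
       and g = "\<lambda>z. urge_count (snd z) t"]) measurable
  then show ?thesis by (simp add: location_def Let_def split_beta')
qed

end

section \<open>Stationary laws of the single particle\<close>

lemma prob_measure_eqI_le:
  assumes M: "prob_space M" and N: "prob_space N" and s: "sets M = sets N"
    and le: "\<And>B. B \<in> sets M \<Longrightarrow> emeasure M B \<le> emeasure N B"
  shows "M = N"
proof (rule measure_eqI[OF s])
  interpret M: prob_space M by fact
  interpret N: prob_space N by fact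
  fix B assume B: "B \<in> sets M"
  have sp: "space M = space N" using s by (rule sets_eq_imp_space_eq)
  have "M.prob (space M - B) \<le> N.prob (space N - B)"
    using le[of "space M - B"] B s sp by (auto simp: M.emeasure_eq_measure N.emeasure_eq_measure)
  then have "N.prob B \<le> M.prob B"
    using M.prob_compl[OF B] N.prob_compl[of B] B s by auto
  then show "emeasure M B = emeasure N B"
    using le[OF B] by (auto simp: M.emeasure_eq_measure N.emeasure_eq_measure)
qed

context balanced_law
begin

text \<open>Almost surely there is a last urge before \<open>t\<close>, so the law at time \<open>t\<close> is the sum of its parts by the number
  of urges.\<close>

lemma location_law_le:
  assumes t: "0 \<le> t" and B[measurable]: "B \<in> sets borel"
  shows "emeasure (law_at M t) B \<le> emeasure M B"
proof -
  interpret D: prob_space "driving J" by (rule prob_space_driving)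
  interpret MD: pair_prob_space M "driving J" ..
  have [measurable]: "(\<lambda>(x, \<omega>). loc x \<omega> t) \<in> borel_measurable (M \<Otimes>\<^sub>M driving J)"
    using location_measurable[of t] measurable_cong_sets[OF sets_pair_measure_cong[OF M.events_eq_borel refl] refl]
    by blast
  define f where "f n = (\<lambda>(x, \<omega>). indicator {urge_time \<omega> n..<urge_time \<omega> (Suc n)} t *
     (indicator B (coast n t x \<omega>) :: ennreal))" for n
  have ind: "indicator {a..<c} (b::real) = (if a \<le> b \<and> b < c then 1 else 0::ennreal)" for a b c by auto
  have [measurable]: "f n \<in> borel_measurable (M \<Otimes>\<^sub>M driving J)" for n
    unfolding f_def ind split_beta' by measurable
  have ae: "AE z in M \<Otimes>\<^sub>M driving J. (\<forall>n. 0 < fst (snd z n)) \<and> (\<exists>n. t < urge_time (snd z) n)"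
  proof (rule MD.AE_pair_measure)
    note [measurable] = measurable_step_parts
    show "{z \<in> space (M \<Otimes>\<^sub>M driving J). (\<forall>n. 0 < fst (snd z n)) \<and> (\<exists>n. t < urge_time (snd z) n)}
        \<in> sets (M \<Otimes>\<^sub>M driving J)" by measurable
    show "AE x in M. AE y in driving J. (\<forall>n. 0 < fst (snd (x, y) n)) \<and> (\<exists>n. t < urge_time (snd (x, y)) n)"
      using AE_waiting_times_pos AE_urge_time_unbounded by simp
  qed
  have "emeasure (law_at M t) B =
      (\<integral>\<^sup>+y. indicator B y \<partial>law_at M t)"
    by simp
  also have "\<dots> = (\<integral>\<^sup>+z. indicator B (case z of (x, \<omega>) \<Rightarrow> loc x \<omega> t) \<partial>(M \<Otimes>\<^sub>M driving J))"
    by (rule nn_integral_distr) measurable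
  also have "\<dots> \<le> (\<integral>\<^sup>+z. (\<Sum>n. f n z) \<partial>(M \<Otimes>\<^sub>M driving J))"
  proof (rule nn_integral_mono_AE, use ae in eventually_elim)
    fix z :: "real \<times> (nat \<Rightarrow> real \<times> real \<times> real)"
    assume z: "(\<forall>n. 0 < fst (snd z n)) \<and> (\<exists>n. t < urge_time (snd z) n)"
    obtain x \<omega> where zz: "z = (x, \<omega>)" by (cases z)
    obtain n where n: "urge_time \<omega> n \<le> t" "t < urge_time \<omega> (Suc n)"
      using z ex_last_urge[OF t] by (auto simp: zz)
    then have "urge_count \<omega> t = n" using z by (intro urge_count_eq) (auto simp: zz)
    then have "indicator B (case z of (x, \<omega>) \<Rightarrow> loc x \<omega> t) = f n z"
      using n by (simp add: zz f_def location_def)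
    also have "\<dots> \<le> (\<Sum>n. f n z)"
      using sum_le_suminf[of "\<lambda>n. f n z" "{n}"] by simp
    finally show "indicator B (case z of (x, \<omega>) \<Rightarrow> loc x \<omega> t) \<le> (\<Sum>n. f n z)" .
  qed
  also have "\<dots> = (\<Sum>n. (\<integral>\<^sup>+z. f n z \<partial>(M \<Otimes>\<^sub>M driving J)))"
    by (rule nn_integral_suminf) measurable
  also have "\<dots> = (\<Sum>n. urge_part M n t (indicator B))"
    by (simp add: urge_part_eq[OF M] f_def start_def)
  also have "\<dots> \<le> (\<integral>\<^sup>+x. indicator B x \<partial>M)"
    by (rule suminf_le_const) (simp_all add: sum_urge_part_le t del: nn_integral_indicator)
  also have "\<dots> = emeasure M B" by simp
  finally show ?thesis .
qed

lemma location_law: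
  assumes "0 \<le> t"
  shows "law_at M t = M"
proof (rule prob_measure_eqI_le)
  interpret D: prob_space "driving J" by (rule prob_space_driving)
  interpret MD: pair_prob_space M "driving J" ..
  have "(\<lambda>(x, \<omega>). loc x \<omega> t) \<in> borel_measurable (M \<Otimes>\<^sub>M driving J)"
    using location_measurable[of t] measurable_cong_sets[OF sets_pair_measure_cong[OF M.events_eq_borel refl] refl]
    by blast
  then show "prob_space (law_at M t)"
    by (rule MD.P.prob_space_distr)
qed (use location_law_le[OF assms] M.prob_space_axioms in auto)

end

text \<open>A bound for sets extends to integrals of \<open>h\<close>, which average the measures of the superlevel sets of \<open>h\<close> over the
  levels in \<open>[0, k]\<close>.\<close>

lemma nn_integral_layer_cake_le:
  fixes M N :: "real measure" and h :: "real \<Rightarrow> real"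
  assumes M: "prob_space M" "sets M = sets borel" and N: "prob_space N" "sets N = sets borel"
    and [measurable]: "h \<in> borel_measurable borel" and h: "\<And>x. 0 \<le> h x" "\<And>x. h x \<le> k"
    and D: "0 \<le> D" "\<And>B. B \<in> sets borel \<Longrightarrow> emeasure M B \<le> emeasure N B + ennreal D"
  shows "(\<integral>\<^sup>+x. ennreal (h x) \<partial>M) \<le> (\<integral>\<^sup>+x. ennreal (h x) \<partial>N) + ennreal (k * D)"
proof -
  have k: "0 \<le> k" using h[of 0] by linarith
  have cake: "(\<integral>\<^sup>+x. ennreal (h x) \<partial>P) = (\<integral>\<^sup>+u. emeasure P {x. u < h x} * indicator {0..<k} u \<partial>lborel)"
    if P: "prob_space P" and sP[measurable_cong]: "sets P = sets borel" for P :: "real measure"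
  proof -
    interpret P: prob_space P by fact
    interpret pair_sigma_finite P lborel ..
    have sp: "space P = UNIV" using sets_eq_imp_space_eq[OF sP] by simp
    have "(\<integral>\<^sup>+x. ennreal (h x) \<partial>P) = (\<integral>\<^sup>+x. (\<integral>\<^sup>+u. (if 0 \<le> u \<and> u < h x then 1 else 0) \<partial>lborel) \<partial>P)"
    proof (rule nn_integral_cong)
      fix x
      have "(\<integral>\<^sup>+u. (if 0 \<le> u \<and> u < h x then 1 else 0) \<partial>lborel) = (\<integral>\<^sup>+u. indicator {0..<h x} u \<partial>lborel)"
        by (intro nn_integral_cong) auto
      then show "ennreal (h x) = (\<integral>\<^sup>+u. (if 0 \<le> u \<and> u < h x then 1 else 0) \<partial>lborel)" using h by simp
    qed
    also have "\<dots> = (\<integral>\<^sup>+u. (\<integral>\<^sup>+x. (if 0 \<le> u \<and> u < h x then 1 else 0) \<partial>P) \<partial>lborel)"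
      by (rule Fubini'[symmetric]) simp
    also have "\<dots> = (\<integral>\<^sup>+u. emeasure P {x. u < h x} * indicator {0..<k} u \<partial>lborel)"
    proof (rule nn_integral_cong)
      fix u :: real
      have "{x \<in> space P. u < h x} \<in> sets P" by measurable
      then have [measurable]: "{x. u < h x} \<in> sets P" by (simp add: sp)
      have "(\<integral>\<^sup>+x. (if 0 \<le> u \<and> u < h x then 1 else 0) \<partial>P) =
          (\<integral>\<^sup>+x. indicator {x. u < h x} x * indicator {0..<k} u \<partial>P)"
        using h by (intro nn_integral_cong) (auto simp: indicator_def intro: less_le_trans)
      then show "(\<integral>\<^sup>+x. (if 0 \<le> u \<and> u < h x then 1 else 0) \<partial>P) = emeasure P {x. u < h x} * indicator {0..<k} u"
        by (simp add: nn_integral_multc)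
    qed
    finally show ?thesis .
  qed
  have "emeasure N {x. u < h x} = (\<integral>\<^sup>+x. (if u < h x then 1 else 0) \<partial>N)" for u
  proof -
    have "{x \<in> space borel. u < h x} \<in> sets borel" by measurable
    then have "{x. u < h x} \<in> sets N" by (simp add: N)
    then have "emeasure N {x. u < h x} = (\<integral>\<^sup>+x. indicator {x. u < h x} x \<partial>N)" by simp
    also have "\<dots> = (\<integral>\<^sup>+x. (if u < h x then 1 else 0) \<partial>N)"
      by (intro nn_integral_cong) auto
    finally show ?thesis .
  qed
  moreover have "(\<lambda>u. \<integral>\<^sup>+x. (if u < h x then 1 else 0) \<partial>N) \<in> borel_measurable borel"
  proof -
    interpret N: prob_space N by fact
    note N(2)[measurable_cong]
    show ?thesis by measurable
  qed
  ultimately have [measurable]: "(\<lambda>u. emeasure N {x. u < h x}) \<in> borel_measurable borel" by simp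
  have "(\<integral>\<^sup>+x. ennreal (h x) \<partial>M) \<le>
      (\<integral>\<^sup>+u. emeasure N {x. u < h x} * indicator {0..<k} u + ennreal D * indicator {0..<k} u \<partial>lborel)"
    unfolding cake[OF M]
  proof (rule nn_integral_mono)
    fix u :: real
    have "{x \<in> space borel. u < h x} \<in> sets borel" by measurable
    then have "emeasure M {x. u < h x} \<le> emeasure N {x. u < h x} + ennreal D" by (intro D) simp
    then show "emeasure M {x. u < h x} * indicator {0..<k} u \<le>
        emeasure N {x. u < h x} * indicator {0..<k} u + ennreal D * indicator {0..<k} u"
      by (auto simp: indicator_def)
  qed
  also have "\<dots> = (\<integral>\<^sup>+x. ennreal (h x) \<partial>N) + (\<integral>\<^sup>+u. ennreal D * indicator {0..<k} u \<partial>lborel)"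
    unfolding cake[OF N] by (rule nn_integral_add) measurable
  also have "(\<integral>\<^sup>+u. ennreal D * indicator {0..<k} u \<partial>lborel) = ennreal (k * D)"
    using k D by (subst nn_integral_cmult_indicator) (simp_all add: ennreal_mult[symmetric] mult.commute)
  finally show ?thesis .
qed

context particle
begin

text \<open>If no urge occurs for a time \<open>T = (BL + BR) / w\<close>, the particle ends up in \<open>- BL\<close> wherever it
  started, so two stationary laws have a common part of mass \<open>exp (- T)\<close> and their distance
  contracts by the factor \<open>1 - exp (- T)\<close>.\<close>

lemma stationary_le:
  assumes M1: "dist_fun_on_frame BL BR \<pi>1" and st1: "stationary \<eta> J w BL BR \<gamma> \<pi>1"
    and M2: "dist_fun_on_frame BL BR \<pi>2" and st2: "stationary \<eta> J w BL BR \<gamma> \<pi>2"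
    and B: "B \<in> sets borel"
  shows "emeasure (interval_measure \<pi>1) B \<le> emeasure (interval_measure \<pi>2) B"
proof -
  define T where "T = (BL + BR) / w"
  have T: "0 \<le> T" "w * T = BL + BR" using pos by (auto simp: T_def)
  define c where "c = exp (- T)"
  have c: "0 < c" "c \<le> 1" using T by (auto simp: c_def)
  interpret D: prob_space "driving J" by (rule prob_space_driving)
  note [measurable] = measurable_step_parts location_measurable
  define A where "A = {\<omega> \<in> space (driving J). T < fst (\<omega> 0)}"
  have [measurable]: "A \<in> sets (driving J)" unfolding A_def by measurable
  have "emeasure (driving J) A = (\<integral>\<^sup>+\<omega>. indicator A \<omega> \<partial>driving J)" by simp
  also have "\<dots> = (\<integral>\<^sup>+\<omega>. indicator {T<..} (fst (\<omega> 0)) \<partial>driving J)"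
    by (intro nn_integral_cong) (auto simp: A_def indicator_def)
  also have "\<dots> = (\<integral>\<^sup>+\<omega>. (\<integral>\<^sup>+e. indicator {T<..} (fst e) \<partial>step) \<partial>driving J)"
    by (rule resample[where h = "\<lambda>\<omega> e. indicator {T<..} (fst e)"]) (auto simp: split_beta')
  also have "\<dots> = (\<integral>\<^sup>+e. indicator {T<..} (fst e) \<partial>step)"
    using D.emeasure_space_1 by (simp only: nn_integral_const mult_1_right)
  also have "\<dots> = (\<integral>\<^sup>+s. (\<integral>\<^sup>+v. indicator {T<..} s \<partial>decision J) \<partial>waiting_time)"
    by (subst nn_integral_pair[OF UJ.prob_space_axioms]) auto
  also have "\<dots> = (\<integral>\<^sup>+s. indicator {T<..} s \<partial>waiting_time)"
    using UJ.emeasure_space_1 by (intro nn_integral_cong) (simp only: nn_integral_const mult_1_right)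
  also have "\<dots> = ennreal c" using waiting_time_tail[OF T(1)] by (simp add: c_def)
  finally have A: "D.prob A = c" using c by (simp add: D.emeasure_eq_measure)
  \<comment> \<open>The part of the transition kernel that remains after removing the common mass \<open>c\<close> in \<open>- BL\<close>.\<close>
  define h where "h B x = D.prob {\<omega> \<in> space (driving J). \<omega> \<notin> A \<and> loc x \<omega> T \<in> B}" for B x
  have h_le: "h B x \<le> 1 - c" for B x
  proof -
    have "space (driving J) - A \<in> sets (driving J)" by (rule sets.compl_sets) measurable
    then have "h B x \<le> D.prob (space (driving J) - A)"
      unfolding h_def by (intro D.finite_measure_mono) auto
    also have "\<dots> = 1 - c" using D.prob_compl[of A] A by simp
    finally show ?thesis .
  qed
  have loc1: "(\<lambda>\<omega>. loc x \<omega> T) \<in> borel_measurable (driving J)" for x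
    using measurable_Pair2[OF location_measurable, of x T] by simp
  have h_meas[measurable]: "h B \<in> borel_measurable borel" if [measurable]: "B \<in> sets borel" for B
  proof -
    define C where "C = {z \<in> space (borel \<Otimes>\<^sub>M driving J). snd z \<notin> A \<and> (\<lambda>(x, \<omega>). loc x \<omega> T) z \<in> B}"
    have "C \<in> sets (borel \<Otimes>\<^sub>M driving J)" unfolding C_def by measurable
    from D.measurable_emeasure_Pair[OF this]
    have "(\<lambda>x. enn2real (emeasure (driving J) (Pair x -` C))) \<in> borel_measurable borel" by measurable
    moreover have "Pair x -` C = {\<omega> \<in> space (driving J). \<omega> \<notin> A \<and> loc x \<omega> T \<in> B}" for x
      by (auto simp: C_def space_pair_measure)
    ultimately show ?thesis by (simp add: h_def[abs_def] measure_def)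
  qed
  have decomp: "emeasure (interval_measure \<pi>) B = ennreal c * indicator B (- BL) + (\<integral>\<^sup>+x. ennreal (h B x) \<partial>interval_measure \<pi>)"
    if fr: "dist_fun_on_frame BL BR \<pi>" and st: "stationary \<eta> J w BL BR \<gamma> \<pi>" and B[measurable]: "B \<in> sets borel" for \<pi> B
  proof -
    interpret P: real_distribution "interval_measure \<pi>"
      using fr by (intro real_distribution_of_dist_fun) (simp add: dist_fun_on_frame_def)
    have [measurable]: "(\<lambda>(x, \<omega>). loc x \<omega> T) \<in> borel_measurable (interval_measure \<pi> \<Otimes>\<^sub>M driving J)"
      using location_measurable[of T] measurable_cong_sets[OF sets_pair_measure_cong[OF P.events_eq_borel refl] refl]
      by blast
    have "emeasure (interval_measure \<pi>) B = emeasure (law_at (interval_measure \<pi>) T) B"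
      using st T(1) by (simp add: stationary_def)
    also have "\<dots> = (\<integral>\<^sup>+y. indicator B y \<partial>law_at (interval_measure \<pi>) T)"
      by simp
    also have "\<dots> = (\<integral>\<^sup>+z. indicator B (case z of (x, \<omega>) \<Rightarrow> loc x \<omega> T) \<partial>(interval_measure \<pi> \<Otimes>\<^sub>M driving J))"
      by (rule nn_integral_distr) measurable
    also have "\<dots> = (\<integral>\<^sup>+x. (\<integral>\<^sup>+\<omega>. indicator B (loc x \<omega> T) \<partial>driving J) \<partial>interval_measure \<pi>)"
      by (subst nn_integral_pair[OF prob_space_driving]) auto
    also have "\<dots> = (\<integral>\<^sup>+x. ennreal c * indicator B (- BL) + ennreal (h B x) \<partial>interval_measure \<pi>)"
    proof (rule nn_integral_cong_AE, use frame_AE[OF fr] in eventually_elim)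
      fix x assume x: "- BL \<le> x \<and> x \<le> BR"
      define C where "C = {\<omega> \<in> space (driving J). \<omega> \<notin> A \<and> loc x \<omega> T \<in> B}"
      note loc1[of x, measurable]
      have [measurable]: "C \<in> sets (driving J)" unfolding C_def by measurable
      have "(\<integral>\<^sup>+\<omega>. indicator B (loc x \<omega> T) \<partial>driving J) =
          (\<integral>\<^sup>+\<omega>. indicator B (- BL) * indicator A \<omega> + indicator C \<omega> \<partial>driving J)"
      proof (rule nn_integral_cong_AE, use AE_waiting_times_pos in eventually_elim)
        fix \<omega> :: "nat \<Rightarrow> real \<times> real \<times> real" assume p: "\<forall>n. 0 < fst (\<omega> n)"
        show "indicator B (loc x \<omega> T) = indicator B (- BL) * indicator A \<omega> + (indicator C \<omega> :: ennreal)"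
        proof (cases "\<omega> \<in> A")
          case True
          then have "urge_count \<omega> T = 0"
            using T by (intro urge_count_eq[OF p]) (auto simp: A_def urge_time_def)
          then have "loc x \<omega> T = - BL"
            using T x by (simp add: location_def urge_time_def drift_def)
          then show ?thesis using True by (simp add: C_def)
        next
          case False
          then show ?thesis by (simp add: C_def indicator_def)
        qed
      qed
      also have "\<dots> = (\<integral>\<^sup>+\<omega>. indicator B (- BL) * indicator A \<omega> \<partial>driving J) + (\<integral>\<^sup>+\<omega>. indicator C \<omega> \<partial>driving J)"
        by (rule nn_integral_add) measurable
      also have "\<dots> = ennreal c * indicator B (- BL) + ennreal (h B x)"
      proof -
        have "(\<integral>\<^sup>+\<omega>. indicator B (- BL) * indicator A \<omega> \<partial>driving J) = indicator B (- BL) * emeasure (driving J) A"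
          by (rule nn_integral_cmult_indicator) measurable
        moreover have "(\<integral>\<^sup>+\<omega>. indicator C \<omega> \<partial>driving J) = emeasure (driving J) C"
          by (rule nn_integral_indicator) measurable
        moreover have "h B x = D.prob C" by (simp only: h_def C_def)
        ultimately show ?thesis by (simp only: D.emeasure_eq_measure A mult.commute)
      qed
      finally show "(\<integral>\<^sup>+\<omega>. indicator B (loc x \<omega> T) \<partial>driving J) =
          ennreal c * indicator B (- BL) + ennreal (h B x)" .
    qed
    also have "\<dots> = ennreal c * indicator B (- BL) + (\<integral>\<^sup>+x. ennreal (h B x) \<partial>interval_measure \<pi>)"
      using P.emeasure_space_1 by (subst nn_integral_add) auto
    finally show ?thesis .
  qed
  interpret P1: real_distribution "interval_measure \<pi>1"
    using M1 by (intro real_distribution_of_dist_fun) (simp add: dist_fun_on_frame_def)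
  interpret P2: real_distribution "interval_measure \<pi>2"
    using M2 by (intro real_distribution_of_dist_fun) (simp add: dist_fun_on_frame_def)
  \<comment> \<open>Each application of stationarity improves the bound by the factor \<open>1 - c\<close>.\<close>
  have *: "emeasure (interval_measure \<pi>1) B \<le> emeasure (interval_measure \<pi>2) B + ennreal ((1 - c) ^ n)"
    if "B \<in> sets borel" for B n
    using that
  proof (induction n arbitrary: B)
    case 0
    have "emeasure (interval_measure \<pi>1) B \<le> 1" by (rule P1.emeasure_le_1)
    then show ?case by (simp add: add_increasing)
  next
    case (Suc n)
    have "(\<integral>\<^sup>+x. ennreal (h B x) \<partial>interval_measure \<pi>1) \<le>
        (\<integral>\<^sup>+x. ennreal (h B x) \<partial>interval_measure \<pi>2) + ennreal ((1 - c) * (1 - c) ^ n)"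
      using c h_le Suc h_meas
      by (intro nn_integral_layer_cake_le P1.prob_space_axioms P2.prob_space_axioms) (auto simp: h_def)
    then show ?case
      unfolding decomp[OF M1 st1 Suc.prems] decomp[OF M2 st2 Suc.prems]
      by (simp add: add.assoc add_left_mono)
  qed
  have "P1.prob B \<le> P2.prob B + (1 - c) ^ n" for n
  proof -
    have "ennreal (P1.prob B) \<le> ennreal (P2.prob B + (1 - c) ^ n)"
      using *[OF B, of n] c by (simp add: P1.emeasure_eq_measure P2.emeasure_eq_measure)
    moreover have "0 \<le> P2.prob B + (1 - c) ^ n" using c by (intro add_nonneg_nonneg) auto
    ultimately show ?thesis by (simp only: ennreal_le_iff)
  qed
  moreover have "(\<lambda>n. P2.prob B + (1 - c) ^ n) \<longlonglongrightarrow> P2.prob B + 0"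
    using c by (intro tendsto_intros LIMSEQ_power_zero) auto
  ultimately have "P1.prob B \<le> P2.prob B + 0"
    by (intro LIMSEQ_le_const) auto
  then show ?thesis by (simp add: P1.emeasure_eq_measure P2.emeasure_eq_measure)
qed

lemma stationary_unique:
  assumes M1: "dist_fun_on_frame BL BR \<pi>1" and st1: "stationary \<eta> J w BL BR \<gamma> \<pi>1"
    and M2: "dist_fun_on_frame BL BR \<pi>2" and st2: "stationary \<eta> J w BL BR \<gamma> \<pi>2"
  shows "\<pi>1 = \<pi>2"
proof -
  have d: "dist_fun \<pi>1" "dist_fun \<pi>2" using M1 M2 by (auto simp: dist_fun_on_frame_def)
  have "interval_measure \<pi>1 = interval_measure \<pi>2"
    using real_distribution_of_dist_fun[OF d(1)] real_distribution_of_dist_fun[OF d(2)]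
    by (intro prob_measure_eqI_le) (auto intro: stationary_le[OF assms] simp: real_distribution_def)
  then show ?thesis by (metis cdf_of_dist_fun d)
qed

lemma stationary_of_flux_balanced:
  assumes "dist_fun_on_frame BL BR \<pi>" "flux_balanced w BL BR p J (interval_measure \<pi>)"
  shows "stationary \<eta> J w BL BR \<gamma> \<pi>"
proof -
  interpret balanced_law \<eta> J w BL BR \<gamma> "interval_measure \<pi>"
  proof (intro balanced_law.intro balanced_law_axioms.intro particle_axioms)
    show "real_distribution (interval_measure \<pi>)"
      using assms by (intro real_distribution_of_dist_fun) (simp add: dist_fun_on_frame_def)
    show "AE x in interval_measure \<pi>. - BL \<le> x \<and> x \<le> BR" by (rule frame_AE[OF assms(1)])
    show "flux_balanced w BL BR p J (interval_measure \<pi>)" by (rule assms(2))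
  qed
  show ?thesis unfolding stationary_def by (intro allI impI location_law)
qed

end

section \<open>Existence of the stationary law for a given environment\<close>

context particle
begin

text \<open>A flux-balanced law consists of an atom in \<open>- BL\<close> and a density on \<open>(- BL, BR]\<close>. Both are
  encoded in one Lebesgue density \<open>profile\<close> on \<open>(- BL - 1, BR]\<close>: collapsing the unit interval below
  \<open>- BL\<close> to the point \<open>- BL\<close> produces the atom. Flux balance then is a linear Volterra equation
  for \<open>profile\<close>, whose iterates starting from the atom alone increase.\<close>

abbreviation collapse :: "real \<Rightarrow> real" where "collapse \<equiv> max (- BL)"

definition kernel :: "real \<Rightarrow> real \<Rightarrow> ennreal" where
  "kernel u x = ennreal (p (collapse x) * (1 - J (u - collapse x))) * indicator {..u} (collapse x)"

primrec picard :: "nat \<Rightarrow> real \<Rightarrow> ennreal" where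
  "picard 0 u = indicator {- BL - 1<..- BL} u"
| "picard (Suc n) u = (if u \<le> - BL then indicator {- BL - 1<..- BL} u
     else if u \<le> BR then ennreal (1 / w) * (\<integral>\<^sup>+x. picard n x * kernel u x \<partial>lborel) else 0)"

definition profile :: "real \<Rightarrow> ennreal" where "profile u = (SUP n. picard n u)"

lemma kernel_measurable[measurable (raw)]:
  assumes [measurable]: "f \<in> borel_measurable N" "h \<in> borel_measurable N"
  shows "(\<lambda>z. kernel (f z) (h z)) \<in> borel_measurable N"
proof -
  have "(\<lambda>z. kernel (f z) (h z)) = (\<lambda>z. if collapse (h z) \<le> f z then
      ennreal (p (collapse (h z)) * (1 - J (f z - collapse (h z)))) else 0)"
    by (auto simp: kernel_def fun_eq_iff)
  then show ?thesis by simp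
qed

lemma picard_measurable[measurable]: "picard n \<in> borel_measurable borel"
proof (induction n)
  case 0
  have "picard 0 = (\<lambda>u. indicator {- BL - 1<..- BL} u)" by auto
  then show ?case by simp
next
  case (Suc n)
  note [measurable] = Suc
  have "picard (Suc n) = (\<lambda>u. if u \<le> - BL then indicator {- BL - 1<..- BL} u
     else if u \<le> BR then ennreal (1 / w) * (\<integral>\<^sup>+x. picard n x * kernel u x \<partial>lborel) else 0)" by auto
  then show ?case by simp
qed

lemma profile_measurable[measurable]: "profile \<in> borel_measurable borel"
  unfolding profile_def[abs_def] by measurable

lemma picard_mono: "picard n u \<le> picard (Suc n) u"
proof (induction n arbitrary: u)
  case 0
  show ?case by (auto simp: indicator_def)
next
  case (Suc n)
  have "(\<integral>\<^sup>+x. picard n x * kernel u x \<partial>lborel) \<le> (\<integral>\<^sup>+x. picard (Suc n) x * kernel u x \<partial>lborel)"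
    by (intro nn_integral_mono mult_right_mono Suc) simp
  then show ?case
    unfolding picard.simps(2)[of "Suc n"] picard.simps(2)[of n u] by (simp add: mult_left_mono del: picard.simps)
qed

lemma incseq_picard: "incseq (\<lambda>n. picard n u)"
  by (intro incseq_SucI picard_mono)

lemma kernel_le_1: "kernel u x \<le> 1"
  by (auto simp: kernel_def indicator_def intro!: mult_le_one)

text \<open>The exponential solves the equation with kernel \<open>1\<close> started from the left end \<open>- BL - 1\<close> and dominates the
  initial value \<open>1\<close>, so the bound reproduces itself.\<close>

lemma picard_bound: "picard n u \<le> ennreal (exp ((u + BL + 1) / w)) * indicator {- BL - 1..BR} u"
proof (induction n arbitrary: u)
  case 0
  show ?case using pos by (auto simp: indicator_def)
next
  case (Suc n)
  show ?case
  proof (cases "- BL < u \<and> u \<le> BR")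
    case False
    then show ?thesis using pos by (auto simp: indicator_def)
  next
    case u: True
    have "(\<integral>\<^sup>+x. picard n x * kernel u x \<partial>lborel) \<le>
        (\<integral>\<^sup>+x. ennreal (exp ((x + BL + 1) / w)) * indicator {- BL - 1..u} x \<partial>lborel)"
    proof (rule nn_integral_mono)
      fix x
      show "picard n x * kernel u x \<le> ennreal (exp ((x + BL + 1) / w)) * indicator {- BL - 1..u} x"
      proof (cases "x \<le> u")
        case True
        have "picard n x * kernel u x \<le> ennreal (exp ((x + BL + 1) / w)) * indicator {- BL - 1..BR} x * 1"
          by (intro mult_mono Suc kernel_le_1) auto
        moreover have "indicator {- BL - 1..BR} x = (indicator {- BL - 1..u} x :: ennreal)"
          using True u by (auto simp: indicator_def)
        ultimately show ?thesis by simp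
      next
        case False
        then have "kernel u x = 0" by (simp add: kernel_def)
        then show ?thesis by simp
      qed
    qed
    also have "\<dots> = ennreal (w * exp ((u + BL + 1) / w) - w * exp ((- BL - 1 + BL + 1) / w))"
      using u pos
      by (intro nn_integral_FTC_Icc) (auto intro!: derivative_eq_intros)
    also have "\<dots> \<le> ennreal (w * exp ((u + BL + 1) / w))"
      using pos by (intro ennreal_leI) simp
    finally have "ennreal (1 / w) * (\<integral>\<^sup>+x. picard n x * kernel u x \<partial>lborel) \<le>
        ennreal (1 / w) * ennreal (w * exp ((u + BL + 1) / w))"
      by (rule mult_left_mono) simp
    also have "\<dots> = ennreal (exp ((u + BL + 1) / w))"
      using pos by (simp add: ennreal_mult[symmetric])
    finally show ?thesis using u pos by simp
  qed
qed

lemma profile_bound: "profile u \<le> ennreal (exp ((u + BL + 1) / w)) * indicator {- BL - 1..BR} u"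
  unfolding profile_def by (intro SUP_least picard_bound)

lemma profile_eq:
  assumes "- BL < u" "u \<le> BR"
  shows "ennreal w * profile u = (\<integral>\<^sup>+x. profile x * kernel u x \<partial>lborel)"
proof -
  have "(\<integral>\<^sup>+x. profile x * kernel u x \<partial>lborel) = (\<integral>\<^sup>+x. (SUP n. picard n x * kernel u x) \<partial>lborel)"
    unfolding profile_def by (simp add: SUP_mult_right_ennreal)
  also have "\<dots> = (SUP n. \<integral>\<^sup>+x. picard n x * kernel u x \<partial>lborel)"
    by (rule nn_integral_monotone_convergence_SUP)
       (auto simp: incseq_def le_fun_def intro!: mult_right_mono incseqD[OF incseq_picard] simp del: picard.simps)
  also have "\<dots> = (SUP n. ennreal w * picard (Suc n) u)"
  proof -
    have "ennreal w * picard (Suc n) u = (\<integral>\<^sup>+x. picard n x * kernel u x \<partial>lborel)" for n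
    proof -
      have "ennreal w * picard (Suc n) u = (ennreal w * ennreal (1 / w)) * (\<integral>\<^sup>+x. picard n x * kernel u x \<partial>lborel)"
        using assms by (simp add: mult.assoc)
      also have "ennreal w * ennreal (1 / w) = 1"
        using pos by (simp add: ennreal_mult[symmetric])
      finally show ?thesis by simp
    qed
    then show ?thesis by (simp del: picard.simps)
  qed
  also have "\<dots> = ennreal w * (SUP n. picard (Suc n) u)"
    by (rule SUP_mult_left_ennreal[symmetric])
  also have "(SUP n. picard (Suc n) u) = profile u"
  proof (rule antisym)
    show "(SUP n. picard (Suc n) u) \<le> profile u"
      unfolding profile_def by (rule SUP_least) (rule SUP_upper, simp)
    show "profile u \<le> (SUP n. picard (Suc n) u)"
      unfolding profile_def by (rule SUP_mono) (use picard_mono in blast)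
  qed
  finally show ?thesis by simp
qed

definition total_mass :: ennreal where "total_mass = (\<integral>\<^sup>+u. profile u \<partial>lborel)"

lemma total_mass_pos: "total_mass \<noteq> 0"
proof -
  have "1 = (\<integral>\<^sup>+u. indicator {- BL - 1<..- BL} u \<partial>lborel)" by simp
  also have "\<dots> \<le> total_mass"
    unfolding total_mass_def profile_def by (intro nn_integral_mono SUP_upper2[of 0]) auto
  finally show ?thesis by auto
qed

lemma total_mass_finite: "total_mass \<noteq> \<top>"
proof -
  have "total_mass \<le> (\<integral>\<^sup>+u. ennreal (exp ((BR + BL + 1) / w)) * indicator {- BL - 1..BR} u \<partial>lborel)"
    unfolding total_mass_def
  proof (rule nn_integral_mono)
    fix u
    have "ennreal (exp ((u + BL + 1) / w)) * indicator {- BL - 1..BR} u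
        \<le> ennreal (exp ((BR + BL + 1) / w)) * indicator {- BL - 1..BR} u"
      using pos by (auto simp: indicator_def divide_right_mono)
    with profile_bound[of u] show "profile u \<le> ennreal (exp ((BR + BL + 1) / w)) * indicator {- BL - 1..BR} u"
      by (rule order_trans)
  qed
  also have "\<dots> < \<top>"
    using pos by (simp add: nn_integral_cmult_indicator ennreal_mult_less_top)
  finally show ?thesis by simp
qed

definition law :: "real measure" where
  "law = distr (density lborel (\<lambda>u. profile u / total_mass)) borel collapse"

lemma nn_integral_law:
  assumes [measurable]: "f \<in> borel_measurable borel"
  shows "(\<integral>\<^sup>+y. f y \<partial>law) = (\<integral>\<^sup>+u. profile u / total_mass * f (collapse u) \<partial>lborel)"
proof -
  have "(\<integral>\<^sup>+y. f y \<partial>law) = (\<integral>\<^sup>+u. f (collapse u) \<partial>density lborel (\<lambda>u. profile u / total_mass))"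
    unfolding law_def by (rule nn_integral_distr) auto
  also have "\<dots> = (\<integral>\<^sup>+u. profile u / total_mass * f (collapse u) \<partial>lborel)"
    by (rule nn_integral_density) measurable
  finally show ?thesis .
qed

lemma law_distribution: "real_distribution law"
proof -
  have "emeasure law UNIV = (\<integral>\<^sup>+y. indicator UNIV y \<partial>law)"
    by (subst nn_integral_indicator) (simp_all add: law_def)
  also have "\<dots> = (\<integral>\<^sup>+u. profile u / total_mass \<partial>lborel)" by (subst nn_integral_law) simp_all
  also have "\<dots> = total_mass / total_mass" unfolding total_mass_def[of] by (rule nn_integral_divide) measurable
  also have "\<dots> = 1" using total_mass_pos total_mass_finite by (simp add: ennreal_divide_self less_top)
  finally have "prob_space law" by (intro prob_spaceI) (simp add: law_def)
  then show ?thesis by (intro real_distribution.intro real_distribution_axioms.intro) (auto simp: law_def)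
qed

lemma law_frame: "AE y in law. - BL \<le> y \<and> y \<le> BR"
proof -
  have "profile u = 0" if "BR < u" for u using profile_bound[of u] that by simp
  then have "AE u in lborel. 0 < profile u / total_mass \<longrightarrow> - BL \<le> collapse u \<and> collapse u \<le> BR"
    using pos by (intro AE_I2) (auto simp: not_le[symmetric] max_def)
  then show ?thesis
    using pos unfolding law_def by (subst AE_distr_iff) (auto simp: AE_density)
qed

lemma law_balanced: "flux_balanced w BL BR p J law"
  unfolding flux_balanced_def
proof
  fix x assume x: "x \<in> {- BL..BR}"
  have fl: "flux p J law c = ennreal w * (profile c / total_mass)" if c: "- BL < c" "c \<le> BR" for c
  proof -
    have "flux p J law c = (\<integral>\<^sup>+u. profile u / total_mass * kernel c u \<partial>lborel)"
      unfolding flux_def kernel_def by (rule nn_integral_law) measurable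
    also have "\<dots> = (\<integral>\<^sup>+u. profile u * kernel c u / total_mass \<partial>lborel)"
      by (intro nn_integral_cong) (simp add: divide_ennreal_def mult_ac)
    also have "\<dots> = (\<integral>\<^sup>+u. profile u * kernel c u \<partial>lborel) / total_mass"
      by (rule nn_integral_divide) measurable
    also have "\<dots> = ennreal w * (profile c / total_mass)"
      unfolding profile_eq[OF c, symmetric] by (simp add: divide_ennreal_def mult_ac)
    finally show ?thesis .
  qed
  have em: "emeasure law {..y} = (\<integral>\<^sup>+u. profile u / total_mass * indicator {..y} u \<partial>lborel)" if "- BL \<le> y" for y
  proof -
    have "emeasure law {..y} = (\<integral>\<^sup>+z. indicator {..y} z \<partial>law)"
      by (subst nn_integral_indicator) (simp_all add: law_def)
    also have "\<dots> = (\<integral>\<^sup>+u. profile u / total_mass * indicator {..y} (collapse u) \<partial>lborel)"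
      by (rule nn_integral_law) measurable
    also have "\<dots> = (\<integral>\<^sup>+u. profile u / total_mass * indicator {..y} u \<partial>lborel)"
      using that by (intro nn_integral_cong) (auto simp: indicator_def)
    finally show ?thesis .
  qed
  have "ennreal w * emeasure law {..x} = (\<integral>\<^sup>+u. ennreal w * (profile u / total_mass * indicator {..x} u) \<partial>lborel)"
    using x by (subst em) (auto simp: nn_integral_cmult)
  also have "\<dots> = (\<integral>\<^sup>+u. ennreal w * (profile u / total_mass * indicator {..- BL} u) + flux p J law u * indicator {- BL<..x} u \<partial>lborel)"
    using x by (intro nn_integral_cong) (auto simp: indicator_def fl)
  also have "\<dots> = (\<integral>\<^sup>+u. ennreal w * (profile u / total_mass * indicator {..- BL} u) + flux p J law u * indicator {- BL..x} u \<partial>lborel)"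
    using AE_lborel_singleton[of "- BL"]
    by (intro nn_integral_cong_AE, eventually_elim) (auto simp: indicator_def)
  also have "\<dots> = (\<integral>\<^sup>+u. ennreal w * (profile u / total_mass * indicator {..- BL} u) \<partial>lborel) +
      (\<integral>\<^sup>+u. flux p J law u * indicator {- BL..x} u \<partial>lborel)"
  proof -
    note [measurable] = flux_measurable[OF law_distribution]
    show ?thesis by (rule nn_integral_add) measurable
  qed
  also have "(\<integral>\<^sup>+u. ennreal w * (profile u / total_mass * indicator {..- BL} u) \<partial>lborel) = ennreal w * emeasure law {..- BL}"
    by (subst em) (auto simp: nn_integral_cmult)
  finally show "ennreal w * emeasure law {..x} =
      ennreal w * emeasure law {..- BL} + (\<integral>\<^sup>+u. flux p J law u * indicator {- BL..x} u \<partial>lborel)" .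
qed

text \<open>The law just constructed is stationary because it is flux balanced, and by uniqueness it is the image of
  \<open>\<gamma>\<close> under the operator.\<close>

lemma opA_frame: "dist_fun_on_frame BL BR (opA \<eta> J w BL BR \<gamma>)"
  and opA_stationary: "stationary \<eta> J w BL BR \<gamma> (opA \<eta> J w BL BR \<gamma>)"
  and opA_balanced: "flux_balanced w BL BR p J (interval_measure (opA \<eta> J w BL BR \<gamma>))"
proof -
  have fr: "dist_fun_on_frame BL BR (cdf law)"
    using frame_AE_iff[OF law_distribution] law_frame by blast
  have fb: "flux_balanced w BL BR p J (interval_measure (cdf law))"
    using law_balanced by (simp add: interval_measure_of_cdf[OF law_distribution])
  have st: "stationary \<eta> J w BL BR \<gamma> (cdf law)"
    by (rule stationary_of_flux_balanced[OF fr fb])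
  have "opA \<eta> J w BL BR \<gamma> = cdf law"
    unfolding opA_def using fr st stationary_unique by (intro the_equality) blast+
  then show "dist_fun_on_frame BL BR (opA \<eta> J w BL BR \<gamma>)"
    "stationary \<eta> J w BL BR \<gamma> (opA \<eta> J w BL BR \<gamma>)"
    "flux_balanced w BL BR p J (interval_measure (opA \<eta> J w BL BR \<gamma>))"
    using fr st fb by simp_all
qed

lemma travelling_wave_iff_flux_balanced:
  "travelling_wave_shape \<eta> J w BL BR \<gamma> \<longleftrightarrow>
    dist_fun_on_frame BL BR \<gamma> \<and> flux_balanced w BL BR p J (interval_measure \<gamma>)"
proof
  assume "travelling_wave_shape \<eta> J w BL BR \<gamma>"
  then have "dist_fun_on_frame BL BR \<gamma>" "opA \<eta> J w BL BR \<gamma> = \<gamma>"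
    by (auto simp: travelling_wave_shape_def)
  then show "dist_fun_on_frame BL BR \<gamma> \<and> flux_balanced w BL BR p J (interval_measure \<gamma>)"
    using opA_balanced by simp
next
  assume a: "dist_fun_on_frame BL BR \<gamma> \<and> flux_balanced w BL BR p J (interval_measure \<gamma>)"
  then have "stationary \<eta> J w BL BR \<gamma> \<gamma>" by (intro stationary_of_flux_balanced) auto
  then have "\<gamma> = opA \<eta> J w BL BR \<gamma>"
    using a opA_frame opA_stationary by (intro stationary_unique) auto
  then show "travelling_wave_shape \<eta> J w BL BR \<gamma>"
    using a by (simp add: travelling_wave_shape_def)
qed

end

section \<open>Flux balance as a Volterra equation\<close>

lemma bounded_borel_integrable:
  fixes f :: "real \<Rightarrow> real"
  assumes [measurable]: "f \<in> borel_measurable borel" and f: "\<And>x. x \<in> {a..b} \<Longrightarrow> 0 \<le> f x \<and> f x \<le> C"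
  shows "f integrable_on {a..b}"
    and "(\<integral>\<^sup>+x. ennreal (f x) * indicator {a..b} x \<partial>lborel) = ennreal (integral {a..b} f)"
proof -
  have s: "set_integrable lborel {a..b} f"
    unfolding set_integrable_def
  proof (rule integrableI_bounded_set_indicator[where B = C])
    show "AE x in lborel. x \<in> {a..b} \<longrightarrow> norm (f x) \<le> C" using f by auto
  qed (auto simp: less_top[symmetric] emeasure_lborel_Icc_eq)
  show "f integrable_on {a..b}" using set_borel_integral_eq_integral(1)[OF s] .
  have "(\<integral>\<^sup>+x. ennreal (f x) * indicator {a..b} x \<partial>lborel) = (\<integral>\<^sup>+x. ennreal (indicator {a..b} x *\<^sub>R f x) \<partial>lborel)"
    by (intro nn_integral_cong) (auto simp: indicator_def)
  also have "\<dots> = ennreal (\<integral>x. indicator {a..b} x *\<^sub>R f x \<partial>lborel)"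
    using s f unfolding set_integrable_def
    by (intro nn_integral_eq_integral) (auto simp: indicator_def)
  also have "(\<integral>x. indicator {a..b} x *\<^sub>R f x \<partial>lborel) = integral {a..b} f"
    using set_borel_integral_eq_integral(2)[OF s] by (simp add: set_lebesgue_integral_def)
  finally show "(\<integral>\<^sup>+x. ennreal (f x) * indicator {a..b} x \<partial>lborel) = ennreal (integral {a..b} f)" .
qed

context decreasing_response
begin

text \<open>\<open>\<eta>\<close> is prescribed on \<open>[0, 1]\<close> only. Extended by constants, its primitive \<open>H\<close> is monotone and Lipschitz on
  all of \<open>\<real>\<close>, so that iterates which leave \<open>[0, 1]\<close> need no separate treatment; as \<open>\<eta> 1 = 0\<close>, \<open>H\<close> is constant
  beyond \<open>1\<close>.\<close>

definition etaC :: "real \<Rightarrow> real" where "etaC v = \<eta> (min 1 (max 0 v))"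

definition H :: "real \<Rightarrow> real" where "H v = integral {0..v} etaC"

lemma etaC_cont: "continuous_on A etaC"
  unfolding etaC_def
  by (rule continuous_on_compose2[OF eta_cont]) (auto intro!: continuous_intros)

lemma etaC_measurable[measurable]: "etaC \<in> borel_measurable borel"
  by (rule borel_measurable_continuous_onI[OF etaC_cont])

lemma etaC_eq: "0 \<le> v \<Longrightarrow> v \<le> 1 \<Longrightarrow> etaC v = \<eta> v"
  by (simp add: etaC_def)

lemma etaC_bounds: "0 \<le> etaC v" "etaC v \<le> 1"
  using eta_bounds[of "min 1 (max 0 v)"] by (auto simp: etaC_def)

lemma etaC_integrable: "etaC integrable_on {a..b}"
  by (intro integrable_continuous_interval etaC_cont)

lemma H_diff: "0 \<le> u \<Longrightarrow> u \<le> v \<Longrightarrow> H v - H u = integral {u..v} etaC"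
  unfolding H_def using Henstock_Kurzweil_Integration.integral_combine[of 0 u v etaC] etaC_integrable by simp

lemma H_0[simp]: "H 0 = 0" by (simp add: H_def)

lemma H_max: "H (max 0 v) = H v"
  by (cases "0 \<le> v") (auto simp: H_def max_def)

lemma H_increment:
  assumes "u \<le> v"
  shows "0 \<le> H v - H u" "H v - H u \<le> v - u"
proof -
  define a b where "a = max 0 u" and "b = max 0 v"
  have ab: "0 \<le> a" "a \<le> b" "b - a \<le> v - u" using assms by (auto simp: a_def b_def)
  have eq: "H v - H u = integral {a..b} etaC"
    using H_diff[OF ab(1,2)] H_max by (simp add: a_def b_def)
  show "0 \<le> H v - H u" unfolding eq
    using etaC_bounds by (intro integral_nonneg etaC_integrable) auto
  have "integral {a..b} etaC \<le> integral {a..b} (\<lambda>_. 1)"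
    using etaC_bounds by (intro integral_le etaC_integrable) auto
  then show "H v - H u \<le> v - u" unfolding eq using ab by simp
qed

lemma H_mono: "u \<le> v \<Longrightarrow> H u \<le> H v" using H_increment(1)[of u v] by simp

lemma H_nonneg: "0 \<le> H v" using H_mono[of 0 "max 0 v"] H_max[of v] by simp

lemma H_le_1: "H v \<le> 1"
proof (cases "v \<le> 1")
  case True
  show ?thesis using H_increment(2)[of v 1] H_increment(1)[of v 1] H_increment[of 0 1] True by simp
next
  case False
  have "integral {1..v} etaC = integral {1..v} (\<lambda>_. 0)"
    by (intro integral_cong) (auto simp: etaC_def eta_ends)
  then have "H v = H 1" using H_diff[of 1 v] False by simp
  then show ?thesis using H_increment[of 0 1] by simp
qed

lemma H_le: "0 \<le> v \<Longrightarrow> H v \<le> v" using H_increment(2)[of 0 v] by simp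

lemma H_measurable[measurable]: "H \<in> borel_measurable borel"
  by (intro borel_measurable_mono) (auto simp: mono_def H_mono)

lemma H_lipschitz: "\<bar>H u - H v\<bar> \<le> \<bar>u - v\<bar>"
  using H_increment[of u v] H_increment[of v u] by (cases "u \<le> v") auto

lemma H_cont: "continuous_on A H"
proof -
  have "1-lipschitz_on A H"
    by (rule lipschitz_onI) (simp_all add: dist_real_def H_lipschitz)
  then show ?thesis by (rule lipschitz_on_continuous_on)
qed

lemma H_strict: 
  assumes "0 \<le> u" "u < v" "v \<le> 1"
  shows "H u < H v"
proof -
  define m where "m = (u + v) / 2"
  have m: "u < m" "m < v" using assms by (auto simp: m_def)
  have "0 < etaC m * (m - u)"
    using eta_less[of m 1] m assms by (simp add: etaC_eq eta_ends)
  also have "etaC m * (m - u) = integral {u..m} (\<lambda>_. etaC m)" using m by simp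
  also have "\<dots> \<le> integral {u..m} etaC"
    using m assms eta_le by (intro integral_le etaC_integrable) (auto simp: etaC_eq)
  also have "\<dots> = H m - H u" using H_diff[of u m] m assms by simp
  also have "\<dots> \<le> H v - H u" using H_mono[of m v] m by simp
  finally show ?thesis by simp
qed

end

locale framed = particle +
  assumes frame: "dist_fun_on_frame BL BR \<gamma>"
begin

abbreviation \<mu> :: "real measure" where "\<mu> \<equiv> interval_measure \<gamma>"

abbreviation \<zeta> :: "real \<Rightarrow> real" where "\<zeta> \<equiv> zeta \<eta> J BL \<gamma>"

sublocale \<mu>: real_distribution \<mu> by (rule real_distribution_of_dist_fun[OF \<gamma>_dist])

lemma \<gamma>_measurable[measurable]: "\<gamma> \<in> borel_measurable borel"
  by (rule borel_measurable_dist_fun[OF \<gamma>_dist])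

lemma \<gamma>_mono: "x \<le> y \<Longrightarrow> \<gamma> x \<le> \<gamma> y" by (rule dist_fun_mono[OF \<gamma>_dist])

lemma \<gamma>_bounds: "0 \<le> \<gamma> x" "\<gamma> x \<le> 1" by (rule dist_fun_bounds[OF \<gamma>_dist])+

lemma \<gamma>_right: "BR \<le> x \<Longrightarrow> \<gamma> x = 1"
  using \<gamma>_mono[of BR x] \<gamma>_bounds[of x] frame by (auto simp: dist_fun_on_frame_def)

lemma AE_ge: "AE y in \<mu>. - BL \<le> y" using frame_AE[OF frame] by eventually_elim auto

lemma emeasure_atMost: "emeasure \<mu> {..x} = ennreal (\<gamma> x)" by (rule emeasure_of_dist_fun[OF \<gamma>_dist])

lemma emeasure_Ioc: "x \<le> y \<Longrightarrow> emeasure \<mu> {x<..y} = ennreal (\<gamma> y - \<gamma> x)"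
  using dist_fun_mono[OF \<gamma>_dist] dist_fun_right_cont[OF \<gamma>_dist]
  by (intro emeasure_interval_measure_Ioc) auto

lemma emeasure_bottom: "emeasure \<mu> {- BL} = ennreal (\<gamma> (- BL))"
proof -
  have "emeasure \<mu> {- BL} = emeasure \<mu> {..- BL}"
    using AE_ge by (intro emeasure_eq_AE) (auto elim!: eventually_mono)
  then show ?thesis by (simp add: emeasure_atMost)
qed

lemma flux_zeta:
  assumes "- BL \<le> u"
  shows "flux p J \<mu> u = ennreal (\<zeta> u)"
proof -
  have "flux p J \<mu> u = (\<integral>\<^sup>+y. ennreal (indicator {- BL..u} y *\<^sub>R (p y * (1 - J (u - y)))) \<partial>\<mu>)"
    unfolding flux_def
    using AE_ge by (intro nn_integral_cong_AE, eventually_elim) (auto simp: indicator_def)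
  also have "\<dots> = ennreal (\<integral>y. indicator {- BL..u} y *\<^sub>R (p y * (1 - J (u - y))) \<partial>\<mu>)"
  proof (rule nn_integral_eq_integral)
    show "integrable \<mu> (\<lambda>y. indicator {- BL..u} y *\<^sub>R (p y * (1 - J (u - y))))"
      by (rule \<mu>.integrable_const_bound[where B = 1])
         (auto simp: indicator_def abs_mult intro!: mult_le_one)
  qed (auto simp: indicator_def)
  finally show ?thesis by (simp add: zeta_def set_lebesgue_integral_def)
qed

lemma zeta_nonneg: "0 \<le> \<zeta> u"
  unfolding zeta_def set_lebesgue_integral_def by (intro integral_nonneg_AE) (auto simp: indicator_def)

lemma zeta_below: "u < - BL \<Longrightarrow> \<zeta> u = 0"
  by (simp add: zeta_def set_lebesgue_integral_def)

lemma zeta_le_1: "\<zeta> u \<le> 1"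
  using flux_le_1[OF \<mu>.real_distribution_axioms, of u] flux_zeta[of u] zeta_below[of u] by (cases "- BL \<le> u") auto

lemmas flux_\<mu>_measurable[measurable] = flux_measurable[OF \<mu>.real_distribution_axioms]

lemma zeta_measurable[measurable]: "\<zeta> \<in> borel_measurable borel"
proof -
  have "\<zeta> = (\<lambda>u. if u < - BL then 0 else enn2real (flux p J \<mu> u))"
    using flux_zeta zeta_nonneg zeta_below by (auto simp: fun_eq_iff)
  moreover have "(\<lambda>u. if u < - BL then 0 else enn2real (flux p J \<mu> u)) \<in> borel_measurable borel"
    by measurable
  ultimately show ?thesis by simp
qed

lemma zeta_integrable: "\<zeta> integrable_on {a..b}"
  using zeta_nonneg zeta_le_1 by (intro bounded_borel_integrable(1)[where C = 1]) auto

lemma balanced_iff_integral: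
  "flux_balanced w BL BR p J \<mu> \<longleftrightarrow>
    (\<forall>x\<in>{- BL..BR}. w * \<gamma> x = w * \<gamma> (- BL) + integral {- BL..x} \<zeta>)"
proof -
  have "(ennreal w * emeasure \<mu> {..x} =
        ennreal w * emeasure \<mu> {..- BL} + (\<integral>\<^sup>+u. flux p J \<mu> u * indicator {- BL..x} u \<partial>lborel)) \<longleftrightarrow>
      w * \<gamma> x = w * \<gamma> (- BL) + integral {- BL..x} \<zeta>" for x
  proof -
    have "(\<integral>\<^sup>+u. flux p J \<mu> u * indicator {- BL..x} u \<partial>lborel) =
        (\<integral>\<^sup>+u. ennreal (\<zeta> u) * indicator {- BL..x} u \<partial>lborel)"
      by (intro nn_integral_cong) (auto simp: indicator_def flux_zeta)
    also have "\<dots> = ennreal (integral {- BL..x} \<zeta>)"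
      using zeta_nonneg zeta_le_1 by (intro bounded_borel_integrable(2)[where C = 1]) auto
    finally have i: "(\<integral>\<^sup>+u. flux p J \<mu> u * indicator {- BL..x} u \<partial>lborel) = ennreal (integral {- BL..x} \<zeta>)" .
    have "0 \<le> integral {- BL..x} \<zeta>" by (intro integral_nonneg zeta_integrable) (simp add: zeta_nonneg)
    then show ?thesis
      unfolding emeasure_atMost i using pos \<gamma>_bounds
      by (simp add: ennreal_mult[symmetric] ennreal_plus[symmetric] del: ennreal_plus)
  qed
  then show ?thesis unfolding flux_balanced_def by blast
qed

text \<open>By flux balance \<open>\<gamma>\<close> has increments \<open>\<integral> \<zeta> / w\<close>, and \<open>\<zeta> \<le> 1\<close>.\<close>

lemma lipschitz_of_balanced:
  assumes "flux_balanced w BL BR p J \<mu>"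
  shows "(1 / w)-lipschitz_on {- BL..BR} \<gamma>"
proof -
  have *: "\<gamma> y - \<gamma> x \<le> (y - x) / w" if "x \<le> y" "x \<in> {- BL..BR}" "y \<in> {- BL..BR}" for x y
  proof -
    have "w * \<gamma> y - w * \<gamma> x = integral {- BL..y} \<zeta> - integral {- BL..x} \<zeta>"
      using bspec[OF assms[unfolded balanced_iff_integral] that(2)]
        bspec[OF assms[unfolded balanced_iff_integral] that(3)] by linarith
    also have "\<dots> = integral {x..y} \<zeta>"
      using Henstock_Kurzweil_Integration.integral_combine[of "- BL" x y \<zeta>] zeta_integrable that by simp
    also have "\<dots> \<le> integral {x..y} (\<lambda>_. 1)"
      by (intro integral_le zeta_integrable) (auto simp: zeta_le_1)
    also have "\<dots> = y - x" using that by simp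
    finally show ?thesis using pos by (simp add: field_simps)
  qed
  show ?thesis
  proof (rule lipschitz_onI)
    fix x y assume "x \<in> {- BL..BR}" "y \<in> {- BL..BR}"
    then show "dist (\<gamma> x) (\<gamma> y) \<le> 1 / w * dist x y"
      using *[of x y] *[of y x] \<gamma>_mono[of x y] \<gamma>_mono[of y x]
      by (cases "x \<le> y") (auto simp: dist_real_def)
  qed (use pos in auto)
qed

end

locale continuous_framed = framed +
  assumes \<gamma>_cont: "continuous_on {- BL..BR} \<gamma>"
begin

lemma \<gamma>_cont': "continuous_on {- BL..} \<gamma>"
proof -
  have "continuous_on ({- BL..BR} \<union> {BR..}) \<gamma>"
  proof (rule continuous_on_closed_Un)
    have "continuous_on {BR..} (\<lambda>_. 1::real)" by simp
    then show "continuous_on {BR..} \<gamma>"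
      by (rule continuous_on_eq) (simp add: \<gamma>_right)
  qed (auto simp: \<gamma>_cont)
  moreover have "{- BL..BR} \<union> {BR..} = {- BL..}" using pos by auto
  ultimately show ?thesis by simp
qed

lemma \<gamma>_isCont: "- BL < y \<Longrightarrow> isCont \<gamma> y"
  using continuous_on_interior[OF \<gamma>_cont', of y] by simp

lemma p_eq: "- BL < y \<Longrightarrow> p y = \<eta> (\<gamma> y)"
  using \<gamma>_isCont by (simp add: etabar_def)

text \<open>If there is an atom in \<open>- BL\<close>, the left limit \<open>0\<close> makes \<open>etabar\<close> the mean of \<open>\<eta>\<close> over \<open>[0, \<gamma> (- BL)]\<close>, so the mean times
  the mass is the primitive.\<close>

lemma p_bottom: "p (- BL) * \<gamma> (- BL) = H (\<gamma> (- BL))"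
proof -
  have l: "left_lim \<gamma> (- BL) = 0" using frame by (simp add: dist_fun_on_frame_def)
  show ?thesis
  proof (cases "\<gamma> (- BL) = 0")
    case False
    have "\<not> isCont \<gamma> (- BL)"
    proof
      assume "isCont \<gamma> (- BL)"
      then have "(\<gamma> \<longlongrightarrow> \<gamma> (- BL)) (at_left (- BL))"
        by (auto simp: isCont_def intro: filterlim_at_split[THEN iffD1, THEN conjunct1])
      then show False using left_lim_eqI l False by simp
    qed
    moreover have "integral {0..\<gamma> (- BL)} etaC = integral {0..\<gamma> (- BL)} \<eta>"
      using \<gamma>_bounds[of "- BL"] by (intro integral_cong) (auto simp: etaC_eq)
    ultimately show ?thesis using False l by (simp add: etabar_def H_def)
  qed simp
qed

text \<open>A continuous distribution function pushes its own law forward to Lebesgue measure, so that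
  \<open>\<eta> (\<gamma> y) d\<gamma>(y)\<close> integrates to the primitive of \<open>\<eta>\<close> at \<open>\<gamma>\<close>.\<close>

lemma distr_cdf_lborel:
  assumes c: "- BL \<le> c"
  shows "distr (density \<mu> (indicator {- BL<..c})) borel \<gamma> = density lborel (indicator {\<gamma> (- BL)<..\<gamma> c})"
proof (rule measure_eqI_lessThan)
  fix \<nu> :: real
  have 1: "emeasure (distr (density \<mu> (indicator {- BL<..c})) borel \<gamma>) {\<nu><..} = emeasure \<mu> {y \<in> {- BL<..c}. \<nu> < \<gamma> y}"
  proof -
    have "emeasure (distr (density \<mu> (indicator {- BL<..c})) borel \<gamma>) {\<nu><..} =
        emeasure (density \<mu> (indicator {- BL<..c})) (\<gamma> -` {\<nu><..} \<inter> space \<mu>)"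
      by (subst emeasure_distr) auto
    also have "\<dots> = emeasure \<mu> ({- BL<..c} \<inter> (\<gamma> -` {\<nu><..} \<inter> space \<mu>))"
      using measurable_sets[OF \<gamma>_measurable, of "{\<nu><..}"]
      by (subst emeasure_restricted) auto
    also have "{- BL<..c} \<inter> (\<gamma> -` {\<nu><..} \<inter> space \<mu>) = {y \<in> {- BL<..c}. \<nu> < \<gamma> y}" by auto
    finally show ?thesis .
  qed
  then show "emeasure (distr (density \<mu> (indicator {- BL<..c})) borel \<gamma>) {\<nu><..} < \<infinity>"
    by (simp add: \<mu>.emeasure_eq_measure)
  have 2: "emeasure (density lborel (indicator {\<gamma> (- BL)<..\<gamma> c})) {\<nu><..} = emeasure lborel {max \<nu> (\<gamma> (- BL))<..\<gamma> c}"
  proof -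
    have "{\<gamma> (- BL)<..\<gamma> c} \<inter> {\<nu><..} = {max \<nu> (\<gamma> (- BL))<..\<gamma> c}" by auto
    then show ?thesis by (subst emeasure_restricted) auto
  qed
  have ac: "\<gamma> (- BL) \<le> \<gamma> c" by (rule \<gamma>_mono[OF c])
  have "emeasure \<mu> {y \<in> {- BL<..c}. \<nu> < \<gamma> y} = emeasure lborel {max \<nu> (\<gamma> (- BL))<..\<gamma> c}"
  proof -
    consider "\<nu> < \<gamma> (- BL)" | "\<gamma> c \<le> \<nu>" | "\<gamma> (- BL) \<le> \<nu>" "\<nu> < \<gamma> c" by linarith
    then show ?thesis
    proof cases
      case 1
      then have "{y \<in> {- BL<..c}. \<nu> < \<gamma> y} = {- BL<..c}" by (auto intro: less_le_trans[OF _ \<gamma>_mono])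
      then show ?thesis using 1 c ac by (simp add: emeasure_Ioc max_def)
    next
      case 2
      then have e: "{y \<in> {- BL<..c}. \<nu> < \<gamma> y} = {}" using \<gamma>_mono[of _ c] by force
      have e': "{max \<nu> (\<gamma> (- BL))<..\<gamma> c} = {}" using 2 by auto
      show ?thesis unfolding e e' by simp
    next
      case 3
      have cont: "continuous_on {- BL..c} \<gamma>" by (rule continuous_on_subset[OF \<gamma>_cont']) auto
      \<comment> \<open>The last point in which \<open>\<gamma>\<close> takes the value \<open>\<nu>\<close>; \<open>\<gamma>\<close> may be constant to the left of it.\<close>
      obtain z where z: "z \<in> {- BL..c}" "\<gamma> z = \<nu>" "\<And>y. y \<in> {- BL..c} \<Longrightarrow> \<gamma> y \<le> \<nu> \<Longrightarrow> y \<le> z"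
      proof -
        define S where "S = {y \<in> {- BL..c}. \<gamma> y \<le> \<nu>}"
        have "closed S" unfolding S_def
          using continuous_on_closed_Collect_le[OF cont continuous_on_const] by simp
        then have "compact S" by (auto simp: compact_eq_bounded_closed S_def intro: bounded_subset[of "{- BL..c}"])
        moreover have "S \<noteq> {}" using 3 c by (auto simp: S_def)
        ultimately obtain z where z: "z \<in> S" "\<forall>y\<in>S. y \<le> z" using compact_attains_sup by blast
        obtain y where y: "z \<le> y" "y \<le> c" "\<gamma> y = \<nu>"
          using IVT'[of \<gamma> z \<nu> c] z(1) 3 continuous_on_subset[OF cont, of "{z..c}"] by (auto simp: S_def)
        then have "y \<in> S" using z by (auto simp: S_def)
        then have "y = z" using z y by auto
        then show ?thesis using that[of z] z y by (auto simp: S_def)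
      qed
      have "{y \<in> {- BL<..c}. \<nu> < \<gamma> y} = {z<..c}"
      proof (intro set_eqI iffI)
        fix y assume "y \<in> {y \<in> {- BL<..c}. \<nu> < \<gamma> y}"
        then show "y \<in> {z<..c}" using z(2) \<gamma>_mono[of y z] by (cases "y \<le> z") auto
      next
        fix y assume "y \<in> {z<..c}"
        then show "y \<in> {y \<in> {- BL<..c}. \<nu> < \<gamma> y}" using z(1) z(3)[of y] by (cases "\<gamma> y \<le> \<nu>") auto
      qed
      then show ?thesis using z 3 by (simp add: emeasure_Ioc max_def)
    qed
  qed
  then show "emeasure (distr (density \<mu> (indicator {- BL<..c})) borel \<gamma>) {\<nu><..} =
      emeasure (density lborel (indicator {\<gamma> (- BL)<..\<gamma> c})) {\<nu><..}"
    unfolding 1 2 .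
qed auto

text \<open>The atom contributes \<open>H (\<gamma> (- BL))\<close> and the continuous part the remaining increment of \<open>H\<close>.\<close>

lemma cumulative_jump_rate:
  assumes c: "- BL \<le> c"
  shows "(\<integral>\<^sup>+y. ennreal (p y) * indicator {..c} y \<partial>\<mu>) = ennreal (H (\<gamma> c))"
proof -
  have ac: "\<gamma> (- BL) \<le> \<gamma> c" by (rule \<gamma>_mono[OF c])
  have "(\<integral>\<^sup>+y. ennreal (p y) * indicator {..c} y \<partial>\<mu>) =
      (\<integral>\<^sup>+y. ennreal (p (- BL)) * indicator {- BL} y + indicator {- BL<..c} y * ennreal (etaC (\<gamma> y)) \<partial>\<mu>)"
    using AE_ge
  proof (intro nn_integral_cong_AE, eventually_elim)
    fix y assume "- BL \<le> y"
    then show "ennreal (p y) * indicator {..c} y =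
        ennreal (p (- BL)) * indicator {- BL} y + indicator {- BL<..c} y * ennreal (etaC (\<gamma> y))"
      using c p_eq[of y] \<gamma>_bounds[of y] by (cases "y = - BL") (auto simp: indicator_def etaC_eq)
  qed
  also have "\<dots> = (\<integral>\<^sup>+y. ennreal (p (- BL)) * indicator {- BL} y \<partial>\<mu>) + (\<integral>\<^sup>+y. indicator {- BL<..c} y * ennreal (etaC (\<gamma> y)) \<partial>\<mu>)"
    by (rule nn_integral_add) measurable
  also have "(\<integral>\<^sup>+y. ennreal (p (- BL)) * indicator {- BL} y \<partial>\<mu>) = ennreal (H (\<gamma> (- BL)))"
    by (subst nn_integral_cmult_indicator) (auto simp: emeasure_bottom ennreal_mult[symmetric] \<gamma>_bounds p_bottom)
  also have "(\<integral>\<^sup>+y. indicator {- BL<..c} y * ennreal (etaC (\<gamma> y)) \<partial>\<mu>) =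
      (\<integral>\<^sup>+y. ennreal (etaC (\<gamma> y)) \<partial>density \<mu> (indicator {- BL<..c}))"
    by (rule nn_integral_density[symmetric]) measurable
  also have "\<dots> = (\<integral>\<^sup>+\<nu>. ennreal (etaC \<nu>) \<partial>distr (density \<mu> (indicator {- BL<..c})) borel \<gamma>)"
    by (rule nn_integral_distr[symmetric]) measurable
  also have "\<dots> = (\<integral>\<^sup>+\<nu>. indicator {\<gamma> (- BL)<..\<gamma> c} \<nu> * ennreal (etaC \<nu>) \<partial>lborel)"
    unfolding distr_cdf_lborel[OF c] by (rule nn_integral_density) measurable
  also have "\<dots> = (\<integral>\<^sup>+\<nu>. ennreal (etaC \<nu>) * indicator {\<gamma> (- BL)..\<gamma> c} \<nu> \<partial>lborel)"
    using AE_lborel_singleton[of "\<gamma> (- BL)"]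
    by (intro nn_integral_cong_AE, eventually_elim) (auto simp: indicator_def)
  also have "\<dots> = ennreal (integral {\<gamma> (- BL)..\<gamma> c} etaC)"
    using etaC_bounds by (intro bounded_borel_integrable(2)[where C = 1]) auto
  also have "integral {\<gamma> (- BL)..\<gamma> c} etaC = H (\<gamma> c) - H (\<gamma> (- BL))"
    using H_diff[OF \<gamma>_bounds(1) ac] by simp
  also have "ennreal (H (\<gamma> (- BL))) + ennreal (H (\<gamma> c) - H (\<gamma> (- BL))) = ennreal (H (\<gamma> c))"
    using H_nonneg H_mono[OF ac] by (simp add: ennreal_plus[symmetric] del: ennreal_plus)
  finally show ?thesis .
qed

text \<open>Both sides integrate \<open>p y * (1 - J (u - y))\<close> over \<open>- BL \<le> y \<le> u \<le> x\<close>; reflecting \<open>u\<close> in the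
  interval \<open>[y, x]\<close> moves the jump kernel to the other factor of the convolution.\<close>

lemma integral_flux:
  "(\<integral>\<^sup>+u. flux p J \<mu> u * indicator {- BL..x} u \<partial>lborel) =
   (\<integral>\<^sup>+u. ennreal ((1 - J (x - u)) * H (\<gamma> u)) * indicator {- BL..x} u \<partial>lborel)"
proof -
  interpret pair_sigma_finite \<mu> lborel ..
  have "(\<integral>\<^sup>+u. flux p J \<mu> u * indicator {- BL..x} u \<partial>lborel) =
      (\<integral>\<^sup>+u. (\<integral>\<^sup>+y. (if y \<le> u \<and> - BL \<le> u \<and> u \<le> x then ennreal (p y * (1 - J (u - y))) else 0) \<partial>\<mu>) \<partial>lborel)"
  proof (rule nn_integral_cong)
    fix u
    show "flux p J \<mu> u * indicator {- BL..x} u =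
        (\<integral>\<^sup>+y. (if y \<le> u \<and> - BL \<le> u \<and> u \<le> x then ennreal (p y * (1 - J (u - y))) else 0) \<partial>\<mu>)"
      unfolding flux_def by (subst nn_integral_multc[symmetric]) (auto simp: indicator_def intro!: nn_integral_cong)
  qed
  also have "\<dots> = (\<integral>\<^sup>+y. (\<integral>\<^sup>+u. (if y \<le> u \<and> - BL \<le> u \<and> u \<le> x then ennreal (p y * (1 - J (u - y))) else 0) \<partial>lborel) \<partial>\<mu>)"
    by (rule Fubini') measurable
  also have "\<dots> = (\<integral>\<^sup>+y. (\<integral>\<^sup>+u. (if y \<le> u \<and> - BL \<le> u \<and> u \<le> x then ennreal (p y * (1 - J (x - u))) else 0) \<partial>lborel) \<partial>\<mu>)"
    using AE_ge
  proof (intro nn_integral_cong_AE, eventually_elim)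
    fix y assume y: "- BL \<le> y"
    define F where "F u = (if y \<le> u \<and> - BL \<le> u \<and> u \<le> x then ennreal (p y * (1 - J (u - y))) else 0)" for u
    have [measurable]: "F \<in> borel_measurable borel" unfolding F_def[abs_def] by measurable
    have "(\<integral>\<^sup>+u. F u \<partial>lborel) = (\<integral>\<^sup>+u. F (x + y + (-1) * u) \<partial>lborel)"
      using nn_integral_real_affine[of F "-1" "x + y"] by simp
    also have "\<dots> = (\<integral>\<^sup>+u. (if y \<le> u \<and> - BL \<le> u \<and> u \<le> x then ennreal (p y * (1 - J (x - u))) else 0) \<partial>lborel)"
      using y by (intro nn_integral_cong) (auto simp: F_def)
    finally show "(\<integral>\<^sup>+u. (if y \<le> u \<and> - BL \<le> u \<and> u \<le> x then ennreal (p y * (1 - J (u - y))) else 0) \<partial>lborel) =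
        (\<integral>\<^sup>+u. (if y \<le> u \<and> - BL \<le> u \<and> u \<le> x then ennreal (p y * (1 - J (x - u))) else 0) \<partial>lborel)"
      by (simp only: F_def)
  qed
  also have "\<dots> = (\<integral>\<^sup>+u. (\<integral>\<^sup>+y. (if y \<le> u \<and> - BL \<le> u \<and> u \<le> x then ennreal (p y * (1 - J (x - u))) else 0) \<partial>\<mu>) \<partial>lborel)"
    by (rule Fubini'[symmetric]) measurable
  also have "\<dots> = (\<integral>\<^sup>+u. ennreal ((1 - J (x - u)) * H (\<gamma> u)) * indicator {- BL..x} u \<partial>lborel)"
  proof (rule nn_integral_cong)
    fix u
    show "(\<integral>\<^sup>+y. (if y \<le> u \<and> - BL \<le> u \<and> u \<le> x then ennreal (p y * (1 - J (x - u))) else 0) \<partial>\<mu>) =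
        ennreal ((1 - J (x - u)) * H (\<gamma> u)) * indicator {- BL..x} u"
    proof (cases "- BL \<le> u \<and> u \<le> x")
      case True
      have "(\<integral>\<^sup>+y. (if y \<le> u \<and> - BL \<le> u \<and> u \<le> x then ennreal (p y * (1 - J (x - u))) else 0) \<partial>\<mu>) =
          (\<integral>\<^sup>+y. ennreal (1 - J (x - u)) * (ennreal (p y) * indicator {..u} y) \<partial>\<mu>)"
        using True by (intro nn_integral_cong) (auto simp: indicator_def ennreal_mult mult.commute)
      also have "\<dots> = ennreal (1 - J (x - u)) * ennreal (H (\<gamma> u))"
        using True by (subst nn_integral_cmult) (auto simp: cumulative_jump_rate)
      finally show ?thesis using True by (simp add: ennreal_mult H_nonneg)
    next
      case False
      then have "(\<integral>\<^sup>+y. (if y \<le> u \<and> - BL \<le> u \<and> u \<le> x then ennreal (p y * (1 - J (x - u))) else 0) \<partial>\<mu>) = (\<integral>\<^sup>+y. 0 \<partial>\<mu>)"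
        by (intro nn_integral_cong) auto
      with False show ?thesis by simp
    qed
  qed
  finally show ?thesis .
qed

lemma integral_zeta:
  assumes "- BL \<le> x"
  shows "integral {- BL..x} \<zeta> = integral {- BL..x} (\<lambda>u. (1 - J (x - u)) * H (\<gamma> u))"
proof -
  have b: "0 \<le> (1 - J (x - u)) * H (\<gamma> u)" "(1 - J (x - u)) * H (\<gamma> u) \<le> 1" for u
    using H_nonneg H_le_1 by (auto intro!: mult_le_one)
  have "ennreal (integral {- BL..x} \<zeta>) = (\<integral>\<^sup>+u. ennreal (\<zeta> u) * indicator {- BL..x} u \<partial>lborel)"
    using zeta_nonneg zeta_le_1 by (intro bounded_borel_integrable(2)[where C = 1, symmetric]) auto
  also have "\<dots> = (\<integral>\<^sup>+u. flux p J \<mu> u * indicator {- BL..x} u \<partial>lborel)"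
    by (intro nn_integral_cong) (auto simp: indicator_def flux_zeta)
  also have "\<dots> = ennreal (integral {- BL..x} (\<lambda>u. (1 - J (x - u)) * H (\<gamma> u)))"
    unfolding integral_flux using b by (intro bounded_borel_integrable(2)[where C = 1]) auto
  finally show ?thesis
    using b zeta_nonneg
    by (simp add: integral_nonneg zeta_integrable bounded_borel_integrable(1)[where C = 1])
qed

lemma balanced_iff_volterra:
  "flux_balanced w BL BR p J \<mu> \<longleftrightarrow>
    (\<forall>x\<in>{- BL..BR}. w * \<gamma> x = w * \<gamma> (- BL) + integral {- BL..x} (\<lambda>u. (1 - J (x - u)) * H (\<gamma> u)))"
  unfolding balanced_iff_integral by (auto simp: integral_zeta)

end

section \<open>The Volterra equation of the wave shape\<close>

lemma integral_exp_growth: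
  assumes "0 < k" "b \<le> x"
  shows "((\<lambda>u. c * exp (k * (u - b))) has_integral c * (exp (k * (x - b)) - 1) / k) {b..(x::real)}"
proof -
  have "((\<lambda>u. c * exp (k * (u - b))) has_integral c * exp (k * (x - b)) / k - c * exp (k * (b - b)) / k) {b..x}"
    using assms
    by (intro fundamental_theorem_of_calculus)
       (auto intro!: derivative_eq_intros simp: has_real_derivative_iff_has_vector_derivative[symmetric])
  then show ?thesis using assms by (simp add: field_simps)
qed

text \<open>The weight \<open>exp (2 / w * (x - b))\<close> has an integral that is at most \<open>w / 2\<close> times the weight itself, so each use of
  the hypothesis halves the constant in front of it.\<close>

lemma gronwall_zero:
  fixes e :: "real \<Rightarrow> real"
  assumes w: "0 < w" and [measurable]: "e \<in> borel_measurable borel"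
    and e: "\<And>x. x \<in> {b..c} \<Longrightarrow> 0 \<le> e x \<and> e x \<le> C"
    and le: "\<And>x. x \<in> {b..c} \<Longrightarrow> w * e x \<le> integral {b..x} e"
    and x: "x \<in> {b..c}"
  shows "e x = 0"
proof -
  have int: "e integrable_on {b..y}" if "y \<in> {b..c}" for y
    by (rule bounded_borel_integrable(1)[where C = C]) (use e that in auto)
  have C: "0 \<le> C" using e[OF x] by simp
  have *: "e y \<le> C / 2 ^ n * exp (2 / w * (y - b))" if "y \<in> {b..c}" for n y
    using that
  proof (induction n arbitrary: y)
    case 0
    have "C * 1 \<le> C * exp (2 / w * (y - b))"
      using 0 w C by (intro mult_left_mono) auto
    then show ?case using e[OF 0] by simp
  next
    case (Suc n)
    have y: "b \<le> y" using Suc.prems by simp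
    note h = integral_exp_growth[of "2 / w" b y "C / 2 ^ n"]
    have "w * e y \<le> integral {b..y} e" by (rule le[OF Suc.prems])
    also have "\<dots> \<le> integral {b..y} (\<lambda>u. C / 2 ^ n * exp (2 / w * (u - b)))"
      using h w y Suc by (intro integral_le int has_integral_integrable[OF h]) auto
    also have "\<dots> = C / 2 ^ n * (exp (2 / w * (y - b)) - 1) / (2 / w)"
      using h w y by (intro integral_unique) auto
    also have "\<dots> \<le> w * (C / 2 ^ Suc n * exp (2 / w * (y - b)))"
      using w C by (simp add: field_simps)
    finally show ?case by (simp only: mult_le_cancel_left_pos[OF w])
  qed
  have "(\<lambda>n. C * exp (2 / w * (x - b)) * (1 / 2) ^ n) \<longlonglongrightarrow> C * exp (2 / w * (x - b)) * 0"
    by (intro tendsto_intros) auto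
  moreover have "e x \<le> C * exp (2 / w * (x - b)) * (1 / 2) ^ n" for n
    using *[OF x, of n] by (simp add: power_one_over divide_simps mult_ac)
  ultimately have "e x \<le> C * exp (2 / w * (x - b)) * 0"
    by (intro LIMSEQ_le_const) auto
  then show ?thesis using e[OF x] by simp
qed

context jump_frame
begin

definition conv :: "(real \<Rightarrow> real) \<Rightarrow> real \<Rightarrow> real" where
  "conv f x = integral {- BL..x} (\<lambda>u. (1 - J (x - u)) * H (f u))"

lemma integrand_bounds: "0 \<le> (1 - J x) * H y" "(1 - J x) * H y \<le> 1"
  using H_nonneg H_le_1 by (auto intro!: mult_le_one)

lemma conv_integrable:
  assumes [measurable]: "f \<in> borel_measurable borel"
  shows "(\<lambda>u. (1 - J (x - u)) * H (f u)) integrable_on {a..b}"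
  using integrand_bounds by (intro bounded_borel_integrable(1)[where C = 1]) auto

lemma conv_nonneg: "f \<in> borel_measurable borel \<Longrightarrow> 0 \<le> conv f x"
  unfolding conv_def by (intro integral_nonneg conv_integrable) (auto simp: integrand_bounds)

lemma conv_mono:
  assumes "f \<in> borel_measurable borel" "g \<in> borel_measurable borel" "\<And>x. f x \<le> g x"
  shows "conv f x \<le> conv g x"
  unfolding conv_def using assms
  by (intro integral_le conv_integrable mult_left_mono H_mono) auto

text \<open>After the substitution \<open>v = x - u\<close> both the integrand and the range of integration grow with \<open>x\<close>. It provides
  monotonicity, and with it measurability, of the iterates.\<close>

lemma conv_incr_ge:
  assumes f: "mono f" and xy: "x \<le> y"
  shows "conv f x \<le> conv f y"
proof -
  have [measurable]: "f \<in> borel_measurable borel" using f by (rule borel_measurable_mono)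
  have c: "ennreal (conv f z) = (\<integral>\<^sup>+v. ennreal ((1 - J v) * H (f (z - v))) * indicator {0..z + BL} v \<partial>lborel)" for z
  proof -
    have "ennreal (conv f z) = (\<integral>\<^sup>+u. ennreal ((1 - J (z - u)) * H (f u)) * indicator {- BL..z} u \<partial>lborel)"
      unfolding conv_def using integrand_bounds
      by (intro bounded_borel_integrable(2)[where C = 1, symmetric]) auto
    also have "\<dots> = (\<integral>\<^sup>+u. ennreal ((1 - J (z - (z + - 1 * u))) * H (f (z + - 1 * u))) * indicator {- BL..z} (z + - 1 * u) \<partial>lborel)"
      by (subst nn_integral_real_affine[where c = "-1" and t = z]) auto
    also have "\<dots> = (\<integral>\<^sup>+v. ennreal ((1 - J v) * H (f (z - v))) * indicator {0..z + BL} v \<partial>lborel)"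
      by (intro nn_integral_cong) (auto simp: indicator_def)
    finally show ?thesis .
  qed
  have "ennreal (conv f x) \<le> ennreal (conv f y)"
    unfolding c using xy
    by (intro nn_integral_mono mult_mono ennreal_leI mult_left_mono H_mono monoD[OF f])
       (auto simp: indicator_def)
  then show ?thesis using conv_nonneg[of f] by (simp add: ennreal_le_iff)
qed

text \<open>The kernel \<open>1 - J (x - u)\<close> decreases in \<open>x\<close>, so only the new range \<open>[x, y]\<close> contributes to an increase.\<close>

lemma conv_incr_le:
  assumes [measurable]: "f \<in> borel_measurable borel" and xy: "- BL \<le> x" "x \<le> y"
  shows "conv f y \<le> conv f x + (y - x)"
proof -
  have "conv f y = integral {- BL..x} (\<lambda>u. (1 - J (y - u)) * H (f u)) + integral {x..y} (\<lambda>u. (1 - J (y - u)) * H (f u))"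
    unfolding conv_def using xy
    by (intro Henstock_Kurzweil_Integration.integral_combine[symmetric] conv_integrable) auto
  also have "integral {- BL..x} (\<lambda>u. (1 - J (y - u)) * H (f u)) \<le> conv f x"
    unfolding conv_def using xy dist_fun_mono[OF J_dist] H_nonneg
    by (intro integral_le conv_integrable mult_right_mono) auto
  also have "integral {x..y} (\<lambda>u. (1 - J (y - u)) * H (f u)) \<le> integral {x..y} (\<lambda>_. 1)"
    by (intro integral_le conv_integrable) (auto simp: integrand_bounds)
  also have "\<dots> = y - x" using xy by simp
  finally show ?thesis by simp
qed

lemma conv_below: "x < - BL \<Longrightarrow> conv f x = 0"
  by (simp add: conv_def)

lemma conv_le: 
  assumes "f \<in> borel_measurable borel"
  shows "conv f x \<le> max 0 (x + BL)"
proof (cases "- BL \<le> x")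
  case True
  have "conv f (- BL) = 0" by (simp add: conv_def)
  then show ?thesis using conv_incr_le[OF assms _ True] by simp
qed (simp add: conv_below)

primrec iter :: "real \<Rightarrow> nat \<Rightarrow> real \<Rightarrow> real" where
  "iter a 0 = (\<lambda>x. 0)"
| "iter a (Suc n) = (\<lambda>x. a + conv (iter a n) x / w)"

lemma iter_mono_x: "mono (iter a n)"
proof (induction n)
  case (Suc n)
  then show ?case using pos conv_incr_ge[OF Suc] by (auto simp: mono_def divide_right_mono)
qed (simp add: mono_def)

lemma iter_measurable[measurable]: "iter a n \<in> borel_measurable borel"
  by (rule borel_measurable_mono[OF iter_mono_x])

lemma iter_mono_n:
  assumes "0 \<le> a"
  shows "iter a n x \<le> iter a (Suc n) x"
proof (induction n arbitrary: x)
  case 0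
  show ?case using assms pos conv_nonneg[of "\<lambda>_. 0"] by simp
next
  case (Suc n)
  have "conv (iter a n) x \<le> conv (iter a (Suc n)) x"
    by (intro conv_mono iter_measurable Suc)
  then show ?case using pos by (simp add: divide_right_mono)
qed

lemma iter_le: 
  assumes "0 \<le> a"
  shows "iter a n x \<le> a + max 0 (x + BL) / w"
proof (cases n)
  case 0
  show ?thesis using 0 assms pos by simp
next
  case (Suc m)
  show ?thesis using Suc conv_le[of "iter a m" x] pos by (simp add: divide_right_mono)
qed

definition sol :: "real \<Rightarrow> real \<Rightarrow> real" where "sol a x = lim (\<lambda>n. iter a n x)"

lemma iter_LIMSEQ:
  assumes "0 \<le> a"
  shows "(\<lambda>n. iter a n x) \<longlonglongrightarrow> sol a x"
proof -
  have "incseq (\<lambda>n. iter a n x)" by (intro incseq_SucI iter_mono_n assms)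
  then obtain L where "(\<lambda>n. iter a n x) \<longlonglongrightarrow> L"
    by (rule incseq_convergent[where B = "a + max 0 (x + BL) / w"]) (auto intro: iter_le[OF assms])
  then show ?thesis unfolding sol_def by (simp add: limI)
qed

lemma sol_mono: "0 \<le> a \<Longrightarrow> mono (sol a)"
  by (intro monoI LIMSEQ_le[OF iter_LIMSEQ iter_LIMSEQ]) (auto intro: monoD[OF iter_mono_x])

lemma sol_measurable: "0 \<le> a \<Longrightarrow> sol a \<in> borel_measurable borel"
  by (rule borel_measurable_mono[OF sol_mono])

lemma sol_eq:
  assumes a: "0 \<le> a"
  shows "sol a x = a + conv (sol a) x / w"
proof -
  have "(\<lambda>n. conv (iter a n) x) \<longlonglongrightarrow> conv (sol a) x"
    unfolding conv_def
  proof (rule dominated_convergence(2)[where h = "\<lambda>_. 1"])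
    show "(\<lambda>u. (1 - J (x - u)) * H (iter a k u)) integrable_on {- BL..x}" for k
      by (intro conv_integrable iter_measurable)
    show "norm ((1 - J (x - u)) * H (iter a k u)) \<le> 1" for k u
      using integrand_bounds[of "x - u" "iter a k u"] by simp
    show "(\<lambda>k. (1 - J (x - u)) * H (iter a k u)) \<longlonglongrightarrow> (1 - J (x - u)) * H (sol a u)" for u
      by (intro tendsto_mult tendsto_const continuous_on_tendsto_compose[OF H_cont[of UNIV] iter_LIMSEQ[OF a]]) auto
  qed auto
  then have "(\<lambda>n. iter a (Suc n) x) \<longlonglongrightarrow> a + conv (sol a) x / w"
    using pos by (auto intro!: tendsto_intros)
  moreover have "(\<lambda>n. iter a (Suc n) x) \<longlonglongrightarrow> sol a x"
    using iter_LIMSEQ[OF a] by (rule LIMSEQ_Suc)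
  ultimately show ?thesis using LIMSEQ_unique by blast
qed

text \<open>The bound reproduces itself under the iteration, since \<open>exp ((x + BL) / w)\<close> solves the Volterra equation with
  kernel \<open>1\<close>, \<open>H\<close> replaced by the identity and atom \<open>1\<close>. It makes the solution continuous in \<open>a\<close>.\<close>

lemma iter_diff:
  assumes "- BL \<le> x"
  shows "\<bar>iter a n x - iter b n x\<bar> \<le> \<bar>a - b\<bar> * exp (1 / w * (x - (- BL)))"
  using assms
proof (induction n arbitrary: x)
  case (Suc n)
  note h = integral_exp_growth[of "1 / w" "- BL" x "\<bar>a - b\<bar>"]
  have D: "conv (iter a n) x - conv (iter b n) x =
      integral {- BL..x} (\<lambda>u. (1 - J (x - u)) * H (iter a n u) - (1 - J (x - u)) * H (iter b n u))"
    unfolding conv_def by (intro integral_diff[symmetric] conv_integrable) measurable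
  have N: "norm (conv (iter a n) x - conv (iter b n) x) \<le> integral {- BL..x} (\<lambda>u. \<bar>a - b\<bar> * exp (1 / w * (u - (- BL))))"
    unfolding D
  proof (rule integral_norm_bound_integral)
    show "(\<lambda>u. (1 - J (x - u)) * H (iter a n u) - (1 - J (x - u)) * H (iter b n u)) integrable_on {- BL..x}"
      by (intro integrable_diff conv_integrable) measurable
    show "(\<lambda>u. \<bar>a - b\<bar> * exp (1 / w * (u - (- BL)))) integrable_on {- BL..x}"
      using h pos Suc.prems by (intro has_integral_integrable) auto
    fix u assume u: "u \<in> {- BL..x}"
    have "norm ((1 - J (x - u)) * H (iter a n u) - (1 - J (x - u)) * H (iter b n u)) =
        (1 - J (x - u)) * \<bar>H (iter a n u) - H (iter b n u)\<bar>"
      by (simp add: abs_mult right_diff_distrib[symmetric])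
    also have "\<dots> \<le> 1 * \<bar>iter a n u - iter b n u\<bar>"
      by (intro mult_mono H_lipschitz) auto
    also have "\<dots> \<le> \<bar>a - b\<bar> * exp (1 / w * (u - (- BL)))" using Suc.IH[of u] u by simp
    finally show "norm ((1 - J (x - u)) * H (iter a n u) - (1 - J (x - u)) * H (iter b n u))
        \<le> \<bar>a - b\<bar> * exp (1 / w * (u - (- BL)))" .
  qed
  have "\<bar>conv (iter a n) x - conv (iter b n) x\<bar> \<le> integral {- BL..x} (\<lambda>u. \<bar>a - b\<bar> * exp (1 / w * (u - (- BL))))"
    using N by (simp only: real_norm_def)
  also have "\<dots> = \<bar>a - b\<bar> * (exp (1 / w * (x - (- BL))) - 1) * w"
    using pos Suc.prems by (subst integral_unique[OF h]) auto
  finally have "\<bar>conv (iter a n) x - conv (iter b n) x\<bar> / w \<le> \<bar>a - b\<bar> * (exp (1 / w * (x - (- BL))) - 1)"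
    using pos by (simp add: divide_le_eq)
  moreover have "iter a (Suc n) x - iter b (Suc n) x = (a - b) + (conv (iter a n) x - conv (iter b n) x) / w"
    by (simp add: diff_divide_distrib)
  then have "\<bar>iter a (Suc n) x - iter b (Suc n) x\<bar> \<le> \<bar>a - b\<bar> + \<bar>conv (iter a n) x - conv (iter b n) x\<bar> / w"
    using abs_triangle_ineq[of "a - b" "(conv (iter a n) x - conv (iter b n) x) / w"] pos
    by (simp add: abs_divide)
  ultimately show ?case by (simp add: algebra_simps)
qed simp

lemma sol_diff:
  assumes "0 \<le> a" "0 \<le> b" "- BL \<le> x"
  shows "\<bar>sol a x - sol b x\<bar> \<le> \<bar>a - b\<bar> * exp (1 / w * (x - (- BL)))"
proof (rule LIMSEQ_le_const2)
  show "(\<lambda>n. \<bar>iter a n x - iter b n x\<bar>) \<longlonglongrightarrow> \<bar>sol a x - sol b x\<bar>"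
    by (intro tendsto_intros iter_LIMSEQ assms)
qed (use iter_diff[OF assms(3)] in blast)

lemma sol_zero: "sol 0 x = 0"
proof -
  have "iter 0 n x = 0" for n x
    by (induction n arbitrary: x) (auto simp: conv_def)
  then show ?thesis using LIMSEQ_unique[OF iter_LIMSEQ[of 0 x]] by simp
qed

text \<open>For \<open>a = 0\<close> the solution vanishes, for \<open>a = 1\<close> it is at least \<open>1\<close>; the intermediate value theorem gives an atom
  in between.\<close>

lemma ex_atom: "\<exists>a. 0 < a \<and> a \<le> 1 \<and> sol a BR = 1"
proof -
  define L where "L = exp (1 / w * (BR - (- BL)))"
  have "L-lipschitz_on {0..1} (\<lambda>a. sol a BR)"
    using pos by (intro lipschitz_onI) (auto simp: dist_real_def L_def mult.commute intro!: sol_diff[THEN order_trans])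
  then have "continuous_on {0..1} (\<lambda>a. sol a BR)" by (rule lipschitz_on_continuous_on)
  moreover have "1 \<le> sol 1 BR"
    using sol_eq[of 1 BR] conv_nonneg[OF sol_measurable[of 1]] pos by simp
  ultimately obtain a where a: "0 \<le> a" "a \<le> 1" "sol a BR = 1"
    using IVT'[of "\<lambda>a. sol a BR" 0 1 1] by (auto simp: sol_zero)
  moreover have "a \<noteq> 0" using a sol_zero by auto
  ultimately show ?thesis by (intro exI[of _ a]) auto
qed

definition volterra :: "(real \<Rightarrow> real) \<Rightarrow> bool" where
  "volterra f \<longleftrightarrow> (\<forall>x\<in>{- BL..BR}. w * f x = w * f (- BL) + conv f x)"

text \<open>Solutions are ordered by their atoms: as \<open>H\<close> is monotone and \<open>1\<close>-Lipschitz, the positive part of \<open>f - g\<close>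
  satisfies the integral inequality of \<open>gronwall_zero\<close>.\<close>

lemma volterra_le:
  assumes V: "volterra f" "volterra g"
    and [measurable]: "f \<in> borel_measurable borel" "g \<in> borel_measurable borel"
    and b: "\<And>x. 0 \<le> f x \<and> f x \<le> 1" "\<And>x. 0 \<le> g x \<and> g x \<le> 1"
    and le: "f (- BL) \<le> g (- BL)" and x: "x \<in> {- BL..BR}"
  shows "f x \<le> g x"
proof -
  define e where "e x = max 0 (f x - g x)" for x
  have [measurable]: "e \<in> borel_measurable borel" unfolding e_def[abs_def] by measurable
  have e: "0 \<le> e x \<and> e x \<le> 1" for x using b[of x] by (auto simp: e_def)
  have int: "e integrable_on {a..b}" for a b
    using e by (intro bounded_borel_integrable(1)[where C = 1]) auto
  have "e x = 0"
  proof (rule gronwall_zero[where w = w and C = 1, OF _ _ _ _ x])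
    fix y assume y: "y \<in> {- BL..BR}"
    have 0: "0 \<le> integral {- BL..y} e" using e by (intro integral_nonneg int) auto
    have "w * (f y - g y) = w * (f (- BL) - g (- BL)) + (conv f y - conv g y)"
      using bspec[OF V(1)[unfolded volterra_def] y] bspec[OF V(2)[unfolded volterra_def] y]
      by (simp add: algebra_simps)
    also have "\<dots> \<le> conv f y - conv g y"
      using le pos by (simp add: mult_nonneg_nonpos)
    also have "\<dots> = integral {- BL..y} (\<lambda>u. (1 - J (y - u)) * H (f u) - (1 - J (y - u)) * H (g u))"
      unfolding conv_def by (intro integral_diff[symmetric] conv_integrable) measurable
    also have "\<dots> \<le> integral {- BL..y} e"
    proof (intro integral_le integrable_diff conv_integrable int)
      fix u
      have "(1 - J (y - u)) * (H (f u) - H (g u)) \<le> e u"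
      proof (cases "f u \<le> g u")
        case True
        then have "(1 - J (y - u)) * (H (f u) - H (g u)) \<le> 0"
          using H_mono[OF True] by (intro mult_nonneg_nonpos) auto
        then show ?thesis using e[of u] by simp
      next
        case False
        then have "(1 - J (y - u)) * (H (f u) - H (g u)) \<le> 1 * (f u - g u)"
          using H_increment[of "g u" "f u"] by (intro mult_mono) auto
        then show ?thesis by (simp add: e_def)
      qed
      then show "(1 - J (y - u)) * H (f u) - (1 - J (y - u)) * H (g u) \<le> e u"
        by (simp add: algebra_simps)
    qed auto
    finally have "w * (f y - g y) \<le> integral {- BL..y} e" .
    then show "w * e y \<le> integral {- BL..y} e"
      using 0 by (simp add: e_def max_def)
  qed (use pos e in auto)
  then show ?thesis by (simp add: e_def max_def split: if_splits)
qed

text \<open>The integral term respects the order of the solutions; so a smaller atom could not be made up for until \<open>BR\<close>, where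
  both solutions equal \<open>1\<close>.\<close>

lemma volterra_unique:
  assumes V: "volterra f" "volterra g"
    and m: "f \<in> borel_measurable borel" "g \<in> borel_measurable borel"
    and b: "\<And>x. 0 \<le> f x \<and> f x \<le> 1" "\<And>x. 0 \<le> g x \<and> g x \<le> 1"
    and one: "f BR = 1" "g BR = 1" and x: "x \<in> {- BL..BR}"
  shows "f x = g x"
proof -
  have eq: "f (- BL) = g (- BL)"
    if V: "volterra f" "volterra g"
    and m: "f \<in> borel_measurable borel" "g \<in> borel_measurable borel"
    and b: "\<And>x. 0 \<le> f x \<and> f x \<le> 1" "\<And>x. 0 \<le> g x \<and> g x \<le> 1"
    and one: "f BR = 1" "g BR = 1" and le: "f (- BL) \<le> g (- BL)" for f g
  proof -
    have BR: "BR \<in> {- BL..BR}" using pos by simp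
    have "conv f BR \<le> conv g BR"
      unfolding conv_def
      using volterra_le[OF V m b le] m
      by (intro integral_le conv_integrable mult_left_mono H_mono) auto
    then have "w * g (- BL) \<le> w * f (- BL)"
      using bspec[OF V(1)[unfolded volterra_def] BR] bspec[OF V(2)[unfolded volterra_def] BR] one
      by simp
    then show ?thesis using le pos by simp
  qed
  have "f (- BL) = g (- BL)"
    using eq[OF V m b one] eq[OF V(2,1) m(2,1) b(2,1) one(2,1)] by linarith
  then show ?thesis
    using volterra_le[OF V m b _ x] volterra_le[OF V(2,1) m(2,1) b(2,1) _ x] by simp
qed

lemma ex_volterra_frame:
  "\<exists>\<gamma>. dist_fun_on_frame BL BR \<gamma> \<and> continuous_on {- BL..BR} \<gamma> \<and> volterra \<gamma> \<and> 0 < \<gamma> (- BL)"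
proof -
  obtain a where a: "0 < a" "a \<le> 1" "sol a BR = 1" using ex_atom by blast
  have a0: "0 \<le> a" using a by simp
  \<comment> \<open>Frozen at the ends of the frame, the solution is continuous on \<open>\<real>\<close>.\<close>
  define s where "s x = sol a (max (- BL) (min x BR))" for x
  define \<gamma> where "\<gamma> x = (if x < - BL then 0 else s x)" for x
  have lip: "(1 / w)-lipschitz_on {- BL..BR} (sol a)"
  proof (rule lipschitz_onI)
    have *: "\<bar>sol a y - sol a x\<bar> \<le> 1 / w * \<bar>y - x\<bar>" if "- BL \<le> x" "x \<le> y" for x y
    proof -
      have "sol a y - sol a x = (conv (sol a) y - conv (sol a) x) / w"
        using sol_eq[OF a0, of x] sol_eq[OF a0, of y] by (simp add: diff_divide_distrib)
      also have "\<dots> \<le> (y - x) / w"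
        using conv_incr_le[OF sol_measurable[OF a0] that] pos by (intro divide_right_mono) auto
      finally show ?thesis using monoD[OF sol_mono[OF a0] that(2)] that(2) by simp
    qed
    fix x y assume "x \<in> {- BL..BR}" "y \<in> {- BL..BR}"
    then show "dist (sol a x) (sol a y) \<le> 1 / w * dist x y"
      using *[of x y] *[of y x] by (cases "x \<le> y") (auto simp: dist_real_def abs_minus_commute)
  qed (use pos in auto)
  have s_cont: "continuous_on A s" for A
    unfolding s_def
    by (rule continuous_on_compose2[OF lipschitz_on_continuous_on[OF lip]])
       (use pos in \<open>auto intro!: continuous_intros\<close>)
  have s_ge: "a \<le> s x" for x
    unfolding s_def using sol_eq[OF a0] conv_nonneg[OF sol_measurable[OF a0]] pos by simp
  have s_mono: "s x \<le> s y" if "x \<le> y" for x y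
    unfolding s_def using that by (intro monoD[OF sol_mono[OF a0]]) auto
  have s_BR: "s x = 1" if "BR \<le> x" for x using that pos a by (simp add: s_def)
  have mono: "\<gamma> x \<le> \<gamma> y" if "x \<le> y" for x y
    using that s_mono[OF that] s_ge[of y] a by (auto simp: \<gamma>_def)
  have right: "continuous (at_right x) \<gamma>" for x
  proof (cases "x < - BL")
    case True
    have "eventually (\<lambda>y. \<gamma> y = 0) (at_right x)"
      unfolding eventually_at_right_field using True by (intro exI[of _ "- BL"]) (auto simp: \<gamma>_def)
    then have "(\<gamma> \<longlongrightarrow> 0) (at_right x)" by (rule tendsto_eventually)
    then show ?thesis using True by (simp add: continuous_within \<gamma>_def)
  next
    case False
    have "(s \<longlongrightarrow> s x) (at_right x)"
      using s_cont[of UNIV] by (auto simp: continuous_on_eq_continuous_at isCont_def filterlim_at_split)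
    moreover have "eventually (\<lambda>y. s y = \<gamma> y) (at_right x)"
      unfolding eventually_at_right_field using False by (intro exI[of _ "x + 1"]) (auto simp: \<gamma>_def)
    ultimately have "(\<gamma> \<longlongrightarrow> s x) (at_right x)" using tendsto_cong by blast
    then show ?thesis using False by (simp add: continuous_within \<gamma>_def)
  qed
  have bot: "(\<gamma> \<longlongrightarrow> 0) at_bot"
    by (rule tendsto_eventually) (auto simp: eventually_at_bot_dense \<gamma>_def intro!: exI[of _ "- BL"])
  have top: "(\<gamma> \<longlongrightarrow> 1) at_top"
    by (rule tendsto_eventually)
       (use pos in \<open>auto simp: eventually_at_top_linorder \<gamma>_def s_BR intro!: exI[of _ BR]\<close>)
  have "real_distribution (interval_measure \<gamma>)" "cdf (interval_measure \<gamma>) = \<gamma>"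
    using mono right bot top by (auto intro!: real_distribution_interval_measure cdf_interval_measure)
  then have d: "dist_fun \<gamma>" using dist_fun_cdf by metis
  have "(\<gamma> \<longlongrightarrow> 0) (at_left (- BL))"
    by (rule tendsto_eventually) (auto simp: eventually_at_filter \<gamma>_def)
  then have "left_lim \<gamma> (- BL) = 0" by (rule left_lim_eqI)
  then have fr: "dist_fun_on_frame BL BR \<gamma>"
    using d pos by (simp add: dist_fun_on_frame_def \<gamma>_def s_BR)
  have eq: "\<gamma> x = sol a x" if "x \<in> {- BL..BR}" for x using that by (auto simp: \<gamma>_def s_def)
  have "continuous_on {- BL..BR} \<gamma>"
    using lipschitz_on_continuous_on[OF lip] by (rule continuous_on_eq) (simp add: eq)
  moreover have "volterra \<gamma>"
    unfolding volterra_def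
  proof
    fix x assume x: "x \<in> {- BL..BR}"
    have c: "conv \<gamma> x = conv (sol a) x"
      unfolding conv_def using x by (intro integral_cong) (auto simp: eq)
    have "conv (sol a) (- BL) = 0" by (simp add: conv_def)
    then have "sol a (- BL) = a" using sol_eq[OF a0, of "- BL"] by simp
    then show "w * \<gamma> x = w * \<gamma> (- BL) + conv \<gamma> x"
      unfolding c using sol_eq[OF a0, of x] x pos eq by (simp add: field_simps)
  qed
  moreover have "0 < \<gamma> (- BL)" using s_ge[of "- BL"] a by (simp add: \<gamma>_def)
  ultimately show ?thesis using fr by blast
qed

end

section \<open>Regularity of wave shapes\<close>

text \<open>For every slope \<open>\<epsilon> > 0\<close>, the largest \<open>z\<close> such that \<open>f\<close> stays in the cone of slope \<open>\<epsilon>\<close> on \<open>[a, z]\<close> must be \<open>b\<close>: the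
  right derivative keeps \<open>f\<close> in the cone slightly beyond any smaller \<open>z\<close>.\<close>

lemma const_if_zero_right_derivative:
  fixes f :: "real \<Rightarrow> real"
  assumes cont: "continuous_on {a..b} f" and ab: "a \<le> b"
    and deriv: "\<And>x. x \<in> {a..<b} \<Longrightarrow> (f has_real_derivative 0) (at_right x)"
  shows "f b = f a"
proof -
  have *: "\<bar>f b - f a\<bar> \<le> \<epsilon> * (b - a)" if \<epsilon>: "0 < \<epsilon>" for \<epsilon>
  proof -
    define S where "S = {x \<in> {a..b}. \<bar>f x - f a\<bar> \<le> \<epsilon> * (x - a)}"
    define T where "T = {x \<in> {a..b}. {a..x} \<subseteq> S}"
    define z where "z = Sup T"
    have "closed S"
      unfolding S_def
      by (rule continuous_on_closed_Collect_le) (auto intro!: continuous_intros cont)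
    have "a \<in> T" using ab by (auto simp: T_def S_def)
    have bdd: "bdd_above T" by (rule bdd_aboveI[of _ b]) (auto simp: T_def)
    have z1: "a \<le> z" unfolding z_def by (rule cSup_upper[OF \<open>a \<in> T\<close> bdd])
    have z2: "z \<le> b" unfolding z_def by (rule cSup_least) (use \<open>a \<in> T\<close> in \<open>auto simp: T_def\<close>)
    note z = z1 z2
    have below: "y \<in> S" if "a \<le> y" "y < z" for y
    proof -
      obtain x where "x \<in> T" "y < x"
        using less_cSup_iff[of T y] bdd \<open>a \<in> T\<close> \<open>y < z\<close> unfolding z_def by blast
      then show ?thesis using that by (auto simp: T_def)
    qed
    have "z \<in> S"
    proof (cases "a = z")
      case True
      then show ?thesis using \<open>a \<in> T\<close> by (auto simp: T_def)
    next
      case False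
      then have "z \<in> closure {a..<z}" using z by simp
      also have "\<dots> \<subseteq> S" using below \<open>closed S\<close> by (intro closure_minimal) auto
      finally show ?thesis .
    qed
    then have "z \<in> T" using z below by (auto simp: T_def order_le_less)
    have "z = b"
    proof (rule ccontr)
      assume "z \<noteq> b"
      then have zb: "z < b" using z by simp
      have "((\<lambda>y. (f y - f z) / (y - z)) \<longlongrightarrow> 0) (at_right z)"
        using deriv[of z] z zb by (simp add: has_field_derivative_iff)
      then have "eventually (\<lambda>y. \<bar>(f y - f z) / (y - z)\<bar> < \<epsilon>) (at_right z)"
        using tendstoD[OF _ \<epsilon>] by (force simp: dist_real_def)
      then obtain c where c: "z < c" "\<And>y. z < y \<Longrightarrow> y < c \<Longrightarrow> \<bar>(f y - f z) / (y - z)\<bar> < \<epsilon>"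
        unfolding eventually_at_right_field by blast
      define x where "x = (z + min c b) / 2"
      have x: "z < x" "x < c" "x < b" using c zb by (auto simp: x_def min_def)
      have "y \<in> S" if y: "a \<le> y" "y \<le> x" for y
      proof (cases "y \<le> z")
        case True
        then show ?thesis using \<open>z \<in> T\<close> y by (auto simp: T_def)
      next
        case False
        then have "\<bar>f y - f z\<bar> < \<epsilon> * (y - z)"
          using c(2)[of y] y x by (simp add: abs_divide divide_less_eq)
        moreover have "\<bar>f z - f a\<bar> \<le> \<epsilon> * (z - a)" using \<open>z \<in> S\<close> by (simp add: S_def)
        ultimately have "\<bar>f y - f a\<bar> \<le> \<epsilon> * (y - a)" by (simp add: algebra_simps)
        then show ?thesis using y x by (simp add: S_def)
      qed
      then have "x \<in> T" using x z by (auto simp: T_def)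
      then have "x \<le> z" unfolding z_def by (rule cSup_upper[OF _ bdd])
      then show False using x by simp
    qed
    then show ?thesis using \<open>z \<in> S\<close> by (simp add: S_def)
  qed
  show ?thesis
  proof (rule ccontr)
    assume "f b \<noteq> f a"
    then have p: "0 < \<bar>f b - f a\<bar>" by simp
    then have "a \<noteq> b" by auto
    then have l: "0 < b - a" using ab by simp
    show False using *[of "\<bar>f b - f a\<bar> / (2 * (b - a))"] p l by (simp add: field_simps)
  qed
qed

lemma right_derivative_unique:
  fixes f :: "real \<Rightarrow> real"
  assumes "(f has_real_derivative D) (at_right x)" "(f has_real_derivative E) (at_right x)"
  shows "D = E"
  using assms tendsto_unique[OF trivial_limit_at_right_real] by (auto simp: has_field_derivative_iff)

context continuous_framed
begin

text \<open>\<open>thrown\<close> is the law of the landing points, were the jumps not stopped at \<open>BR\<close>; it is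
  a subprobability, since a particle may fail to jump. The rate \<open>\<zeta>\<close> of crossing a point to the
  right is the rate of jumps starting before it minus the rate of jumps landing before it.\<close>

definition thrown :: "real measure" where
  "thrown = distr (density \<mu> (\<lambda>y. ennreal (p y)) \<Otimes>\<^sub>M interval_measure J) borel (\<lambda>(y, z). y + z)"

lemma emeasure_thrown: "emeasure thrown {..u} = (\<integral>\<^sup>+y. ennreal (p y * J (u - y)) \<partial>\<mu>)"
proof -
  have "emeasure thrown {..u} = (\<integral>\<^sup>+x. indicator {..u} x \<partial>thrown)"
    by (subst nn_integral_indicator) (auto simp: thrown_def)
  also have "\<dots> = (\<integral>\<^sup>+z. indicator {..u} (fst z + snd z) \<partial>(density \<mu> (\<lambda>y. ennreal (p y)) \<Otimes>\<^sub>M interval_measure J))"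
    unfolding thrown_def by (subst nn_integral_distr) (auto simp: split_beta')
  also have "\<dots> = (\<integral>\<^sup>+y. (\<integral>\<^sup>+z. indicator {..u} (y + z) \<partial>interval_measure J) \<partial>density \<mu> (\<lambda>y. ennreal (p y)))"
    by (subst nn_integral_pair[OF J.prob_space_axioms]) auto
  also have "\<dots> = (\<integral>\<^sup>+y. ennreal (J (u - y)) \<partial>density \<mu> (\<lambda>y. ennreal (p y)))"
  proof (rule nn_integral_cong)
    fix y
    have "(\<integral>\<^sup>+z. indicator {..u} (y + z) \<partial>interval_measure J) = (\<integral>\<^sup>+z. indicator {..u - y} z \<partial>interval_measure J)"
      by (intro nn_integral_cong) (auto simp: indicator_def)
    then show "(\<integral>\<^sup>+z. indicator {..u} (y + z) \<partial>interval_measure J) = ennreal (J (u - y))"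
      by (simp add: emeasure_of_dist_fun[OF J_dist])
  qed
  also have "\<dots> = (\<integral>\<^sup>+y. ennreal (p y) * ennreal (J (u - y)) \<partial>\<mu>)"
    by (rule nn_integral_density) measurable
  finally show ?thesis by (simp add: ennreal_mult)
qed

lemma finite_thrown: "finite_borel_measure thrown"
proof -
  have "emeasure (density \<mu> (\<lambda>y. ennreal (p y))) UNIV = (\<integral>\<^sup>+y. ennreal (p y) \<partial>\<mu>)"
    by (subst emeasure_density) auto
  also have "\<dots> \<le> (\<integral>\<^sup>+y. 1 \<partial>\<mu>)" by (intro nn_integral_mono) simp
  finally have "emeasure (density \<mu> (\<lambda>y. ennreal (p y))) UNIV \<noteq> \<infinity>"
    using \<mu>.emeasure_space_1 by (auto simp: top_unique)
  then have f: "finite_measure (density \<mu> (\<lambda>y. ennreal (p y)))" by (intro finite_measureI) simp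
  have "finite_measure (density \<mu> (\<lambda>y. ennreal (p y)) \<Otimes>\<^sub>M interval_measure J)"
    by (intro finite_measure_pair_measure f) (rule J.finite_measure_axioms)
  then have "finite_measure thrown"
    unfolding thrown_def by (intro finite_measure.finite_measure_distr) auto
  then show ?thesis
    by (intro finite_borel_measure.intro finite_borel_measure_axioms.intro) (auto simp: thrown_def)
qed

sublocale thrown: finite_borel_measure thrown by (rule finite_thrown)

lemma zeta_eq: 
  assumes u: "- BL \<le> u"
  shows "\<zeta> u = H (\<gamma> u) - cdf thrown u"
proof -
  have "emeasure thrown {..u} + flux p J \<mu> u = (\<integral>\<^sup>+y. ennreal (p y * J (u - y)) + ennreal (p y * (1 - J (u - y))) * indicator {..u} y \<partial>\<mu>)"
    unfolding emeasure_thrown flux_def by (rule nn_integral_add[symmetric]) measurable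
  also have "\<dots> = (\<integral>\<^sup>+y. ennreal (p y) * indicator {..u} y \<partial>\<mu>)"
  proof (rule nn_integral_cong)
    fix y
    show "ennreal (p y * J (u - y)) + ennreal (p y * (1 - J (u - y))) * indicator {..u} y = ennreal (p y) * indicator {..u} y"
    proof (cases "y \<le> u")
      case True
      have "ennreal (p y * J (u - y)) + ennreal (p y * (1 - J (u - y))) =
          ennreal (p y * J (u - y) + p y * (1 - J (u - y)))"
        by (rule ennreal_plus[symmetric]) simp_all
      also have "p y * J (u - y) + p y * (1 - J (u - y)) = p y" by (simp add: algebra_simps)
      finally show ?thesis using True by simp
    next
      case False
      then show ?thesis using J_nonneg[of "u - y"] by simp
    qed
  qed
  also have "\<dots> = ennreal (H (\<gamma> u))" by (rule cumulative_jump_rate[OF u])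
  finally have "cdf thrown u + \<zeta> u = H (\<gamma> u)"
    unfolding flux_zeta[OF u] using zeta_nonneg H_nonneg
    by (simp add: thrown.emeasure_eq_measure cdf_def ennreal_plus[symmetric] del: ennreal_plus)
  then show ?thesis by simp
qed

lemma zeta_right_cont:
  assumes x: "- BL \<le> x"
  shows "(\<zeta> \<longlongrightarrow> \<zeta> x) (at_right x)"
proof -
  have "(\<gamma> \<longlongrightarrow> \<gamma> x) (at_right x)"
    using dist_fun_right_cont[OF \<gamma>_dist, of x] by (simp add: continuous_within)
  then have "((\<lambda>u. H (\<gamma> u)) \<longlongrightarrow> H (\<gamma> x)) (at_right x)"
    by (intro continuous_on_tendsto_compose[OF H_cont[of UNIV]]) auto
  moreover have "(cdf thrown \<longlongrightarrow> cdf thrown x) (at_right x)"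
    using thrown.cdf_is_right_cont[of x] by (simp add: continuous_within)
  ultimately have "((\<lambda>u. H (\<gamma> u) - cdf thrown u) \<longlongrightarrow> H (\<gamma> x) - cdf thrown x) (at_right x)"
    by (rule tendsto_diff)
  moreover have "eventually (\<lambda>u. H (\<gamma> u) - cdf thrown u = \<zeta> u) (at_right x)"
    using x by (auto simp: eventually_at_filter zeta_eq)
  ultimately show ?thesis using tendsto_cong zeta_eq[OF x] by metis
qed

lemma zeta_left_limit:
  assumes x: "- BL < x"
  shows "(\<zeta> \<longlongrightarrow> left_lim \<zeta> x) (at_left x)" "\<zeta> x \<le> left_lim \<zeta> x"
    "isCont (cdf thrown) x \<Longrightarrow> left_lim \<zeta> x = \<zeta> x"
proof -
  have "(\<gamma> \<longlongrightarrow> \<gamma> x) (at_left x)"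
    using \<gamma>_isCont[OF x] by (auto simp: isCont_def filterlim_at_split)
  then have g: "((\<lambda>u. H (\<gamma> u)) \<longlongrightarrow> H (\<gamma> x)) (at_left x)"
    by (intro continuous_on_tendsto_compose[OF H_cont[of UNIV]]) auto
  have c: "(cdf thrown \<longlongrightarrow> measure thrown {..<x}) (at_left x)" by (rule thrown.cdf_at_left)
  have "eventually (\<lambda>u. H (\<gamma> u) - cdf thrown u = \<zeta> u) (at_left x)"
    unfolding eventually_at_left_field using x by (intro exI[of _ "- BL"]) (auto simp: zeta_eq)
  then have l: "(\<zeta> \<longlongrightarrow> H (\<gamma> x) - measure thrown {..<x}) (at_left x)"
    using tendsto_diff[OF g c] by (rule tendsto_cong[THEN iffD1])
  then have e: "left_lim \<zeta> x = H (\<gamma> x) - measure thrown {..<x}" by (rule left_lim_eqI)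
  show "(\<zeta> \<longlongrightarrow> left_lim \<zeta> x) (at_left x)" using l e by simp
  have "measure thrown {..<x} \<le> cdf thrown x"
    unfolding cdf_def by (intro thrown.finite_measure_mono) auto
  then show "\<zeta> x \<le> left_lim \<zeta> x" using e zeta_eq[of x] x by simp
  assume "isCont (cdf thrown) x"
  then have "(cdf thrown \<longlongrightarrow> cdf thrown x) (at_left x)" by (auto simp: isCont_def filterlim_at_split)
  then have "measure thrown {..<x} = cdf thrown x"
    using c tendsto_unique[OF trivial_limit_at_left_real] by blast
  then show "left_lim \<zeta> x = \<zeta> x" using e zeta_eq[of x] x by simp
qed

lemma zeta_rcll: "rcll_on {- BL..BR} \<zeta>"
  unfolding rcll_on_def
proof (intro ballI conjI)
  fix x assume x: "x \<in> {- BL..BR}"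
  then show "(\<zeta> \<longlongrightarrow> \<zeta> x) (at x within {- BL..BR} \<inter> {x<..})"
    using zeta_right_cont[of x] by (auto intro: tendsto_within_subset)
  show "\<exists>l. (\<zeta> \<longlongrightarrow> l) (at x within {- BL..BR} \<inter> {..<x})"
  proof (cases "x = - BL")
    case True
    then have "{- BL..BR} \<inter> {..<x} = {}" by auto
    then show ?thesis by (simp add: at_within_def)
  next
    case False
    then show ?thesis using zeta_left_limit(1)[of x] x by (auto intro: tendsto_within_subset)
  qed
qed

text \<open>By right-continuity of \<open>\<zeta>\<close> its integral has right derivative \<open>\<zeta>\<close> everywhere, so \<open>w \<gamma> - \<integral> \<zeta>\<close> has right derivative \<open>0\<close>.\<close>

lemma balanced_of_right_derivative:
  assumes "\<forall>x\<in>{- BL..<BR}. \<exists>D. (\<gamma> has_real_derivative D) (at_right x) \<and> w * D = \<zeta> x"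
  shows "flux_balanced w BL BR p J \<mu>"
  unfolding balanced_iff_integral
proof
  fix x assume x: "x \<in> {- BL..BR}"
  define f where "f y = w * \<gamma> y - integral {- BL..y} \<zeta>" for y
  have "f x = f (- BL)"
  proof (rule const_if_zero_right_derivative[where f = f and a = "- BL" and b = x])
    show "continuous_on {- BL..x} f"
      unfolding f_def using x
      by (intro continuous_intros indefinite_integral_continuous_1 zeta_integrable
          continuous_on_subset[OF \<gamma>_cont]) auto
    fix y assume y: "y \<in> {- BL..<x}"
    then obtain D where D: "(\<gamma> has_real_derivative D) (at_right y)" "w * D = \<zeta> y"
      using assms x by force
    have "continuous (at y within {y..x}) \<zeta>"
      using zeta_right_cont[of y] y by (simp add: continuous_within at_within_Icc_at_right)
    then have "((\<lambda>u. integral {y..u} \<zeta>) has_vector_derivative \<zeta> y) (at y within {y..x})"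
      using integral_has_vector_derivative_continuous_at[of \<zeta> y x y "{}"] y zeta_integrable by simp
    then have "((\<lambda>u. integral {- BL..y} \<zeta> + integral {y..u} \<zeta>) has_real_derivative 0 + \<zeta> y) (at y within {y..x})"
      by (intro derivative_intros) (simp add: has_real_derivative_iff_has_vector_derivative)
    then have "((\<lambda>u. integral {- BL..u} \<zeta>) has_real_derivative 0 + \<zeta> y) (at y within {y..x})"
      by (rule has_field_derivative_transform_within[OF _ zero_less_one])
         (use y Henstock_Kurzweil_Integration.integral_combine[of "- BL" y _ \<zeta>] zeta_integrable in auto)
    then have "((\<lambda>u. integral {- BL..u} \<zeta>) has_real_derivative \<zeta> y) (at_right y)"
      using y by (simp add: at_within_Icc_at_right)
    then show "(f has_real_derivative 0) (at_right y)"
      unfolding f_def using D by (auto intro!: derivative_eq_intros simp: mult.commute)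
  qed (use x in auto)
  then show "w * \<gamma> x = w * \<gamma> (- BL) + integral {- BL..x} \<zeta>" by (simp add: f_def)
qed

end

locale wave_shape = continuous_framed +
  assumes balanced: "flux_balanced w BL BR p J \<mu>"
begin

lemma increment:
  assumes "- BL \<le> x" "x \<le> y" "y \<le> BR"
  shows "\<gamma> y = \<gamma> x + integral {x..y} \<zeta> / w"
proof -
  have "w * \<gamma> y = w * \<gamma> (- BL) + integral {- BL..y} \<zeta>" "w * \<gamma> x = w * \<gamma> (- BL) + integral {- BL..x} \<zeta>"
    using bspec[OF balanced[unfolded balanced_iff_integral], of y]
      bspec[OF balanced[unfolded balanced_iff_integral], of x] assms by auto
  moreover have "integral {- BL..y} \<zeta> = integral {- BL..x} \<zeta> + integral {x..y} \<zeta>"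
    using Henstock_Kurzweil_Integration.integral_combine[of "- BL" x y \<zeta>] zeta_integrable assms by simp
  ultimately show ?thesis using pos by (simp add: field_simps)
qed

text \<open>Changing \<open>\<zeta>\<close> in the single point \<open>x\<close> does not affect its integrals; taking \<open>v\<close> as a one-sided
  limit yields both one-sided derivatives and, if the limits agree, the derivative.\<close>

lemma derivative_within:
  assumes ab: "- BL \<le> a" "b \<le> BR" "x \<in> {a..b}"
    and lim: "(\<zeta> \<longlongrightarrow> v) (at x within {a..b})"
  shows "(\<gamma> has_real_derivative v / w) (at x within {a..b})"
proof -
  define f where "f y = (if y = x then v else \<zeta> y)" for y
  have int: "f integrable_on {c..d}" for c d
    by (rule integrable_spike[OF zeta_integrable negligible_sing[of x]]) (auto simp: f_def)
  have eq: "integral {c..d} f = integral {c..d} \<zeta>" for c d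
    by (rule integral_spike[OF negligible_sing[of x]]) (auto simp: f_def)
  have "(f \<longlongrightarrow> v) (at x within {a..b})"
    using lim by (rule Lim_transform_eventually) (auto simp: f_def eventually_at_filter)
  then have "continuous (at x within {a..b}) f" by (simp add: continuous_within f_def)
  then have "((\<lambda>u. integral {a..u} f) has_vector_derivative f x) (at x within {a..b})"
    using integral_has_vector_derivative_continuous_at[of f a b x "{}"] ab int by simp
  then have "((\<lambda>u. integral {a..u} \<zeta>) has_real_derivative v) (at x within {a..b})"
    by (simp add: has_real_derivative_iff_has_vector_derivative eq f_def)
  then have "((\<lambda>u. \<gamma> a + integral {a..u} \<zeta> / w) has_real_derivative 0 + v / w) (at x within {a..b})"
    by (intro DERIV_add DERIV_const DERIV_cdivide)
  then have "(\<gamma> has_real_derivative 0 + v / w) (at x within {a..b})"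
  proof (rule has_field_derivative_transform_within[OF _ zero_less_one ab(3)])
    fix y assume "y \<in> {a..b}"
    then show "\<gamma> a + integral {a..y} \<zeta> / w = \<gamma> y"
      using ab by (intro increment[symmetric]) auto
  qed
  then show ?thesis by simp
qed

lemma right_derivative:
  assumes "x \<in> {- BL..<BR}"
  shows "(\<gamma> has_real_derivative \<zeta> x / w) (at_right x)"
  using derivative_within[of x BR x "\<zeta> x"] zeta_right_cont[of x] assms
  by (simp add: at_within_Icc_at_right)

lemma left_derivative:
  assumes "x \<in> {- BL<..BR}"
  shows "(\<gamma> has_real_derivative left_lim \<zeta> x / w) (at_left x)"
  using derivative_within[of "- BL" x x "left_lim \<zeta> x"] zeta_left_limit(1)[of x] assms
  by (simp add: at_within_Icc_at_left)

text \<open>The distribution function of \<open>thrown\<close> is monotone and so discontinuous in countably many points only; everywhere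
  else \<open>\<zeta>\<close> is continuous.\<close>

lemma AE_differentiable: "AE x in lebesgue. x \<in> {- BL<..<BR} \<longrightarrow> \<gamma> field_differentiable (at x)"
proof -
  have "mono (cdf thrown)" using thrown.cdf_nondecreasing by (simp add: mono_def)
  then have "countable {x. \<not> isCont (cdf thrown) x}" by (rule mono_ctble_discont)
  then have "AE x in lborel. x \<notin> {x. \<not> isCont (cdf thrown) x}"
    by (intro AE_not_in countable_imp_null_set_lborel)
  then have "AE x in lebesgue. x \<notin> {x. \<not> isCont (cdf thrown) x}" by (rule AE_completion)
  then show ?thesis
  proof eventually_elim
    fix x assume c: "x \<notin> {x. \<not> isCont (cdf thrown) x}"
    show "x \<in> {- BL<..<BR} \<longrightarrow> \<gamma> field_differentiable (at x)"
    proof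
      assume x: "x \<in> {- BL<..<BR}"
      then have "(\<zeta> \<longlongrightarrow> \<zeta> x) (at_left x)" "(\<zeta> \<longlongrightarrow> \<zeta> x) (at_right x)"
        using zeta_left_limit[of x] zeta_right_cont[of x] c by auto
      then have "(\<zeta> \<longlongrightarrow> \<zeta> x) (at x)" by (simp add: filterlim_at_split)
      then have "(\<zeta> \<longlongrightarrow> \<zeta> x) (at x within {- BL..BR})" by (rule tendsto_within_subset) simp
      then have "(\<gamma> has_real_derivative \<zeta> x / w) (at x within {- BL..BR})"
        using x by (intro derivative_within) auto
      then show "\<gamma> field_differentiable (at x)"
        using x at_within_interior[of x "{- BL..BR}"] by (auto simp: field_differentiable_def)
    qed
  qed
qed

lemma regular_derivative:
  assumes x: "x \<in> {- BL<..<BR}" and "\<gamma> field_differentiable (at x)"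
  shows "w * deriv \<gamma> x = \<zeta> x"
proof -
  have "(\<gamma> has_real_derivative deriv \<gamma> x) (at_right x)"
    by (rule has_field_derivative_at_within, rule field_differentiable_derivI, rule assms(2))
  moreover have "(\<gamma> has_real_derivative \<zeta> x / w) (at_right x)"
    using x by (intro right_derivative) auto
  ultimately have "deriv \<gamma> x = \<zeta> x / w" by (rule right_derivative_unique)
  then show ?thesis using pos by simp
qed

text \<open>Among the jumps from \<open>(x - d, x]\<close>, a fraction of at least \<open>1 - J d\<close> is long enough to cross \<open>x\<close>.\<close>

lemma zeta_lower:
  assumes x: "x \<in> {- BL..BR}" and d: "0 < d"
  shows "(1 - J d) * (H (\<gamma> x) - (if - BL \<le> x - d then H (\<gamma> (x - d)) else 0)) \<le> \<zeta> x"
proof -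
  define h where "h = (if - BL \<le> x - d then H (\<gamma> (x - d)) else 0)"
  have h: "(\<integral>\<^sup>+y. ennreal (p y) * indicator {..x - d} y \<partial>\<mu>) = ennreal h"
  proof (cases "- BL \<le> x - d")
    case True
    then show ?thesis by (simp add: h_def cumulative_jump_rate)
  next
    case False
    have "(\<integral>\<^sup>+y. ennreal (p y) * indicator {..x - d} y \<partial>\<mu>) = (\<integral>\<^sup>+y. 0 \<partial>\<mu>)"
      using AE_ge by (intro nn_integral_cong_AE, eventually_elim) (use False in \<open>auto simp: indicator_def\<close>)
    then show ?thesis using False by (simp add: h_def)
  qed
  have h0: "0 \<le> h" by (simp add: h_def H_nonneg)
  have "ennreal (1 - J d) * ennreal (H (\<gamma> x)) = (\<integral>\<^sup>+y. ennreal (1 - J d) * (ennreal (p y) * indicator {..x} y) \<partial>\<mu>)"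
    using x by (subst nn_integral_cmult) (auto simp: cumulative_jump_rate)
  also have "\<dots> \<le> (\<integral>\<^sup>+y. ennreal (p y * (1 - J (x - y))) * indicator {..x} y
      + ennreal (1 - J d) * (ennreal (p y) * indicator {..x - d} y) \<partial>\<mu>)"
  proof (rule nn_integral_mono)
    fix y
    show "ennreal (1 - J d) * (ennreal (p y) * indicator {..x} y) \<le>
        ennreal (p y * (1 - J (x - y))) * indicator {..x} y + ennreal (1 - J d) * (ennreal (p y) * indicator {..x - d} y)"
    proof (cases "x - d < y \<and> y \<le> x")
      case True
      then have "p y * (1 - J d) \<le> p y * (1 - J (x - y))"
        using dist_fun_mono[OF J_dist, of "x - y" d] by (intro mult_left_mono) auto
      then show ?thesis using True by (simp add: ennreal_mult[symmetric] mult.commute ennreal_leI)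
    next
      case False
      then show ?thesis using d by (cases "y \<le> x") (auto simp: indicator_def)
    qed
  qed
  also have "\<dots> = flux p J \<mu> x + (\<integral>\<^sup>+y. ennreal (1 - J d) * (ennreal (p y) * indicator {..x - d} y) \<partial>\<mu>)"
    unfolding flux_def by (rule nn_integral_add) measurable
  also have "\<dots> = ennreal (\<zeta> x) + ennreal (1 - J d) * ennreal h"
    using x by (subst nn_integral_cmult) (auto simp: h flux_zeta)
  finally have "(1 - J d) * H (\<gamma> x) \<le> \<zeta> x + (1 - J d) * h"
    using h0 zeta_nonneg[of x] H_nonneg[of "\<gamma> x"]
    by (simp add: ennreal_mult[symmetric] ennreal_plus[symmetric] del: ennreal_plus)
  then show ?thesis unfolding h_def[symmetric] by (simp only: algebra_simps)
qed

text \<open>Without an atom, \<open>\<gamma>\<close> would lie below the trivial solution \<open>0\<close> of the Volterra equation.\<close>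

lemma atom_pos: "0 < \<gamma> (- BL)"
proof (rule ccontr)
  assume "\<not> 0 < \<gamma> (- BL)"
  then have le: "\<gamma> (- BL) \<le> 0" by simp
  have v: "volterra \<gamma>"
    using balanced unfolding balanced_iff_volterra volterra_def conv_def .
  have v0: "volterra (\<lambda>_. 0)" by (simp add: volterra_def conv_def)
  have "\<gamma> BR \<le> 0"
    by (rule volterra_le[OF v v0 \<gamma>_measurable _ _ _ le]) (use \<gamma>_bounds pos in simp_all)
  then show False using \<gamma>_right[of BR] by simp
qed

text \<open>If \<open>\<zeta>\<close> vanished in \<open>x\<close>, no mass would lie within reach \<open>d\<close> to the left of \<open>x\<close>, hence \<open>\<gamma>\<close> would be
  constant there and \<open>\<zeta>\<close> would vanish in \<open>x - d\<close> as well. Descending in steps of \<open>d\<close> one reaches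
  the atom in \<open>- BL\<close>, which has positive mass.\<close>

lemma zeta_pos:
  assumes d: "0 < d" "J d < 1" and x: "x \<in> {- BL..BR}"
  shows "0 < \<zeta> x"
proof -
  have "0 < \<zeta> x" if "x \<in> {- BL..BR}" "x < - BL + real n * d" for n x
    using that
  proof (induction n arbitrary: x)
    case (Suc n)
    show ?case
    proof (cases "- BL \<le> x - d")
      case False
      have "0 < H (\<gamma> (- BL))"
        using H_strict[of 0 "\<gamma> (- BL)"] atom_pos \<gamma>_bounds by simp
      also have "\<dots> \<le> H (\<gamma> x)" using Suc.prems by (intro H_mono \<gamma>_mono) simp
      finally have "0 < (1 - J d) * H (\<gamma> x)" using d by simp
      then show ?thesis using zeta_lower[OF Suc.prems(1) d(1)] False by simp
    next
      case True
      have pos': "0 < \<zeta> (x - d)"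
        using Suc d True by (intro Suc.IH) (auto simp: algebra_simps)
      show ?thesis
      proof (rule ccontr)
        assume "\<not> 0 < \<zeta> x"
        then have "(1 - J d) * (H (\<gamma> x) - H (\<gamma> (x - d))) \<le> 0"
          using zeta_lower[OF Suc.prems(1) d(1)] True by simp
        then have "H (\<gamma> x) \<le> H (\<gamma> (x - d))" using d by (simp add: mult_le_0_iff)
        then have "\<gamma> x \<le> \<gamma> (x - d)"
          using H_strict[of "\<gamma> (x - d)" "\<gamma> x"] \<gamma>_bounds by force
        then have const: "\<gamma> y = \<gamma> (x - d)" if "x - d \<le> y" "y \<le> x" for y
          using \<gamma>_mono[OF that(1)] \<gamma>_mono[OF that(2)] by simp
        have "((\<lambda>_. \<gamma> (x - d)) has_real_derivative 0) (at (x - d) within {x - d..x})" by simp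
        then have "(\<gamma> has_real_derivative 0) (at (x - d) within {x - d..x})"
        proof (rule has_field_derivative_transform_within[OF _ zero_less_one])
          show "x - d \<in> {x - d..x}" using d by simp
        next
          fix y assume "y \<in> {x - d..x}"
          then show "\<gamma> (x - d) = \<gamma> y" by (intro const[symmetric]) auto
        qed
        then have "(\<gamma> has_real_derivative 0) (at_right (x - d))"
          using d by (simp add: at_within_Icc_at_right)
        moreover have "(\<gamma> has_real_derivative \<zeta> (x - d) / w) (at_right (x - d))"
          using Suc.prems True d by (intro right_derivative) auto
        ultimately have "0 = \<zeta> (x - d) / w" by (rule right_derivative_unique)
        then show False using pos' pos by simp
      qed
    qed
  qed simp
  moreover obtain n where "(x + BL) / d < real n" using reals_Archimedean2 by blast
  then have "x < - BL + real n * d" using d by (simp add: field_simps)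
  ultimately show ?thesis using x by blast
qed

text \<open>\<open>\<zeta>\<close> is positive and jumps only downwards, so it is bounded below near each point of the compact frame.\<close>

lemma zeta_bounded_below:
  assumes d: "0 < d" "J d < 1"
  shows "\<exists>\<epsilon>>0. \<forall>x\<in>{- BL..BR}. \<epsilon> \<le> \<zeta> x"
proof -
  have "\<exists>\<epsilon>>0. \<forall>x\<in>{- BL..BR}. x \<in> {- BL..BR} \<longrightarrow> \<epsilon> \<le> \<zeta> x"
  proof (rule Bolzano[where P = "\<lambda>a b. \<exists>\<epsilon>>0. \<forall>x\<in>{a..b}. x \<in> {- BL..BR} \<longrightarrow> \<epsilon> \<le> \<zeta> x"])
    fix a b c :: real
    assume "\<exists>\<epsilon>>0. \<forall>x\<in>{a..b}. x \<in> {- BL..BR} \<longrightarrow> \<epsilon> \<le> \<zeta> x" "\<exists>\<epsilon>>0. \<forall>x\<in>{b..c}. x \<in> {- BL..BR} \<longrightarrow> \<epsilon> \<le> \<zeta> x"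
    then obtain \<epsilon>1 \<epsilon>2 where "0 < \<epsilon>1" "0 < \<epsilon>2" "\<forall>x\<in>{a..b}. x \<in> {- BL..BR} \<longrightarrow> \<epsilon>1 \<le> \<zeta> x" "\<forall>x\<in>{b..c}. x \<in> {- BL..BR} \<longrightarrow> \<epsilon>2 \<le> \<zeta> x"
      by blast
    then show "\<exists>\<epsilon>>0. \<forall>x\<in>{a..c}. x \<in> {- BL..BR} \<longrightarrow> \<epsilon> \<le> \<zeta> x"
      by (intro exI[of _ "min \<epsilon>1 \<epsilon>2"]) (force simp: min_le_iff_disj)
  next
    fix x :: real assume x: "- BL \<le> x" "x \<le> BR"
    define \<epsilon> where "\<epsilon> = \<zeta> x / 2"
    have z: "0 < \<zeta> x" using zeta_pos[OF d] x by simp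
    have "eventually (\<lambda>y. \<epsilon> < \<zeta> y) (at_right x)"
      using order_tendstoD(1)[OF zeta_right_cont[OF x(1)], of \<epsilon>] z by (simp add: \<epsilon>_def)
    then obtain r where r: "x < r" "\<And>y. x < y \<Longrightarrow> y < r \<Longrightarrow> \<epsilon> < \<zeta> y"
      unfolding eventually_at_right_field by blast
    obtain l where l: "l < x" "\<And>y. l < y \<Longrightarrow> y < x \<Longrightarrow> y \<in> {- BL..BR} \<Longrightarrow> \<epsilon> < \<zeta> y"
    proof (cases "x = - BL")
      case True
      then show ?thesis using that[of "x - 1"] by simp
    next
      case False
      then have "- BL < x" using x by simp
      then have "eventually (\<lambda>y. \<epsilon> < \<zeta> y) (at_left x)"
        using zeta_left_limit(1,2)[of x] z by (intro order_tendstoD(1)[of _ "left_lim \<zeta> x"]) (auto simp: \<epsilon>_def)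
      then obtain l where "l < x" "\<And>y. l < y \<Longrightarrow> y < x \<Longrightarrow> \<epsilon> < \<zeta> y"
        unfolding eventually_at_left_field by blast
      then show ?thesis using that[of l] by blast
    qed
    have "\<epsilon> \<le> \<zeta> y" if "a \<le> x" "x \<le> b" "b - a < min (r - x) (x - l)" "y \<in> {a..b}" "y \<in> {- BL..BR}" for a b y
      using r(2)[of y] l(2)[of y] that z by (cases y x rule: linorder_cases) (auto simp: \<epsilon>_def)
    moreover have "0 < \<epsilon>" using z by (simp add: \<epsilon>_def)
    ultimately show "\<exists>\<delta>>0. \<forall>a b. a \<le> x \<and> x \<le> b \<and> b - a < \<delta> \<longrightarrow>
        (\<exists>\<epsilon>>0. \<forall>x\<in>{a..b}. x \<in> {- BL..BR} \<longrightarrow> \<epsilon> \<le> \<zeta> x)"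
      using r(1) l(1) by (intro exI[of _ "min (r - x) (x - l)"]) (auto intro!: exI[of _ \<epsilon>])
  qed (use pos in auto)
  then show ?thesis by blast
qed

lemma INF_zeta_pos:
  assumes d: "0 < d" "J d < 1"
  shows "(INF x\<in>{- BL..BR}. \<zeta> x) > 0"
proof -
  obtain \<epsilon> where "0 < \<epsilon>" "\<forall>x\<in>{- BL..BR}. \<epsilon> \<le> \<zeta> x" using zeta_bounded_below[OF d] by blast
  then have "\<epsilon> \<le> (INF x\<in>{- BL..BR}. \<zeta> x)" using pos by (intro cINF_greatest) auto
  then show ?thesis using \<open>0 < \<epsilon>\<close> by simp
qed

end

section \<open>Existence, uniqueness and characterisation of the wave shape\<close>

context jump_frame
begin

lemma particle_intro: "dist_fun \<gamma> \<Longrightarrow> particle \<eta> J w BL BR \<gamma>"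
  by (intro particle.intro jump_frame_axioms particle_axioms.intro)

lemma framed_intro:
  assumes "dist_fun_on_frame BL BR \<gamma>"
  shows "framed \<eta> J w BL BR \<gamma>"
  using assms by (intro framed.intro particle_intro framed_axioms.intro) (auto simp: dist_fun_on_frame_def)

lemma travelling_wave_iff_wave_shape:
  "travelling_wave_shape \<eta> J w BL BR \<gamma> \<longleftrightarrow> wave_shape \<eta> J w BL BR \<gamma>"
proof
  assume t: "travelling_wave_shape \<eta> J w BL BR \<gamma>"
  then have fr: "dist_fun_on_frame BL BR \<gamma>" by (simp add: travelling_wave_shape_def)
  interpret framed \<eta> J w BL BR \<gamma> by (rule framed_intro[OF fr])
  have b: "flux_balanced w BL BR p J \<mu>"
    using t travelling_wave_iff_flux_balanced by blast
  show "wave_shape \<eta> J w BL BR \<gamma>"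
    by (intro wave_shape.intro continuous_framed.intro framed_axioms continuous_framed_axioms.intro
        wave_shape_axioms.intro b lipschitz_on_continuous_on[OF lipschitz_of_balanced[OF b]])
next
  assume "wave_shape \<eta> J w BL BR \<gamma>"
  then interpret wave_shape \<eta> J w BL BR \<gamma> .
  show "travelling_wave_shape \<eta> J w BL BR \<gamma>"
    using travelling_wave_iff_flux_balanced frame balanced by blast
qed

lemma wave_shape_unique:
  assumes "wave_shape \<eta> J w BL BR f" "wave_shape \<eta> J w BL BR g"
  shows "f = g"
proof
  interpret f: wave_shape \<eta> J w BL BR f by fact
  interpret g: wave_shape \<eta> J w BL BR g by fact
  fix x
  consider "x < - BL" | "x \<in> {- BL..BR}" | "BR < x" by force
  then show "f x = g x"
  proof cases
    case 1
    have *: "h x = 0" if "dist_fun_on_frame BL BR h" for h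
    proof -
      have d: "dist_fun h" "left_lim h (- BL) = 0" using that by (auto simp: dist_fun_on_frame_def)
      interpret real_distribution "interval_measure h" by (rule real_distribution_of_dist_fun[OF d(1)])
      have "measure (interval_measure h) {..x} \<le> measure (interval_measure h) {..<- BL}"
        using 1 by (intro finite_measure_mono) auto
      then show ?thesis
        using d left_lim_eq_measure[OF d(1), of "- BL"] dist_fun_bounds[OF d(1), of x]
        by (simp add: measure_of_dist_fun)
    qed
    from *[OF f.frame] *[OF g.frame] show ?thesis by simp
  next
    case 2
    have vf: "volterra f"
      using f.balanced unfolding f.balanced_iff_volterra volterra_def conv_def .
    have vg: "volterra g"
      using g.balanced unfolding g.balanced_iff_volterra volterra_def conv_def .
    show ?thesis
      by (rule volterra_unique[OF vf vg f.\<gamma>_measurable g.\<gamma>_measurable _ _ _ _ 2])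
         (simp_all add: f.\<gamma>_bounds g.\<gamma>_bounds f.\<gamma>_right g.\<gamma>_right)
  next
    case 3
    then show ?thesis by (simp add: f.\<gamma>_right g.\<gamma>_right)
  qed
qed

lemma ex1_travelling_wave: "\<exists>!\<gamma>. travelling_wave_shape \<eta> J w BL BR \<gamma>"
proof -
  obtain \<gamma> where g: "dist_fun_on_frame BL BR \<gamma>" "continuous_on {- BL..BR} \<gamma>" "volterra \<gamma>"
    using ex_volterra_frame by blast
  interpret continuous_framed \<eta> J w BL BR \<gamma>
    by (intro continuous_framed.intro framed_intro continuous_framed_axioms.intro g)
  have "flux_balanced w BL BR p J \<mu>"
    using g(3) unfolding balanced_iff_volterra volterra_def conv_def .
  then have "wave_shape \<eta> J w BL BR \<gamma>"
    by (intro wave_shape.intro continuous_framed_axioms wave_shape_axioms.intro)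
  then show ?thesis
    using wave_shape_unique by (auto simp: travelling_wave_iff_wave_shape)
qed

end

text \<open>Otherwise all jumps would have size \<open>0\<close>, contradicting their mean \<open>1\<close>.\<close>

lemma dist_fun_less_1_near_0:
  assumes J: "dist_fun J" "\<And>y. y < 0 \<Longrightarrow> J y = 0"
    and mean: "(LINT y:{0..}|interval_measure J. y) = 1"
  shows "\<exists>d>0. J d < 1"
proof -
  interpret real_distribution "interval_measure J" by (rule real_distribution_of_dist_fun[OF J(1)])
  have "J 0 < 1"
  proof (rule ccontr)
    assume "\<not> J 0 < 1"
    then have "measure (interval_measure J) {..0} = 1"
      using dist_fun_bounds[OF J(1), of 0] measure_of_dist_fun[OF J(1)] by simp
    then have "AE y in interval_measure J. y \<in> {..0}" by (rule AE_prob_1)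
    then have "(LINT y:{0..}|interval_measure J. y) = (LINT y|interval_measure J. 0)"
      unfolding set_lebesgue_integral_def
      by (intro integral_cong_AE) (auto elim!: eventually_mono simp: indicator_def)
    then show False using mean by simp
  qed
  moreover have "(J \<longlongrightarrow> J 0) (at_right 0)"
    using dist_fun_right_cont[OF J(1), of 0] by (simp add: continuous_within)
  ultimately have "eventually (\<lambda>y. J y < 1) (at_right 0)" by (intro order_tendstoD(2))
  then obtain b where "0 < b" "\<And>y. 0 < y \<Longrightarrow> y < b \<Longrightarrow> J y < 1"
    unfolding eventually_at_right_field by blast
  then show ?thesis by (intro exI[of _ "b / 2"]) auto
qed

text \<open>Both parts reduce to flux balance: travelling waves are the flux-balanced environments, and for those the
  conditions on \<open>\<zeta>\<close> follow from the integrated balance; conversely, the right derivatives integrate back to it.\<close>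

theorem lemma5p3:
  fixes \<eta> J :: "real \<Rightarrow> real" and l :: nat and w BL BR :: real
  assumes eta_range: "\<eta> ` {0..1} \<subseteq> {0..1}"
    and eta_cont: "continuous_on {0..1} \<eta>"
    and eta_decr: "strict_antimono_on {0..1} \<eta>"
    and eta_ends: "\<eta> 0 = 1" "\<eta> 1 = 0"
    and J_dist: "dist_fun J"
    and J_nonneg: "\<And>y. y < 0 \<Longrightarrow> J y = 0"
    and l: "l \<ge> 2"
    and J_moment: "set_integrable (interval_measure J) {0..} (\<lambda>y. y ^ l)"
    and J_mean: "(LINT y:{0..}|interval_measure J. y) = 1"
    and pos: "w > 0" "BL > 0" "BR > 0"
  shows "(\<exists>!\<gamma>. travelling_wave_shape \<eta> J w BL BR \<gamma>) \<and>
    (\<forall>\<gamma>. dist_fun \<gamma> \<longrightarrow>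
      (\<gamma> = TW \<eta> J w BL BR \<longleftrightarrow>
        (1 / w)-lipschitz_on {- BL..BR} \<gamma> \<and>
        (left_lim \<gamma> (- BL) = 0 \<and> 0 < \<gamma> (- BL) \<and> \<gamma> BR = 1) \<and>
        ((AE x in lebesgue. x \<in> {- BL<..<BR} \<longrightarrow> \<gamma> field_differentiable (at x)) \<and>
         (\<forall>x\<in>{- BL<..<BR}. \<gamma> field_differentiable (at x) \<longrightarrow>
            w * deriv \<gamma> x = zeta \<eta> J BL \<gamma> x)) \<and>
        (rcll_on {- BL..BR} (zeta \<eta> J BL \<gamma>) \<and>
         (\<forall>x\<in>{- BL<..BR}. left_lim (zeta \<eta> J BL \<gamma>) x \<ge> zeta \<eta> J BL \<gamma> x)) \<and>
        ((\<forall>x\<in>{- BL..<BR}. \<exists>D. (\<gamma> has_real_derivative D) (at_right x) \<and>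
            w * D = zeta \<eta> J BL \<gamma> x) \<and>
         (\<forall>x\<in>{- BL<..BR}. \<exists>D. (\<gamma> has_real_derivative D) (at_left x) \<and>
            w * D = left_lim (zeta \<eta> J BL \<gamma>) x)) \<and>
        (INF x\<in>{- BL..BR}. zeta \<eta> J BL \<gamma> x) > 0))"
proof -
  interpret jump_frame \<eta> J w BL BR
    by unfold_locales (use assms in auto)
  obtain d where d: "0 < d" "J d < 1"
    using dist_fun_less_1_near_0[OF J_dist J_nonneg J_mean] by blast
  have TW: "\<gamma> = TW \<eta> J w BL BR \<longleftrightarrow> wave_shape \<eta> J w BL BR \<gamma>" for \<gamma>
    unfolding TW_def travelling_wave_iff_wave_shape[symmetric]
    using ex1_travelling_wave theI'[OF ex1_travelling_wave] by (metis (no_types))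
  show ?thesis
  proof (rule conjI[OF ex1_travelling_wave], intro allI impI iffI, goal_cases)
    case (1 \<gamma>)
    then interpret wave_shape \<eta> J w BL BR \<gamma> by (simp only: TW)
    show ?case
    proof (intro conjI ballI impI)
      show "(1 / w)-lipschitz_on {- BL..BR} \<gamma>" by (rule lipschitz_of_balanced[OF balanced])
      show "left_lim \<gamma> (- BL) = 0" "\<gamma> BR = 1" using frame by (auto simp: dist_fun_on_frame_def)
      show "0 < \<gamma> (- BL)" by (rule atom_pos)
      show "AE x in lebesgue. x \<in> {- BL<..<BR} \<longrightarrow> \<gamma> field_differentiable (at x)"
        by (rule AE_differentiable)
      show "rcll_on {- BL..BR} \<zeta>" by (rule zeta_rcll)
      show "(INF x\<in>{- BL..BR}. \<zeta> x) > 0" by (rule INF_zeta_pos[OF d])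
    next
      fix x assume "x \<in> {- BL<..<BR}" "\<gamma> field_differentiable (at x)"
      then show "w * deriv \<gamma> x = \<zeta> x" by (rule regular_derivative)
    next
      fix x assume "x \<in> {- BL<..BR}"
      then show "\<zeta> x \<le> left_lim \<zeta> x" by (intro zeta_left_limit(2)) simp
    next
      fix x assume "x \<in> {- BL..<BR}"
      then show "\<exists>D. (\<gamma> has_real_derivative D) (at_right x) \<and> w * D = \<zeta> x"
        using pos by (intro exI[of _ "\<zeta> x / w"] conjI right_derivative) auto
    next
      fix x assume "x \<in> {- BL<..BR}"
      then show "\<exists>D. (\<gamma> has_real_derivative D) (at_left x) \<and> w * D = left_lim \<zeta> x"
        using pos by (intro exI[of _ "left_lim \<zeta> x / w"] conjI left_derivative) auto
    qed
  next
    case (2 \<gamma>)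
    note R = 2(2)
    then have fr: "dist_fun_on_frame BL BR \<gamma>" using 2(1) by (simp add: dist_fun_on_frame_def)
    have lip: "(1 / w)-lipschitz_on {- BL..BR} \<gamma>"
      and right: "\<forall>x\<in>{- BL..<BR}. \<exists>D. (\<gamma> has_real_derivative D) (at_right x) \<and>
          w * D = zeta \<eta> J BL \<gamma> x" using R by blast+
    interpret continuous_framed \<eta> J w BL BR \<gamma>
      by (intro continuous_framed.intro framed_intro fr continuous_framed_axioms.intro
          lipschitz_on_continuous_on[OF lip])
    have "wave_shape \<eta> J w BL BR \<gamma>"
      by (intro wave_shape.intro continuous_framed_axioms wave_shape_axioms.intro
          balanced_of_right_derivative right)
    then show "\<gamma> = TW \<eta> J w BL BR" by (simp only: TW)
  qed
qed

end
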